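(* Let $\ell\subset\mathbb R^2$ be any fixed line. Let $\frac12<p<1$ and let $E\subset[0,1]^2$ be the random fractal percolation set with parameter $p$. Then \[ 0<\mathcal H^1(V_\ell(E))<\infty \] almost surely conditioned on non-extinction (that is, $E\neq\emptyset$) and $E\cap\ell=\emptyset$.
   Context: Fractal percolation: let $0<p<1$ and $Q_0=[0,1]\times[0,1]$. Divide $Q_0$ into four closed subsquares of equal size; each is chosen with probability $p$ and dropped with probability $1-p$, independently of each other. Let $\mathcal C_1$ be the collection of chosen subsquares. Each $Q\in\mathcal C_1$ is again divided into four subsquares of equal size, each chosen with probability $p$ independently; the collection of all chosen squares at the second level is $\mathcal C_2$. Continue inductively to define $\mathcal C_n$ (consisting of squares of side length $2^{-n}$), and set $E=\bigcap_{n=1}^\infty\bigcup\{Q: Q\in\mathcal C_n\}$. The probability measure induced on the space of constructions is $\mathbf P$. Visible part: for compact $E\subset\mathbb R^2$ and an affine line $\ell$ with $\ell\cap E=\emptyset$, $V_\ell(E)=\{a\in E: [a,\Pi_\ell(a)]\cap E=\{a\}\}$, where $\Pi_\ell$ is the orthogonal projection onto $\ell$ and $[a,b]$ is the closed line segment from $a$ to $b$. $\mathcal H^1$ is the 1-dimensional Hausdorff measure. *)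

theory Defs
  imports "HOL-Probability.Probability"
begin

text \<open>
  The plane is \<^typ>\<open>real \<times> real\<close>, which carries the Euclidean metric and inner product.
  \<open>hausdorff_measure s\<close> uses arbitrary (not only open or closed) countable covers and no
  normalising constant.  It is meant for \<open>s > 0\<close>: then \<open>0 powr s = 0\<close>, so
  empty covering sets contribute nothing.  The boundedness condition is needed because
  \<^const>\<open>diameter\<close> is \<open>0\<close> on unbounded sets.
\<close>

definition hausdorff_premeasure :: "real \<Rightarrow> real \<Rightarrow> 'a::metric_space set \<Rightarrow> ennreal" where
  "hausdorff_premeasure s \<delta> A =
     (INF U \<in> {U :: nat \<Rightarrow> 'a set.
                 (\<forall>k. bounded (U k) \<and> diameter (U k) \<le> \<delta>) \<and> A \<subseteq> (\<Union>k. U k)}.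
        \<Sum>k. ennreal (diameter (U k) powr s))"

definition hausdorff_measure :: "real \<Rightarrow> 'a::metric_space set \<Rightarrow> ennreal" where
  "hausdorff_measure s A = (SUP \<delta> \<in> {0<..}. hausdorff_premeasure s \<delta> A)"


definition is_line :: "'a::euclidean_space set \<Rightarrow> bool" where
  "is_line l \<longleftrightarrow> affine l \<and> aff_dim l = 1"

definition orth_proj :: "'a::euclidean_space set \<Rightarrow> 'a \<Rightarrow> 'a" where
  "orth_proj l a = (THE b. b \<in> l \<and> (\<forall>c\<in>l. orthogonal (a - b) (c - b)))"

definition visible_part :: "'a::euclidean_space set \<Rightarrow> 'a set \<Rightarrow> 'a set" where
  "visible_part l E = {a \<in> E. closed_segment a (orth_proj l a) \<inter> E = {a}}"


text \<open>
  A dyadic square of level \<open>n\<close> is given by the pair \<open>(i, j)\<close> with \<open>i, j < 2 ^ n\<close>; its parent is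
  \<open>(i div 2, j div 2)\<close> at level \<open>n - 1\<close>.  A construction is a function \<open>\<omega>\<close> telling for each
  \<open>(n, i, j)\<close> whether that square is kept, should its parent have been chosen.  The coin tosses
  of squares whose parent is not chosen, and those at indices which are not squares
  (\<open>n = 0\<close>, or \<open>i \<ge> 2 ^ n\<close>, or \<open>j \<ge> 2 ^ n\<close>), have no influence on \<open>chosen\<close>.
\<close>

definition dyadic_square :: "nat \<Rightarrow> nat \<times> nat \<Rightarrow> (real \<times> real) set" where
  "dyadic_square n = (\<lambda>(i, j). {real i / 2 ^ n .. (real i + 1) / 2 ^ n} \<times>
                               {real j / 2 ^ n .. (real j + 1) / 2 ^ n})"

primrec chosen :: "(nat \<times> nat \<times> nat \<Rightarrow> bool) \<Rightarrow> nat \<Rightarrow> (nat \<times> nat) set" where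
  "chosen \<omega> 0 = {(0, 0)}"
| "chosen \<omega> (Suc n) = {(i, j). (i div 2, j div 2) \<in> chosen \<omega> n \<and> \<omega> (Suc n, i, j)}"

definition percolation_set :: "(nat \<times> nat \<times> nat \<Rightarrow> bool) \<Rightarrow> (real \<times> real) set" where
  "percolation_set \<omega> = (\<Inter>n\<in>{1..}. \<Union>q\<in>chosen \<omega> n. dyadic_square n q)"

definition percolation_measure :: "real \<Rightarrow> (nat \<times> nat \<times> nat \<Rightarrow> bool) measure" where
  "percolation_measure p = (\<Pi>\<^sub>M _\<in>UNIV. measure_pmf (bernoulli_pmf p))"

text \<open>\<^const>\<open>uniform_measure\<close> \<open>M A\<close> is the conditional probability given the event \<open>A\<close>.\<close>

definition conditioned_percolation ::
    "real \<Rightarrow> (real \<times> real) set \<Rightarrow> (nat \<times> nat \<times> nat \<Rightarrow> bool) measure" where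
  "conditioned_percolation p l =
     uniform_measure (percolation_measure p)
       {\<omega> \<in> space (percolation_measure p). percolation_set \<omega> \<noteq> {} \<and> percolation_set \<omega> \<inter> l = {}}"


lemma orth_proj_eqI:
  assumes "b \<in> l" "\<And>c. c \<in> l \<Longrightarrow> orthogonal (a - b) (c - b)"
  shows "orth_proj l a = b"
  unfolding orth_proj_def
proof (rule the_equality)
  fix b' assume b': "b' \<in> l \<and> (\<forall>c\<in>l. orthogonal (a - b') (c - b'))"
  have "(a - b) \<bullet> (b' - b) = 0" "(a - b') \<bullet> (b - b') = 0"
    using assms b' by (auto simp: orthogonal_def)
  then have "(b' - b) \<bullet> (b' - b) = 0"
    by (simp add: inner_diff_left inner_diff_right inner_commute)
  then show "b' = b" by simp
qed (use assms in auto)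

lemma orth_proj_eq_closest_point:
  assumes "affine l" "l \<noteq> {}"
  shows "orth_proj l a = closest_point l a"
proof (rule orth_proj_eqI)
  have cl: "closed l" and cv: "convex l"
    using assms closed_affine_hull[of l] affine_hull_eq[of l] by (metis, metis affine_imp_convex)
  show b: "closest_point l a \<in> l"
    using closest_point_in_set[OF cl assms(2)] .
  let ?b = "closest_point l a"
  fix c assume c: "c \<in> l"
  have "(a - ?b) \<bullet> (c - ?b) \<le> 0"
    by (rule closest_point_dot[OF cv cl c])
  moreover have "2 *\<^sub>R ?b - c \<in> l"
    using mem_affine[OF assms(1) b c, of 2 "-1"] by simp
  then have "(a - ?b) \<bullet> (2 *\<^sub>R ?b - c - ?b) \<le> 0"
    by (rule closest_point_dot[OF cv cl])
  then have "0 \<le> (a - ?b) \<bullet> (c - ?b)"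
    by (simp add: inner_diff_right scaleR_2 inner_add_right)
  ultimately show "orthogonal (a - ?b) (c - ?b)"
    by (simp add: orthogonal_def)
qed

lemma prob_space_percolation_measure: "prob_space (percolation_measure p)"
  unfolding percolation_measure_def
  by (intro prob_space_PiM measure_pmf.prob_space_axioms)

lemma space_percolation_measure [simp]: "space (percolation_measure p) = UNIV"
  by (simp add: percolation_measure_def space_PiM)

lemma finite_chosen: "finite (chosen \<omega> n)"
proof -
  have "i < 2 ^ n \<and> j < 2 ^ n" if "(i, j) \<in> chosen \<omega> n" for i j
    using that by (induction n arbitrary: i j) (fastforce simp: less_mult_imp_div_less)+
  then have "chosen \<omega> n \<subseteq> {..<2^n} \<times> {..<2^n}" by auto
  then show ?thesis by (rule finite_subset) simp
qed

lemma dyadic_square_parent: "dyadic_square (Suc n) (i, j) \<subseteq> dyadic_square n (i div 2, j div 2)"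
proof -
  have *: "{real i / 2 ^ Suc n .. (real i + 1) / 2 ^ Suc n} \<subseteq>
           {real (i div 2) / 2 ^ n .. (real (i div 2) + 1) / 2 ^ n}" for i
  proof -
    have "2 * (i div 2) \<le> i" "i + 1 \<le> 2 * (i div 2) + 2" by linarith+
    then have "real (2 * (i div 2)) \<le> real i" "real (i + 1) \<le> real (2 * (i div 2) + 2)"
      unfolding of_nat_le_iff by auto
    then have "2 * real (i div 2) / 2 ^ Suc n \<le> real i / 2 ^ Suc n"
        "(real i + 1) / 2 ^ Suc n \<le> (2 * (real (i div 2) + 1)) / 2 ^ Suc n"
      by (intro divide_right_mono; simp)+
    moreover have "2 * x / 2 ^ Suc n = x / 2 ^ n" for x :: real by simp
    ultimately show ?thesis by (metis atLeastatMost_subset_iff)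
  qed
  show ?thesis
    unfolding dyadic_square_def prod.case using *[of i] *[of j] by blast
qed

lemma percolation_set_disjoint_iff:
  assumes "closed K"
  shows "percolation_set \<omega> \<inter> K = {} \<longleftrightarrow>
         (\<exists>n\<ge>1. \<forall>q\<in>chosen \<omega> n. dyadic_square n q \<inter> K = {})"
proof
  assume *: "percolation_set \<omega> \<inter> K = {}"
  define F where "F n = (\<Union>q\<in>chosen \<omega> (Suc n). dyadic_square (Suc n) q) \<inter> K" for n
  have compact: "compact (F n)" for n
    unfolding F_def dyadic_square_def
    by (intro compact_Int_closed compact_UN finite_chosen assms)
      (auto intro!: compact_Times)
  have "F (Suc n) \<subseteq> F n" for n
  proof
    fix x assume "x \<in> F (Suc n)"
    then obtain i j where ij: "(i, j) \<in> chosen \<omega> (Suc (Suc n))"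
        "x \<in> dyadic_square (Suc (Suc n)) (i, j)" "x \<in> K"
      unfolding F_def by auto
    then have "(i div 2, j div 2) \<in> chosen \<omega> (Suc n)" by simp
    moreover have "x \<in> dyadic_square (Suc n) (i div 2, j div 2)"
      using ij dyadic_square_parent by blast
    ultimately show "x \<in> F n"
      unfolding F_def using ij(3) by blast
  qed
  then have "decseq F" by (rule decseq_SucI)
  have "(\<Inter>n. F n) \<subseteq> percolation_set \<omega> \<inter> K"
  proof
    fix x assume x: "x \<in> (\<Inter>n. F n)"
    have "x \<in> (\<Union>q\<in>chosen \<omega> n. dyadic_square n q)" if "n \<ge> 1" for n
    proof -
      have "x \<in> F (n - 1)" using x by blast
      then show ?thesis using that by (simp add: F_def)
    qed
    moreover have "x \<in> K" using x by (auto simp: F_def)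
    ultimately show "x \<in> percolation_set \<omega> \<inter> K"
      by (simp add: percolation_set_def)
  qed
  then have "(\<Inter>n. F n) = {}" using * by blast
  then obtain n where "F n = {}"
    using compact_nest[of F] compact \<open>decseq F\<close> unfolding decseq_def by blast
  then show "\<exists>n\<ge>1. \<forall>q\<in>chosen \<omega> n. dyadic_square n q \<inter> K = {}"
    by (intro exI[of _ "Suc n"]) (auto simp: F_def)
next
  assume "\<exists>n\<ge>1. \<forall>q\<in>chosen \<omega> n. dyadic_square n q \<inter> K = {}"
  then obtain n where n: "n \<ge> 1" "\<forall>q\<in>chosen \<omega> n. dyadic_square n q \<inter> K = {}"
    by blast
  have "percolation_set \<omega> \<subseteq> (\<Union>q\<in>chosen \<omega> n. dyadic_square n q)"
    unfolding percolation_set_def using n(1) by (intro INF_lower) simp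
  then show "percolation_set \<omega> \<inter> K = {}" using n(2) by blast
qed

lemma chosen_measurable [measurable]:
  "Measurable.pred (percolation_measure p) (\<lambda>\<omega>. q \<in> chosen \<omega> n)"
proof (induction n arbitrary: q)
  case (Suc n)
  have [measurable]: "Measurable.pred (percolation_measure p) (\<lambda>\<omega>. \<omega> k)" for k
  proof -
    have "(\<lambda>\<omega>. \<omega> k) \<in> percolation_measure p \<rightarrow>\<^sub>M measure_pmf (bernoulli_pmf p)"
      unfolding percolation_measure_def by (rule measurable_component_singleton) simp
    then show ?thesis by (simp add: measurable_def)
  qed
  note Suc.IH [measurable]
  show ?case by (cases q) simp
qed simp

lemma sets_percolation_disjoint:
  assumes "closed K"
  shows "Measurable.pred (percolation_measure p) (\<lambda>\<omega>. percolation_set \<omega> \<inter> K = {})"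
proof -
  have "(percolation_set \<omega> \<inter> K = {}) \<longleftrightarrow>
        (\<exists>n. n \<ge> 1 \<and> (\<forall>q. q \<in> chosen \<omega> n \<longrightarrow> dyadic_square n q \<inter> K = {}))" for \<omega>
    unfolding percolation_set_disjoint_iff[OF assms] by blast
  then show ?thesis by simp
qed

lemma sets_conditioning_event:
  assumes "affine l"
  shows "{\<omega> \<in> space (percolation_measure p).
            percolation_set \<omega> \<noteq> {} \<and> percolation_set \<omega> \<inter> l = {}} \<in> sets (percolation_measure p)"
proof -
  have [measurable]: "Measurable.pred (percolation_measure p) (\<lambda>\<omega>. percolation_set \<omega> = {})"
    using sets_percolation_disjoint[of UNIV] by simp
  have [measurable]: "Measurable.pred (percolation_measure p) (\<lambda>\<omega>. percolation_set \<omega> \<inter> l = {})"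
    using sets_percolation_disjoint[of l] assms closed_affine_hull[of l] affine_hull_eq[of l] by metis
  show ?thesis by measurable
qed

lemma AE_conditioned_percolation_iff:
  assumes "affine l"
  shows "(AE \<omega> in conditioned_percolation p l. P \<omega>) \<longleftrightarrow>
         (AE \<omega> in percolation_measure p.
            percolation_set \<omega> \<noteq> {} \<longrightarrow> percolation_set \<omega> \<inter> l = {} \<longrightarrow> P \<omega>)"
proof (cases "emeasure (percolation_measure p) {\<omega> \<in> space (percolation_measure p).
            percolation_set \<omega> \<noteq> {} \<and> percolation_set \<omega> \<inter> l = {}} = 0")
  case True
  let ?M = "percolation_measure p"
  let ?A = "{\<omega> \<in> space ?M. percolation_set \<omega> \<noteq> {} \<and> percolation_set \<omega> \<inter> l = {}}"
  have null: "?A \<in> null_sets ?M"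
    using True sets_conditioning_event[OF assms] by (simp add: null_sets_def)
  then have notin: "AE \<omega> in ?M. \<omega> \<notin> ?A" by (rule AE_not_in)
  have "(\<lambda>\<omega>. indicator ?A \<omega> / emeasure ?M ?A) \<in> borel_measurable ?M"
    using sets_conditioning_event[OF assms] by measurable
  then have "AE \<omega> in conditioned_percolation p l. P \<omega>"
    unfolding conditioned_percolation_def uniform_measure_def
  proof (subst AE_density)
    show "AE \<omega> in ?M. 0 < indicator ?A \<omega> / emeasure ?M ?A \<longrightarrow> P \<omega>"
      using notin by (rule eventually_mono) simp
  qed
  moreover have "AE \<omega> in ?M. percolation_set \<omega> \<noteq> {} \<longrightarrow> percolation_set \<omega> \<inter> l = {} \<longrightarrow> P \<omega>"
    using notin by (auto elim!: eventually_mono)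
  ultimately show ?thesis by blast
next
  case False
  interpret prob_space "percolation_measure p"
    by (rule prob_space_percolation_measure)
  show ?thesis
    unfolding conditioned_percolation_def
    using False emeasure_finite
    by (subst AE_uniform_measure) (auto simp: less_top[symmetric])
qed

end

theory Submission
  imports Defs "HOL-Real_Asymp.Real_Asymp"
begin

text \<open>
  Let \<open>(u, v)\<close> be a unit normal of the line.  The lines of sight are then the level sets of
  \<open>proj u v\<close>, and everything reduces to how the percolation set \<open>E\<close> meets them.

  Follow one line of sight and add up the lengths that it has in the chosen
  squares of level \<open>n\<close>, in units of \<open>2^-n\<close>.  One step of the construction multiplies this number by
  \<open>2 p > 1\<close> on average, and by Hoeffding's inequality it falls short of a growth factor
  between \<open>1\<close> and \<open>2 p\<close> with a probability that is exponentially small in the number itself, that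
  is, doubly exponentially small in \<open>n\<close>.  Only exponentially many lines of sight have to be
  tested at level \<open>n\<close>, so with positive probability the growth never fails on any line of sight
  that stays away from the two ends of the shadow of the unit square
  (\<open>percolation_weights_survive\<close>).  Then all these lines meet \<open>E\<close>: the projection of \<open>E\<close> contains a
  prescribed interval (\<open>prob_covers_pos\<close>, \<open>covers_imp_hit\<close>).

  For positivity, note that the point of \<open>E\<close> on a segment towards the line that is nearest to the line is
  visible, so the visible part has the same projection as \<open>E\<close>.  Projections do not increase
  \<open>H^1\<close>, hence it suffices that almost surely on non-extinction some chosen
  square covers an interval.  The probability that no chosen square does so is less than one and
  at most its image under the generating function of the offspring number, and this forces it to
  be at most the extinction probability (\<open>AE_nonempty_imp_subtree\<close>).

  For finiteness, look from one side and cut the lines of sight into strips of width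
  comparable with \<open>2^-n\<close>.  Every chosen square of level \<open>n\<close> whose shadow contains the strip with some
  room to spare blocks the whole strip with a fixed positive probability, independently of
  the others.  So the expected number of such squares that are not behind a blocking one is
  bounded, and altogether \<open>O(2^n)\<close> squares of level \<open>n\<close> are exposed in this sense on average
  (\<open>expected_exposed_in_le\<close>, \<open>expected_exposed_upto_le\<close>).  A square that is not exposed can contain
  visible points only near an end of its shadow.  Such a point is near
  an end of the shadow of the parent as well only if the square is the extreme child of the
  parent in that direction.  Thus, going up the tree, these squares descend along a single
  corner from a child of an exposed square of some lower level, or from one of the finitely many
  squares of a fixed starting level, and their number is
  controlled by the sum of the numbers of exposed squares of all lower levels, which is again
  \<open>O(2^n)\<close> (\<open>card_squares_meeting_front_visible\<close>).  Fatou's lemma yields infinitely many levels at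
  which \<open>O(2^n)\<close> squares of diameter \<open>O(2^-n)\<close> cover the visible part.
\<close>

section \<open>Independence and self-similarity of the coin tosses\<close>

text \<open>
  Dependence on a set of coordinates is stated for predicates on total functions, so that it can
  be checked by comparing two configurations, without reference to sub-sigma-algebras.
\<close>

definition determined_by :: "'k set \<Rightarrow> (('k \<Rightarrow> 'v) \<Rightarrow> bool) \<Rightarrow> bool" where
  "determined_by K P \<longleftrightarrow> (\<forall>\<omega> \<omega>'. (\<forall>k\<in>K. \<omega> k = \<omega>' k) \<longrightarrow> P \<omega> = P \<omega>')"

lemma determined_byI:
  assumes "\<And>\<omega> \<omega>'. (\<And>k. k \<in> K \<Longrightarrow> \<omega> k = \<omega>' k) \<Longrightarrow> P \<omega> = P \<omega>'"
  shows "determined_by K P"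
  unfolding determined_by_def by (intro allI impI assms) (erule bspec)

lemma determined_byD:
  assumes "determined_by K P" "\<And>k. k \<in> K \<Longrightarrow> \<omega> k = \<omega>' k"
  shows "P \<omega> = P \<omega>'"
  using assms(1)[unfolded determined_by_def, rule_format, OF assms(2)] .

lemma measurable_toss [measurable]: "Measurable.pred (percolation_measure p) (\<lambda>\<omega>. \<omega> k)"
proof -
  have "(\<lambda>\<omega>. \<omega> k) \<in> percolation_measure p \<rightarrow>\<^sub>M measure_pmf (bernoulli_pmf p)"
    unfolding percolation_measure_def by (rule measurable_component_singleton) simp
  then show ?thesis by (simp add: measurable_def)
qed

lemma sets_percolation_iff_pred:
  "{\<omega>. P \<omega>} \<in> sets (percolation_measure p) \<longleftrightarrow> Measurable.pred (percolation_measure p) P"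
  by (simp add: pred_def)

lemma indep_tosses:
  "prob_space.indep_vars (percolation_measure p) (\<lambda>_. count_space UNIV) (\<lambda>k \<omega>. \<omega> k) UNIV"
proof -
  interpret prob_space "percolation_measure p" by (rule prob_space_percolation_measure)
  have *: "distr (percolation_measure p) (count_space UNIV) (\<lambda>\<omega>. \<omega> k) =
      distr (percolation_measure p) (measure_pmf (bernoulli_pmf p)) (\<lambda>\<omega>. \<omega> k)" for k
    by (intro distr_cong) simp_all
  have **: "distr (percolation_measure p) (measure_pmf (bernoulli_pmf p)) (\<lambda>\<omega>. \<omega> k)
      = measure_pmf (bernoulli_pmf p)" for k
    unfolding percolation_measure_def
    by (rule distr_PiM_component) (simp_all add: measure_pmf.prob_space_axioms)
  have id: "distr (percolation_measure p) (Pi\<^sub>M UNIV (\<lambda>_. count_space UNIV)) (\<lambda>\<omega>. \<lambda>k\<in>UNIV. \<omega> k)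
       = percolation_measure p"
  proof -
    have "sets (Pi\<^sub>M UNIV (\<lambda>_. count_space UNIV)) = sets (percolation_measure p)"
      unfolding percolation_measure_def by (rule sets_PiM_cong) simp_all
    then have "distr (percolation_measure p) (Pi\<^sub>M UNIV (\<lambda>_. count_space UNIV)) (\<lambda>\<omega>. \<omega>)
        = percolation_measure p"
      by (intro distr_id2) simp
    then show ?thesis by (simp add: restrict_def)
  qed
  show ?thesis
  proof (subst indep_vars_iff_distr_eq_PiM)
    show "distr (percolation_measure p) (Pi\<^sub>M UNIV (\<lambda>_. count_space UNIV)) (\<lambda>\<omega>. \<lambda>k\<in>UNIV. \<omega> k) =
        (\<Pi>\<^sub>M k\<in>UNIV. distr (percolation_measure p) (count_space UNIV) (\<lambda>\<omega>. \<omega> k))"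
      unfolding * ** id by (rule percolation_measure_def)
  qed simp_all
qed

lemma prob_toss:
  assumes "0 \<le> p" "p \<le> 1"
  shows "measure (percolation_measure p) {\<omega>. \<omega> k} = p"
proof -
  interpret prob_space "percolation_measure p" by (rule prob_space_percolation_measure)
  have **: "distr (percolation_measure p) (measure_pmf (bernoulli_pmf p)) (\<lambda>\<omega>. \<omega> k)
      = measure_pmf (bernoulli_pmf p)"
    unfolding percolation_measure_def
    by (rule distr_PiM_component) (simp_all add: measure_pmf.prob_space_axioms)
  have "p = measure (measure_pmf (bernoulli_pmf p)) {True}"
    using assms by (simp add: measure_pmf_single)
  also have "\<dots> = measure (distr (percolation_measure p) (measure_pmf (bernoulli_pmf p)) (\<lambda>\<omega>. \<omega> k)) {True}"
    by (simp add: **)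
  also have "\<dots> = measure (percolation_measure p) {\<omega>. \<omega> k}"
  proof (subst measure_distr)
    show "(\<lambda>\<omega>. \<omega> k) \<in> percolation_measure p \<rightarrow>\<^sub>M measure_pmf (bernoulli_pmf p)"
      unfolding percolation_measure_def by (rule measurable_component_singleton) simp
  qed (simp_all add: vimage_def)
  finally show ?thesis by simp
qed

text \<open>
  A predicate that is determined by \<open>K\<close> factors through the restriction of the configuration to \<open>K\<close>, and
  restrictions to disjoint sets are independent.
\<close>

lemma prob_conj_determined_by:
  assumes [measurable]: "Measurable.pred (percolation_measure p) P"
      "Measurable.pred (percolation_measure p) Q"
    and "determined_by K P" "determined_by L Q" "K \<inter> L = {}"
  shows "measure (percolation_measure p) {\<omega>. P \<omega> \<and> Q \<omega>} =
         measure (percolation_measure p) {\<omega>. P \<omega>} * measure (percolation_measure p) {\<omega>. Q \<omega>}"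
proof -
  interpret prob_space "percolation_measure p" by (rule prob_space_percolation_measure)
  let ?N = "\<lambda>K. Pi\<^sub>M K (\<lambda>_. count_space (UNIV :: bool set))"
  have ind: "indep_var (?N K) (\<lambda>\<omega>. restrict \<omega> K) (?N L) (\<lambda>\<omega>. restrict \<omega> L)"
    using indep_var_restrict[OF indep_tosses, of K L] assms(5) by simp
  \<comment> \<open>restrictions are undefined off \<open>K\<close>; filling them up with \<open>False\<close> gives configurations again\<close>
  have ext: "(\<lambda>\<omega> k. if k \<in> K then \<omega> k else False) \<in> ?N K \<rightarrow>\<^sub>M percolation_measure p" for K
    unfolding percolation_measure_def
  proof (rule measurable_PiM_single')
    fix i :: "nat \<times> nat \<times> nat"
    show "(\<lambda>\<omega>. if i \<in> K then \<omega> i else False) \<in> ?N K \<rightarrow>\<^sub>M measure_pmf (bernoulli_pmf p)"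
      by (cases "i \<in> K") (auto simp: measurable_cong_sets[OF refl sets_measure_pmf_count_space])
  qed simp
  define A where "A = {x \<in> space (?N K). P (\<lambda>k. if k \<in> K then x k else False)}"
  define B where "B = {x \<in> space (?N L). Q (\<lambda>k. if k \<in> L then x k else False)}"
  have [measurable]: "A \<in> sets (?N K)" "B \<in> sets (?N L)"
    unfolding A_def B_def pred_def[symmetric] 
    by (rule measurable_compose[OF ext], fact)+
  have "prob ((\<lambda>x. (restrict x K, restrict x L)) -` (A \<times> B) \<inter> space (percolation_measure p)) =
      prob ((\<lambda>x. restrict x K) -` A \<inter> space (percolation_measure p)) *
      prob ((\<lambda>x. restrict x L) -` B \<inter> space (percolation_measure p))"
    by (rule indep_varD[OF ind]) measurable
  moreover have P: "P (\<lambda>k. if k \<in> K then restrict \<omega> K k else False) = P \<omega>" for \<omega>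
    by (rule determined_byD[OF assms(3)]) simp
  moreover have Q: "Q (\<lambda>k. if k \<in> L then restrict \<omega> L k else False) = Q \<omega>" for \<omega>
    by (rule determined_byD[OF assms(4)]) simp
  have "restrict \<omega> K \<in> A \<longleftrightarrow> P \<omega>" "restrict \<omega> L \<in> B \<longleftrightarrow> Q \<omega>" for \<omega>
    unfolding A_def B_def mem_Collect_eq P Q by (auto simp: space_PiM)
  ultimately show ?thesis
    by (simp add: vimage_def)
qed

lemma measurable_reindex [measurable]:
  "(\<lambda>\<omega>. \<omega> \<circ> f) \<in> percolation_measure p \<rightarrow>\<^sub>M percolation_measure p"
  unfolding percolation_measure_def
proof (rule measurable_PiM_single')
  fix k :: "nat \<times> nat \<times> nat"
  show "(\<lambda>\<omega>. (\<omega> \<circ> f) k) \<in> Pi\<^sub>M UNIV (\<lambda>_. measure_pmf (bernoulli_pmf p)) \<rightarrow>\<^sub>M measure_pmf (bernoulli_pmf p)"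
    unfolding comp_apply by (rule measurable_component_singleton) simp
qed simp

lemma prob_reindex:
  assumes "inj f" and [measurable]: "Measurable.pred (percolation_measure p) P"
  shows "measure (percolation_measure p) {\<omega>. P (\<omega> \<circ> f)} = measure (percolation_measure p) {\<omega>. P \<omega>}"
proof -
  have "distr (percolation_measure p) (percolation_measure p) (\<lambda>\<omega>. \<omega> \<circ> f) = percolation_measure p"
    using distr_PiM_reindex[of UNIV "\<lambda>_. measure_pmf (bernoulli_pmf p)" f UNIV] assms(1)
    by (simp add: percolation_measure_def comp_def measure_pmf.prob_space_axioms restrict_def)
  then have "measure (percolation_measure p) {\<omega>. P \<omega>} =
      measure (distr (percolation_measure p) (percolation_measure p) (\<lambda>\<omega>. \<omega> \<circ> f)) {\<omega>. P \<omega>}"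
    by simp
  also have "\<dots> = measure (percolation_measure p) {\<omega>. P (\<omega> \<circ> f)}"
    by (subst measure_distr) (auto simp: vimage_def sets_percolation_iff_pred)
  finally show ?thesis by simp
qed

lemma prob_tosses_pos:
  assumes "0 < p" "p \<le> 1" "finite K"
  shows "0 < measure (percolation_measure p) {\<omega>. \<forall>k\<in>K. \<omega> k}"
  using \<open>finite K\<close>
proof induction
  case empty
  then show ?case
    using prob_space.prob_space[OF prob_space_percolation_measure, of p] by simp
next
  case (insert x K)
  have [measurable]: "Measurable.pred (percolation_measure p) (\<lambda>\<omega>. \<forall>k\<in>K. \<omega> k)"
    using insert(1) by (intro pred_intros_finite) auto
  have "measure (percolation_measure p) {\<omega>. \<omega> x \<and> (\<forall>k\<in>K. \<omega> k)} =
      measure (percolation_measure p) {\<omega>. \<omega> x} * measure (percolation_measure p) {\<omega>. \<forall>k\<in>K. \<omega> k}"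
    by (rule prob_conj_determined_by[where K="{x}" and L=K])
      (use insert in \<open>auto simp: determined_by_def\<close>)
  then show ?case
    using insert assms prob_toss[of p x] by simp
qed

section \<open>The tree of chosen squares\<close>

lemma chosen_index_less: "(i, j) \<in> chosen \<omega> n \<Longrightarrow> i < 2 ^ n \<and> j < 2 ^ n"
  by (induction n arbitrary: i j) (fastforce simp: less_mult_imp_div_less)+

text \<open>
  As \<open>chosen \<omega> n\<close> has only finitely many values, every predicate of it is measurable, even one that
  quantifies over uncountably many lines.
\<close>

lemma measurable_chosen_set [measurable]:
  "(\<lambda>\<omega>. chosen \<omega> n) \<in> percolation_measure p \<rightarrow>\<^sub>M count_space UNIV"
proof -
  have "chosen \<omega> n \<in> Pow ({..<2^n} \<times> {..<2^n})" for \<omega>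
    using chosen_index_less by fastforce
  moreover have "Measurable.pred (percolation_measure p) (\<lambda>\<omega>. chosen \<omega> n = D)" 
    if "D \<in> Pow ({..<2^n} \<times> {..<2^n})" for D
  proof -
    have "(\<lambda>\<omega>. chosen \<omega> n = D) = 
      (\<lambda>\<omega>. \<forall>q. (q \<in> chosen \<omega> n \<longleftrightarrow> q \<in> D))"
      by auto
    then show ?thesis by simp
  qed
  ultimately have "(\<lambda>\<omega>. chosen \<omega> n) \<in> percolation_measure p \<rightarrow>\<^sub>M count_space (Pow ({..<2^n} \<times> {..<2^n}))"
    by (subst measurable_count_space_eq2)
      (auto simp: pred_def vimage_def)
  then show ?thesis
    by (rule measurable_compose) simp
qed

lemma pred_chosen_set [measurable (raw)]:
  "Measurable.pred (percolation_measure p) (\<lambda>\<omega>. P (chosen \<omega> n))"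
  using measurable_compose[OF measurable_chosen_set, of P "count_space UNIV" n p] by simp

lemma chosen_cong:
  assumes "\<And>m i j. 0 < m \<Longrightarrow> m \<le> n \<Longrightarrow> i < 2 ^ m \<Longrightarrow> j < 2 ^ m \<Longrightarrow> \<omega> (m, i, j) = \<omega>' (m, i, j)"
  shows "chosen \<omega> n = chosen \<omega>' n"
  using assms
proof (induction n)
  case (Suc n)
  have IH: "chosen \<omega> n = chosen \<omega>' n" by (rule Suc.IH) (rule Suc.prems, simp_all)
  have "(i, j) \<in> chosen \<omega> (Suc n) \<longleftrightarrow> (i, j) \<in> chosen \<omega>' (Suc n)" for i j
  proof (cases "i < 2 ^ Suc n \<and> j < 2 ^ Suc n")
    case True
    then show ?thesis using Suc.prems[of "Suc n" i j] by (simp add: IH)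
  next
    case False
    then show ?thesis using chosen_index_less[of i j _ "Suc n"] by blast
  qed
  then show ?case by auto
qed simp

lemma chosen_parent:
  assumes "(i, j) \<in> chosen \<omega> (n + k)"
  shows "(i div 2 ^ k, j div 2 ^ k) \<in> chosen \<omega> n"
  using assms
proof (induction k arbitrary: i j)
  case (Suc k)
  then have "(i div 2, j div 2) \<in> chosen \<omega> (n + k)" by simp
  from Suc.IH[OF this] show ?case by (simp add: div_mult2_eq)
qed simp

text \<open>
  The index map that carries the tree below a square onto the whole tree.  It is injective on all
  indices, not only on those that name squares; thus \<open>\<omega> \<circ> subtree m a b\<close> has the law of \<open>\<omega>\<close>.
\<close>

definition subtree :: "nat \<Rightarrow> nat \<times> nat \<Rightarrow> nat \<times> nat \<times> nat \<Rightarrow> nat \<times> nat \<times> nat" where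
  "subtree m q = (\<lambda>(n, i, j). (m + n, fst q * 2 ^ n + i, snd q * 2 ^ n + j))"

lemma inj_subtree: "inj (subtree m q)"
  by (auto simp: inj_def subtree_def)

lemma subtree_0: "subtree 0 (0, 0) = id"
  by (auto simp: subtree_def fun_eq_iff)

lemma subtree_comp:
  "subtree m (a, b) \<circ> subtree n (i, j) = subtree (m + n) (a * 2 ^ n + i, b * 2 ^ n + j)"
  by (auto simp: subtree_def fun_eq_iff power_add algebra_simps)

lemma chosen_subtree_iff:
  assumes "i < 2 ^ n" "j < 2 ^ n"
  shows "(a * 2 ^ n + i, b * 2 ^ n + j) \<in> chosen \<omega> (m + n) \<longleftrightarrow>
         (a, b) \<in> chosen \<omega> m \<and> (i, j) \<in> chosen (\<omega> \<circ> subtree m (a, b)) n"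
  using assms
proof (induction n arbitrary: i j)
  case (Suc n)
  have "(a * 2 ^ Suc n + i) div 2 = a * 2 ^ n + i div 2" "(b * 2 ^ Suc n + j) div 2 = b * 2 ^ n + j div 2"
    by simp_all
  moreover have "i div 2 < 2 ^ n" "j div 2 < 2 ^ n" using Suc.prems by (auto simp: less_mult_imp_div_less)
  ultimately show ?case
    using Suc.IH[of "i div 2" "j div 2"] by (auto simp: subtree_def)
qed auto

text \<open>
  The coordinates that matter for the percolation inside a chosen square.  Contrary to the
  ranges of the maps \<open>subtree m q\<close>, these sets are disjoint for different squares of one level.
\<close>

definition below :: "nat \<Rightarrow> nat \<times> nat \<Rightarrow> (nat \<times> nat \<times> nat) set" where
  "below m q = {subtree m q (n, i, j) | n i j. 0 < n \<and> i < 2 ^ n \<and> j < 2 ^ n}"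

lemma chosen_subtree_cong:
  assumes "\<And>k. k \<in> below m q \<Longrightarrow> \<omega> k = \<omega>' k"
  shows "chosen (\<omega> \<circ> subtree m q) n = chosen (\<omega>' \<circ> subtree m q) n"
  by (rule chosen_cong) (unfold comp_apply, rule assms, unfold below_def, blast)

lemma in_below_iff:
  "(n, i, j) \<in> below m (a, b) \<longleftrightarrow> m < n \<and> i div 2 ^ (n - m) = a \<and> j div 2 ^ (n - m) = b"
proof
  assume "(n, i, j) \<in> below m (a, b)"
  then show "m < n \<and> i div 2 ^ (n - m) = a \<and> j div 2 ^ (n - m) = b"
    by (auto simp: below_def subtree_def)
next
  assume *: "m < n \<and> i div 2 ^ (n - m) = a \<and> j div 2 ^ (n - m) = b"
  then have "(n, i, j) = subtree m (a, b) (n - m, i mod 2 ^ (n - m), j mod 2 ^ (n - m))"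
    by (auto simp: subtree_def mult.commute)
  then show "(n, i, j) \<in> below m (a, b)"
    unfolding below_def using * by (intro CollectI exI conjI) auto
qed

lemma below_disjoint: "q \<noteq> q' \<Longrightarrow> below m q \<inter> below m q' = {}"
  by (cases q; cases q') (auto simp: in_below_iff)

section \<open>Estimates for one-dimensional Hausdorff measure\<close>

lemma diameter_dyadic_square: "diameter (dyadic_square n q) \<le> 2 / 2 ^ n"
proof (rule diameter_le)
  obtain i j where q: "q = (i, j)" by (cases q)
  show "dyadic_square n q \<noteq> {} \<or> 0 \<le> (2 / 2 ^ n :: real)" by simp
  fix x y assume xy: "x \<in> dyadic_square n q" "y \<in> dyadic_square n q"
  obtain x1 x2 y1 y2 where *: "x = (x1, x2)" "y = (y1, y2)" by (cases x; cases y)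
  have "\<bar>x1 - y1\<bar> \<le> (real i + 1) / 2 ^ n - real i / 2 ^ n" "\<bar>x2 - y2\<bar> \<le> (real j + 1) / 2 ^ n - real j / 2 ^ n"
    using xy unfolding * q dyadic_square_def by auto
  then have "\<bar>x1 - y1\<bar> \<le> 1 / 2 ^ n" "\<bar>x2 - y2\<bar> \<le> 1 / 2 ^ n"
    by (simp_all add: diff_divide_distrib[symmetric])
  moreover have "norm (x - y) \<le> norm (x1 - y1) + norm (x2 - y2)"
    unfolding * diff_Pair by (rule norm_Pair_le)
  ultimately show "norm (x - y) \<le> 2 / 2 ^ n" by simp
qed

lemma bounded_dyadic_square: "bounded (dyadic_square n q)"
  by (cases q) (auto simp: dyadic_square_def intro: bounded_Times)

lemma hausdorff_measure_1_le_dyadic: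
  fixes A :: "(real \<times> real) set"
  assumes "\<And>N. \<exists>n\<ge>N. \<exists>D. finite D \<and> A \<subseteq> (\<Union>q\<in>D. dyadic_square n q) \<and> real (card D) \<le> B * 2 ^ n"
  shows "hausdorff_measure 1 A \<le> ennreal (2 * B)"
  unfolding hausdorff_measure_def
proof (rule SUP_least)
  fix \<delta> :: real assume "\<delta> \<in> {0<..}"
  then obtain N where N: "2 / \<delta> < 2 ^ N" using real_arch_pow[of 2 "2 / \<delta>"] by auto
  obtain n D where nD: "n \<ge> N" "finite D" "A \<subseteq> (\<Union>q\<in>D. dyadic_square n q)" "real (card D) \<le> B * 2 ^ n"
    using assms[of N] by blast
  have "2 / \<delta> < 2 ^ n" using N power_increasing[OF nD(1), of "2::real"] by linarith
  then have \<delta>: "2 / 2 ^ n \<le> \<delta>" using \<open>\<delta> \<in> {0<..}\<close> by (simp add: field_simps)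
  obtain f where f: "bij_betw f {0..<card D} D" using ex_bij_betw_nat_finite[OF nD(2)] by blast
  define U where "U k = (if k < card D then dyadic_square n (f k) else {})" for k
  have "A \<subseteq> (\<Union>k. U k)"
  proof
    fix x assume "x \<in> A"
    then obtain q where "q \<in> D" "x \<in> dyadic_square n q" using nD(3) by blast
    moreover from this obtain k where "k < card D" "f k = q"
      using f unfolding bij_betw_def by (metis atLeastLessThan_iff imageE)
    ultimately show "x \<in> (\<Union>k. U k)" by (auto simp: U_def intro!: exI[of _ k])
  qed
  moreover have "bounded (U k) \<and> diameter (U k) \<le> \<delta>" for k
    using diameter_dyadic_square[of n "f k"] \<delta> \<open>\<delta> \<in> {0<..}\<close>
    by (auto simp: U_def bounded_dyadic_square)
  ultimately have "hausdorff_premeasure 1 \<delta> A \<le> (\<Sum>k. ennreal (diameter (U k) powr 1))"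
    unfolding hausdorff_premeasure_def by (intro INF_lower) simp
  also have "\<dots> = (\<Sum>k<card D. ennreal (diameter (U k) powr 1))"
    by (rule suminf_finite) (auto simp: U_def)
  also have "\<dots> \<le> (\<Sum>k<card D. ennreal (2 / 2 ^ n))"
    using diameter_dyadic_square
    by (intro sum_mono ennreal_leI) (auto simp: U_def bounded_dyadic_square diameter_ge_0)
  also have "\<dots> = ennreal (real (card D) * (2 / 2 ^ n))"
    by (simp add: ennreal_of_nat_eq_real_of_nat ennreal_mult[symmetric])
  also have "\<dots> \<le> ennreal (2 * B)"
    using nD(4) by (intro ennreal_leI) (simp add: field_simps)
  finally show "hausdorff_premeasure 1 \<delta> A \<le> ennreal (2 * B)" .
qed

text \<open>
  The images of the sets of a cover of \<open>A\<close> lie in intervals of at most the same diameters, and these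
  intervals cover \<open>{a..b}\<close>.
\<close>

lemma interval_length_le_hausdorff_measure_1:
  fixes f :: "'a::metric_space \<Rightarrow> real"
  assumes f: "\<And>x y. \<bar>f x - f y\<bar> \<le> dist x y" and ab: "{a..b} \<subseteq> f ` A"
  shows "ennreal (b - a) \<le> hausdorff_measure 1 A"
proof -
  have "ennreal (b - a) \<le> (\<Sum>k. ennreal (diameter (U k) powr 1))"
    if U: "\<And>k. bounded (U k)" "A \<subseteq> (\<Union>k. U k)" for U :: "nat \<Rightarrow> 'a set"
  proof -
    define d where "d k = diameter (U k)" for k
    define m where "m k = Inf (f ` U k)" for k
    have cov: "f ` U k \<subseteq> {m k .. m k + d k}" for k
    proof (cases "U k = {}")
      case False
      have dist: "\<bar>f x - f y\<bar> \<le> d k" if "x \<in> U k" "y \<in> U k" for x y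
        using f[of x y] diameter_bounded_bound[OF U(1) that] unfolding d_def by linarith
      obtain x0 where x0: "x0 \<in> U k" using False by blast
      have bdd: "bdd_below (f ` U k)"
        using dist[OF x0] by (intro bdd_belowI2[of _ "f x0 - d k"]) (smt (verit))
      have "f x \<le> m k + d k" if "x \<in> U k" for x
      proof -
        have "f x - d k \<le> m k" unfolding m_def
          using False dist[OF that] by (intro cINF_greatest) (auto simp: abs_le_iff algebra_simps)
        then show ?thesis by simp
      qed
      moreover have "m k \<le> f x" if "x \<in> U k" for x
        unfolding m_def using bdd that by (rule cINF_lower)
      ultimately show ?thesis by auto
    qed simp
    have "{a..b} \<subseteq> (\<Union>k. {m k .. m k + d k})"
    proof
      fix t assume "t \<in> {a..b}"
      then obtain x where x: "x \<in> A" "t = f x" using ab by blast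
      then obtain k where "x \<in> U k" using U(2) by blast
      then show "t \<in> (\<Union>k. {m k .. m k + d k})" using cov[of k] x(2) by blast
    qed
    then have "emeasure lborel {a..b} \<le> emeasure lborel (\<Union>k. {m k .. m k + d k})"
      by (intro emeasure_mono) auto
    also have "\<dots> \<le> (\<Sum>k. emeasure lborel {m k .. m k + d k})"
      by (rule emeasure_subadditive_countably) auto
    also have "\<dots> = (\<Sum>k. ennreal (diameter (U k) powr 1))"
      using U(1) by (intro suminf_cong) (simp add: d_def diameter_ge_0)
    finally have le: "emeasure lborel {a..b} \<le> (\<Sum>k. ennreal (diameter (U k) powr 1))" .
    have "ennreal (b - a) = emeasure lborel {a..b}"
      by (cases "a \<le> b") (simp_all add: ennreal_neg)
    then show ?thesis using le by metis
  qed
  then have "ennreal (b - a) \<le> hausdorff_premeasure 1 1 A"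
    unfolding hausdorff_premeasure_def by (intro INF_greatest) auto
  also have "\<dots> \<le> hausdorff_measure 1 A"
    unfolding hausdorff_measure_def by (rule SUP_upper) simp
  finally show ?thesis .
qed

section \<open>Growth of weighted counts of chosen squares\<close>

definition child_squares :: "(nat \<times> nat) set \<Rightarrow> (nat \<times> nat) set" where
  "child_squares D = {(i, j). (i div 2, j div 2) \<in> D}"

lemma child_squares_eq_image:
  "child_squares D = (\<lambda>((i, j), x, y). (2 * i + x, 2 * j + y)) ` (D \<times> {0, 1} \<times> {0, 1})"
proof -
  have "(i, j) \<in> (\<lambda>((i, j), x, y). (2 * i + x, 2 * j + y)) ` (D \<times> {0, 1} \<times> {0, 1})"
    if "(i div 2, j div 2) \<in> D" for i j
    by (rule image_eqI[of _ _ "((i div 2, j div 2), i mod 2, j mod 2)"]) (use that in auto)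
  then show ?thesis by (auto simp: child_squares_def)
qed

lemma finite_child_squares: "finite D \<Longrightarrow> finite (child_squares D)"
  unfolding child_squares_eq_image by auto

lemma card_child_squares_le: "finite D \<Longrightarrow> card (child_squares D) \<le> 4 * card D"
  unfolding child_squares_eq_image
  by (rule card_image_le[THEN order_trans]) (auto simp: card_cartesian_product)

lemma chosen_Suc_eq: "chosen \<omega> (Suc n) = {q \<in> child_squares (chosen \<omega> n). \<omega> (Suc n, q)}"
  by (auto simp: child_squares_def)

lemma sum_child_squares:
  fixes f g :: "nat \<times> nat \<Rightarrow> real"
  assumes "finite D"
    and "\<And>i j. f (2 * i, 2 * j) + f (2 * i, 2 * j + 1) + f (2 * i + 1, 2 * j) + f (2 * i + 1, 2 * j + 1)
              = 2 * g (i, j)"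
  shows "(\<Sum>q\<in>child_squares D. f q) = 2 * (\<Sum>q\<in>D. g q)"
proof -
  have inj: "inj_on (\<lambda>((i, j), x, y). (2 * i + x, 2 * j + y)) (D \<times> {0, 1::nat} \<times> {0, 1::nat})"
    by (auto simp: inj_on_def) presburger+
  have "(\<Sum>q\<in>child_squares D. f q) = (\<Sum>(q, x, y)\<in>D \<times> {0, 1} \<times> {0, 1}. f (2 * fst q + x, 2 * snd q + y))"
    unfolding child_squares_eq_image
    by (subst sum.reindex[OF inj]) (auto intro!: sum.cong simp: case_prod_unfold)
  also have "\<dots> = (\<Sum>q\<in>D. \<Sum>x\<in>{0, 1}. \<Sum>y\<in>{0, 1}. f (2 * fst q + x, 2 * snd q + y))"
    by (simp only: sum.cartesian_product[symmetric])
  also have "\<dots> = (\<Sum>q\<in>D. 2 * g q)"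
    using assms(2) by (intro sum.cong) (auto simp: add_ac)
  finally show ?thesis by (simp add: sum_distrib_left)
qed

text \<open>
  Hoeffding's inequality involves the sum of the squares of the weights.  Since the weights are at
  most \<open>1\<close>, that sum is at most \<open>sum a I\<close>, and one factor \<open>sum a I\<close> cancels.
\<close>

lemma weighted_toss_sum_lower_tail:
  fixes a :: "nat \<times> nat \<times> nat \<Rightarrow> real"
  assumes p: "0 \<le> p" "p \<le> 1" and I: "finite I" and a: "\<And>k. k \<in> I \<Longrightarrow> 0 \<le> a k \<and> a k \<le> 1" and \<mu>: "\<mu> \<le> p"
  shows "measure (percolation_measure p) {\<omega>. (\<Sum>k\<in>I. a k * of_bool (\<omega> k)) \<le> \<mu> * sum a I}
         \<le> exp (- 2 * (p - \<mu>)\<^sup>2 * sum a I)"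
proof -
  interpret prob_space "percolation_measure p" by (rule prob_space_percolation_measure)
  define X where "X k \<omega> = a k * of_bool (\<omega> k)" for k \<omega>
  have exp: "expectation (X k) = a k * p" for k
  proof -
    have "expectation (X k) = a k * expectation (\<lambda>\<omega>. indicator {\<omega>. \<omega> k} \<omega>)"
      by (simp add: X_def[abs_def] of_bool_def indicator_def)
    then show ?thesis using prob_toss[OF p] by (simp add: sets_percolation_iff_pred)
  qed
  have sum_exp: "(\<Sum>k\<in>I. expectation (X k)) = p * sum a I"
    by (simp add: exp sum_distrib_left mult.commute)
  have sum0: "0 \<le> sum a I" using a by (intro sum_nonneg) auto
  show ?thesis
  proof (cases "sum a I = 0")
    case True
    then show ?thesis by simp
  next
    case False
    then obtain k0 where k0: "k0 \<in> I" "a k0 \<noteq> 0" by (meson sum.neutral)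
    have sq_pos: "0 < (\<Sum>k\<in>I. (a k - 0)\<^sup>2)"
      using k0 I by (intro sum_pos2[of _ k0]) auto
    have sq_le: "(\<Sum>k\<in>I. (a k - 0)\<^sup>2) \<le> sum a I"
      using a by (intro sum_mono) (auto simp: power2_eq_square intro: mult_left_le)
    interpret H: Hoeffding_ineq "percolation_measure p" I X "\<lambda>_. 0" a "\<Sum>k\<in>I. expectation (X k)"
    proof unfold_locales
      have "indep_vars (\<lambda>_. count_space UNIV) (\<lambda>k \<omega>. \<omega> k) I"
        by (rule indep_vars_subset[OF indep_tosses]) simp
      then show "indep_vars (\<lambda>_. borel) X I"
        unfolding X_def by (rule indep_vars_compose2[where Y = "\<lambda>k b. a k * of_bool b"]) simp
    qed (use I a in \<open>auto simp: X_def\<close>)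
    have "prob {\<omega>. (\<Sum>k\<in>I. X k \<omega>) \<le> p * sum a I - (p - \<mu>) * sum a I} \<le>
        exp (- 2 * ((p - \<mu>) * sum a I)\<^sup>2 / (\<Sum>k\<in>I. (a k - 0)\<^sup>2))"
      using H.Hoeffding_ineq_le[OF mult_nonneg_nonneg[of "p - \<mu>", OF _ sum0]] sq_pos \<mu>
      by (simp add: sum_exp)
    also have "\<dots> \<le> exp (- 2 * ((p - \<mu>) * sum a I)\<^sup>2 / sum a I)"
      using sq_pos sq_le by (auto intro!: divide_left_mono mult_pos_pos)
    also have "\<dots> = exp (- 2 * (p - \<mu>)\<^sup>2 * sum a I)"
      using False by (simp add: power2_eq_square)
    finally show ?thesis by (simp add: X_def algebra_simps)
  qed
qed

definition tosses_upto :: "nat \<Rightarrow> (nat \<times> nat \<times> nat) set" where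
  "tosses_upto n = {k. fst k \<le> n}"

lemma chosen_cong_upto:
  assumes "\<And>k. k \<in> tosses_upto n \<Longrightarrow> \<omega> k = \<omega>' k" "m \<le> n"
  shows "chosen \<omega> m = chosen \<omega>' m"
  by (rule chosen_cong) (rule assms(1), use assms(2) in \<open>simp add: tosses_upto_def\<close>)

text \<open>
  Given the chosen squares of level \<open>n\<close>, the weighted count at the next level is a sum of independent
  terms with total mean \<open>2 p\<close> times the count at level \<open>n\<close>.  The event \<open>A\<close> allows
  several levels to be combined.
\<close>

lemma weighted_count_step:
  fixes w :: "nat \<Rightarrow> nat \<times> nat \<Rightarrow> real"
  assumes p: "0 \<le> p" "p \<le> 1" and \<mu>: "\<mu> < p" "0 \<le> \<mu>"
    and w: "\<And>n q. 0 \<le> w n q" "\<And>n q. w n q \<le> 1"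
    and ch: "\<And>n i j. w (Suc n) (2 * i, 2 * j) + w (Suc n) (2 * i, 2 * j + 1) + w (Suc n) (2 * i + 1, 2 * j)
                + w (Suc n) (2 * i + 1, 2 * j + 1) = 2 * w n (i, j)"
    and A[measurable]: "Measurable.pred (percolation_measure p) A" and "determined_by (tosses_upto n) A"
  shows "measure (percolation_measure p)
       {\<omega>. A \<omega> \<and> y \<le> sum (w n) (chosen \<omega> n) \<and>
           sum (w (Suc n)) (chosen \<omega> (Suc n)) < 2 * \<mu> * sum (w n) (chosen \<omega> n)}
     \<le> measure (percolation_measure p) {\<omega>. A \<omega>} * exp (- 4 * (p - \<mu>)\<^sup>2 * y)"
proof -
  interpret prob_space "percolation_measure p" by (rule prob_space_percolation_measure)
  define G where "G = Pow ({..<2 ^ n :: nat} \<times> {..<2 ^ n :: nat})"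
  have "finite G" by (simp add: G_def)
  have inG: "chosen \<omega> n \<in> G" for \<omega> using chosen_index_less by (fastforce simp: G_def)
  define e where "e = exp (- 4 * (p - \<mu>)\<^sup>2 * y)"
  define S where "S D \<omega> \<longleftrightarrow> (\<Sum>k\<in>Pair (Suc n) ` child_squares D. w (Suc n) (snd k) * of_bool (\<omega> k)) \<le>
      \<mu> * (\<Sum>k\<in>Pair (Suc n) ` child_squares D. w (Suc n) (snd k))" for D \<omega>
  have [measurable]: "Measurable.pred (percolation_measure p) (S D)" for D
    unfolding S_def by measurable
  have sum_ch: "(\<Sum>k\<in>Pair (Suc n) ` child_squares D. w (Suc n) (snd k)) = 2 * sum (w n) D" if "D \<in> G" for D
  proof -
    have "finite D" using that finite_subset[of D] by (auto simp: G_def)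
    then show ?thesis
      by (subst sum.reindex) (auto simp: inj_on_def comp_def intro!: sum_child_squares ch)
  qed
  have sum_ch': "sum (w (Suc n)) (chosen \<omega> (Suc n)) =
      (\<Sum>k\<in>Pair (Suc n) ` child_squares (chosen \<omega> n). w (Suc n) (snd k) * of_bool (\<omega> k))" for \<omega>
    unfolding chosen_Suc_eq
    by (subst sum.reindex)
      (auto simp: inj_on_def comp_def of_bool_def if_distrib sum.If_cases finite_child_squares finite_chosen Int_def
        cong: if_cong)
  have one: "prob {\<omega>. (A \<omega> \<and> chosen \<omega> n = D \<and> y \<le> sum (w n) D) \<and> S D \<omega>} \<le> prob {\<omega>. A \<omega> \<and> chosen \<omega> n = D} * e"
    if "D \<in> G" for D
  proof (cases "y \<le> sum (w n) D")
    case False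
    then show ?thesis by (simp add: e_def)
  next
    case True
    have finD: "finite D" using that finite_subset[of D] by (auto simp: G_def)
    have "prob {\<omega>. (A \<omega> \<and> chosen \<omega> n = D) \<and> S D \<omega>} = prob {\<omega>. A \<omega> \<and> chosen \<omega> n = D} * prob {\<omega>. S D \<omega>}"
    proof (rule prob_conj_determined_by)
      show "determined_by (tosses_upto n) (\<lambda>\<omega>. A \<omega> \<and> chosen \<omega> n = D)"
      proof (rule determined_byI)
        fix \<omega> \<omega>' :: "nat \<times> nat \<times> nat \<Rightarrow> bool"
        assume *: "\<And>k. k \<in> tosses_upto n \<Longrightarrow> \<omega> k = \<omega>' k"
        show "(A \<omega> \<and> chosen \<omega> n = D) = (A \<omega>' \<and> chosen \<omega>' n = D)"
          using determined_byD[OF assms(9) *] chosen_cong_upto[OF * order_refl] by simp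
      qed
      show "determined_by (Pair (Suc n) ` child_squares D) (S D)"
        unfolding S_def by (rule determined_byI) (simp cong: sum.cong)
    qed (auto simp: tosses_upto_def)
    also have "\<dots> \<le> prob {\<omega>. A \<omega> \<and> chosen \<omega> n = D} * e"
    proof (rule mult_left_mono)
      have "prob {\<omega>. S D \<omega>} \<le> exp (- 2 * (p - \<mu>)\<^sup>2 * (2 * sum (w n) D))"
        unfolding S_def sum_ch[OF that, symmetric]
        by (rule weighted_toss_sum_lower_tail) (use p \<mu> w finD in \<open>auto intro: finite_child_squares\<close>)
      also have "\<dots> \<le> e"
        unfolding e_def using True by (auto intro!: mult_left_mono)
      finally show "prob {\<omega>. S D \<omega>} \<le> e" .
    qed simp
    finally show ?thesis using True by simp
  qed
  have "prob {\<omega>. A \<omega> \<and> y \<le> sum (w n) (chosen \<omega> n) \<and>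
           sum (w (Suc n)) (chosen \<omega> (Suc n)) < 2 * \<mu> * sum (w n) (chosen \<omega> n)}
      \<le> prob (\<Union>D\<in>G. {\<omega>. (A \<omega> \<and> chosen \<omega> n = D \<and> y \<le> sum (w n) D) \<and> S D \<omega>})"
  proof (rule finite_measure_mono)
    show "(\<Union>D\<in>G. {\<omega>. (A \<omega> \<and> chosen \<omega> n = D \<and> y \<le> sum (w n) D) \<and> S D \<omega>}) \<in> events"
      using \<open>finite G\<close> by (intro sets.finite_UN) (simp_all add: sets_percolation_iff_pred)
    show "{\<omega>. A \<omega> \<and> y \<le> sum (w n) (chosen \<omega> n) \<and>
           sum (w (Suc n)) (chosen \<omega> (Suc n)) < 2 * \<mu> * sum (w n) (chosen \<omega> n)} \<subseteq>
       (\<Union>D\<in>G. {\<omega>. (A \<omega> \<and> chosen \<omega> n = D \<and> y \<le> sum (w n) D) \<and> S D \<omega>})"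
      unfolding S_def using inG by (auto simp: sum_ch' sum_ch simp del: chosen.simps)
  qed
  also have "\<dots> \<le> (\<Sum>D\<in>G. prob {\<omega>. (A \<omega> \<and> chosen \<omega> n = D \<and> y \<le> sum (w n) D) \<and> S D \<omega>})"
    using \<open>finite G\<close> by (intro finite_measure_subadditive_finite) (auto simp: sets_percolation_iff_pred)
  also have "\<dots> \<le> (\<Sum>D\<in>G. prob {\<omega>. A \<omega> \<and> chosen \<omega> n = D} * e)"
    by (rule sum_mono) (rule one)
  also have "\<dots> = prob (\<Union>D\<in>G. {\<omega>. A \<omega> \<and> chosen \<omega> n = D}) * e"
    using \<open>finite G\<close> unfolding sum_distrib_right[symmetric]
    by (subst finite_measure_finite_Union) (auto simp: sets_percolation_iff_pred disjoint_family_on_def)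
  also have "(\<Union>D\<in>G. {\<omega>. A \<omega> \<and> chosen \<omega> n = D}) = {\<omega>. A \<omega>}"
    using inG by auto
  finally show ?thesis by (simp add: e_def)
qed

lemma summable_exponential_beats_geometric:
  fixes c r :: real
  assumes "0 < c" "1 < r"
  shows "summable (\<lambda>n. C * 8 ^ n * exp (- c * r ^ n))"
proof -
  have "(\<lambda>n. C * 16 ^ n * exp (- c * r ^ n)) \<longlonglongrightarrow> 0"
    using assms by real_asymp
  then have "Bseq (\<lambda>n. C * 16 ^ n * exp (- c * r ^ n))"
    by (intro convergent_imp_Bseq convergentI)
  then obtain K where K: "\<And>n. norm (C * 16 ^ n * exp (- c * r ^ n)) \<le> K"
    by (auto simp: Bseq_def)
  show ?thesis
  proof (rule summable_comparison_test')
    show "summable (\<lambda>n. K * (1 / 2) ^ n)"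
      by (intro summable_mult summable_geometric) simp
    fix n
    have "C * 8 ^ n * exp (- c * r ^ n) = C * 16 ^ n * exp (- c * r ^ n) * (1 / 2) ^ n"
      using power_mult_distrib[of "16::real" "1/2" n] by simp
    then show "norm (C * 8 ^ n * exp (- c * r ^ n)) \<le> K * (1 / 2) ^ n"
      using K[of n] by (simp only: norm_mult) (auto intro!: mult_right_mono simp: norm_mult)
  qed
qed

lemma card_chosen_le: "card (chosen \<omega> n) \<le> 4 ^ n"
proof -
  have "chosen \<omega> n \<subseteq> {..<2 ^ n} \<times> {..<2 ^ n}"
    using chosen_index_less by fastforce
  then have "card (chosen \<omega> n) \<le> card ({..<2 ^ n :: nat} \<times> {..<2 ^ n :: nat})"
    by (intro card_mono) auto
  also have "\<dots> = 4 ^ n"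
    by (simp add: card_cartesian_product power_mult_distrib[symmetric])
  finally show ?thesis .
qed

text \<open>
  The parameters \<open>t\<close> stand for lines and \<open>w t n q\<close> for the normalised length of \<open>t\<close> in a square.
  Start from the event that all squares up to a level \<open>n0\<close> are chosen.  The weighted
  counts then start at \<open>2 ^ n0\<close> times their initial values.  From there on the growth by a factor
  \<open>r > 1\<close> is tested on a finite net of parameters at every level; the failure probabilities, summed over
  the net and over all levels from \<open>n0\<close> on, are less than \<open>1\<close> if \<open>n0\<close> is large.
\<close>

lemma percolation_weights_survive:
  fixes w :: "'t \<Rightarrow> nat \<Rightarrow> nat \<times> nat \<Rightarrow> real" and K :: "'t set"
  assumes p: "1 / 2 < p" "p < 1"
    and w: "\<And>t n q. 0 \<le> w t n q" "\<And>t n q. w t n q \<le> 1"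
    and ch: "\<And>t n i j. w t (Suc n) (2 * i, 2 * j) + w t (Suc n) (2 * i, 2 * j + 1) +
                w t (Suc n) (2 * i + 1, 2 * j) + w t (Suc n) (2 * i + 1, 2 * j + 1) = 2 * w t n (i, j)"
    and root: "0 < x0" "\<And>t. t \<in> K \<Longrightarrow> x0 \<le> w t 0 (0, 0)"
    and net: "\<And>\<theta>. 0 < \<theta> \<Longrightarrow> \<exists>C. \<forall>n. \<exists>T\<subseteq>K. finite T \<and> real (card T) \<le> C * 8 ^ n \<and>
                (\<forall>t\<in>K. \<exists>t'\<in>T. \<forall>q. \<bar>w t n q - w t' n q\<bar> \<le> \<theta> / 4 ^ n)"
  shows "0 < measure (percolation_measure p) {\<omega>. \<forall>n. \<forall>t\<in>K. \<exists>q\<in>chosen \<omega> n. 0 < w t n q}"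
proof -
  interpret prob_space "percolation_measure p" by (rule prob_space_percolation_measure)
  \<comment> \<open>\<open>1 < r < 2 * \<mu> < 2 * p\<close>: net parameters grow by \<open>2 * \<mu>\<close>, and \<open>\<theta>\<close> pays for the passage to all others\<close>
  define r where "r = (2 + 2 * p) / 3"
  define \<mu> where "\<mu> = (1 + 4 * p) / 6"
  define \<theta> where "\<theta> = (2 * \<mu> - r) * x0"
  have r: "1 < r" "r \<le> 2" and \<mu>: "0 \<le> \<mu>" "\<mu> < p" "r < 2 * \<mu>"
    using p by (auto simp: r_def \<mu>_def field_simps)
  have \<theta>: "0 < \<theta>" using \<mu>(3) root(1) by (simp add: \<theta>_def)
  obtain C where C: "\<forall>n. \<exists>T\<subseteq>K. finite T \<and> real (card T) \<le> C * 8 ^ n \<and>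
                (\<forall>t\<in>K. \<exists>t'\<in>T. \<forall>q. \<bar>w t n q - w t' n q\<bar> \<le> \<theta> / 4 ^ n)"
    using net[OF \<theta>] by blast
  obtain T where T: "\<And>n. T n \<subseteq> K" "\<And>n. finite (T n)" "\<And>n. real (card (T n)) \<le> C * 8 ^ n"
      "\<And>n t. t \<in> K \<Longrightarrow> \<exists>t'\<in>T n. \<forall>q. \<bar>w t n q - w t' n q\<bar> \<le> \<theta> / 4 ^ n"
    using choice[OF C] by blast
  define X where "X t n \<omega> = sum (w t n) (chosen \<omega> n)" for t n \<omega>
  define Bad where "Bad k \<omega> \<longleftrightarrow> (\<exists>t\<in>T (Suc k). x0 * r ^ k \<le> X t k \<omega> \<and> X t (Suc k) \<omega> < 2 * \<mu> * X t k \<omega>)" for k \<omega>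
  have Xmeas [measurable]: "X t n \<in> borel_measurable (percolation_measure p)" for t n
    unfolding X_def by (rule measurable_compose[OF measurable_chosen_set]) simp
  have [measurable]: "Measurable.pred (percolation_measure p) (Bad k)" for k
    unfolding Bad_def using T(2) by (intro pred_intros_finite) measurable
  define c where "c = 4 * (p - \<mu>)\<^sup>2 * x0"
  have c: "0 < c" using \<mu> root(1) by (simp add: c_def)
  define b where "b k = 8 * C * 8 ^ k * exp (- c * r ^ k)" for k
  have summable: "summable b"
    unfolding b_def by (rule summable_exponential_beats_geometric[OF c r(1)])
  have C0: "0 \<le> C" using T(3)[of 0] by simp
  then have b0: "0 \<le> b k" for k by (simp add: b_def)
  obtain n0 where n0: "(\<Sum>k. b (k + n0)) < 1"
    using suminf_exist_split[OF zero_less_one summable] by (metis abs_less_iff order_refl real_norm_def)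
  define I0 where "I0 = {..n0} \<times> {..<2 ^ n0 :: nat} \<times> {..<2 ^ n0 :: nat}"
  define F where "F \<omega> \<longleftrightarrow> (\<forall>k\<in>I0. \<omega> k)" for \<omega>
  have "finite I0" by (simp add: I0_def)
  then have Fpos: "0 < prob {\<omega>. F \<omega>}"
    unfolding F_def using p by (intro prob_tosses_pos) auto
  have [measurable]: "Measurable.pred (percolation_measure p) F"
    unfolding F_def using \<open>finite I0\<close> by (intro pred_intros_finite) measurable
  have F_det: "determined_by (tosses_upto k) F" if "n0 \<le> k" for k
  proof (rule determined_byI)
    fix \<omega> \<omega>' :: "nat \<times> nat \<times> nat \<Rightarrow> bool"
    assume *: "\<And>i. i \<in> tosses_upto k \<Longrightarrow> \<omega> i = \<omega>' i"
    have "\<omega> i = \<omega>' i" if "i \<in> I0" for i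
      by (rule *) (use that \<open>n0 \<le> k\<close> in \<open>auto simp: I0_def tosses_upto_def\<close>)
    then show "F \<omega> = F \<omega>'" by (simp add: F_def)
  qed
  have step: "prob {\<omega>. F \<omega> \<and> Bad k \<omega>} \<le> prob {\<omega>. F \<omega>} * b k" if "n0 \<le> k" for k
  proof -
    let ?B = "\<lambda>t. {\<omega>. F \<omega> \<and> x0 * r ^ k \<le> X t k \<omega> \<and> X t (Suc k) \<omega> < 2 * \<mu> * X t k \<omega>}"
    have one: "prob (?B t) \<le> prob {\<omega>. F \<omega>} * exp (- c * r ^ k)" for t
    proof -
      have "prob (?B t) \<le> prob {\<omega>. F \<omega>} * exp (- 4 * (p - \<mu>)\<^sup>2 * (x0 * r ^ k))"
        unfolding X_def
        by (rule weighted_count_step[where w = "w t" and A = F and n = k, OF _ _ \<mu>(2,1) w ch _ F_det[OF that]]) (use p in auto)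
      then show ?thesis by (simp add: c_def mult.assoc)
    qed
    have "{\<omega>. F \<omega> \<and> Bad k \<omega>} = (\<Union>t\<in>T (Suc k). ?B t)" by (auto simp: Bad_def)
    also have "prob \<dots> \<le> (\<Sum>t\<in>T (Suc k). prob (?B t))"
      using T(2) by (intro finite_measure_subadditive_finite) (auto simp: sets_percolation_iff_pred)
    also have "\<dots> \<le> (\<Sum>t\<in>T (Suc k). prob {\<omega>. F \<omega>} * exp (- c * r ^ k))"
      by (rule sum_mono) (rule one)
    also have "\<dots> = real (card (T (Suc k))) * (prob {\<omega>. F \<omega>} * exp (- c * r ^ k))" by simp
    also have "\<dots> \<le> (C * 8 ^ Suc k) * (prob {\<omega>. F \<omega>} * exp (- c * r ^ k))"
      by (rule mult_right_mono[OF T(3)]) simp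
    finally show ?thesis by (simp add: b_def algebra_simps)
  qed
  have summable': "summable (\<lambda>k. b (k + n0))" using summable by (rule summable_ignore_initial_segment)
  have le_b: "prob {\<omega>. F \<omega> \<and> Bad (k + n0) \<omega>} \<le> prob {\<omega>. F \<omega>} * b (k + n0)" for k
    by (rule step) simp
  have "prob (\<Union>k. {\<omega>. F \<omega> \<and> Bad (k + n0) \<omega>}) \<le> (\<Sum>k. prob {\<omega>. F \<omega> \<and> Bad (k + n0) \<omega>})"
    by (rule finite_measure_subadditive_countably)
      (auto simp: sets_percolation_iff_pred intro!: summable_comparison_test'[OF summable_mult[OF summable'] le_b[THEN order_trans[rotated]]])
  also have "\<dots> \<le> (\<Sum>k. prob {\<omega>. F \<omega>} * b (k + n0))"
    by (intro suminf_le le_b summable_mult summable'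
        summable_comparison_test'[OF summable_mult[OF summable', of "prob {\<omega>. F \<omega>}"]]) (simp add: le_b)
  also have "\<dots> = prob {\<omega>. F \<omega>} * (\<Sum>k. b (k + n0))"
    by (rule suminf_mult[OF summable'])
  also have "\<dots> < prob {\<omega>. F \<omega>} * 1"
    by (rule mult_strict_left_mono[OF n0 Fpos])
  finally have less: "prob (\<Union>k. {\<omega>. F \<omega> \<and> Bad (k + n0) \<omega>}) < prob {\<omega>. F \<omega>}" by simp
  let ?U = "\<Union>k. {\<omega>. F \<omega> \<and> Bad (k + n0) \<omega>}"
  have "prob ({\<omega>. F \<omega>} - ?U) = prob {\<omega>. F \<omega>} - prob ?U"
    by (rule finite_measure_Diff) (auto simp: sets_percolation_iff_pred intro!: sets.countable_UN)
  then have pos: "0 < prob ({\<omega>. F \<omega>} - ?U)" using less by simp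
  have "{\<omega>. F \<omega>} - ?U \<subseteq> {\<omega>. \<forall>n. \<forall>t\<in>K. \<exists>q\<in>chosen \<omega> n. 0 < w t n q}"
  proof safe
    fix \<omega> n t assume F: "F \<omega>" and notU: "\<omega> \<notin> ?U" and t: "t \<in> K"
    have full: "X s m \<omega> = 2 ^ m * w s 0 (0, 0)" if "m \<le> n0" for m s
      using that
    proof (induction m)
      case 0
      then show ?case by (simp add: X_def)
    next
      case (Suc m)
      have toss: "\<omega> (Suc m, q)" if "q \<in> child_squares (chosen \<omega> m)" for q
      proof -
        obtain i j where q: "q = (i, j)" by (cases q)
        then have "(i div 2, j div 2) \<in> chosen \<omega> m" using that by (simp add: child_squares_def)
        then have "i div 2 < 2 ^ m" "j div 2 < 2 ^ m" using chosen_index_less by blast+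
        then have "i < 2 ^ Suc m" "j < 2 ^ Suc m" by auto
        moreover have "(2::nat) ^ Suc m \<le> 2 ^ n0" using Suc.prems by (intro power_increasing) auto
        ultimately have "i < 2 ^ n0" "j < 2 ^ n0" by linarith+
        then show ?thesis using F Suc.prems by (simp add: F_def I0_def q)
      qed
      have "chosen \<omega> (Suc m) = child_squares (chosen \<omega> m)"
        unfolding chosen_Suc_eq using toss by blast
      then have "X s (Suc m) \<omega> = 2 * X s m \<omega>"
        unfolding X_def by (simp only:) (rule sum_child_squares[OF finite_chosen ch])
      then show ?case using Suc by simp
    qed
    have grow: "\<forall>t\<in>K. x0 * r ^ k \<le> X t k \<omega>" if "n0 \<le> k" for k
      using that
    proof (induction k rule: dec_induct)
      case base
      have "r ^ n0 \<le> 2 ^ n0" using r by (intro power_mono) auto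
      then have "x0 * r ^ n0 \<le> w t 0 (0, 0) * 2 ^ n0" if "t \<in> K" for t
        using root(1) root(2)[OF that] r by (intro mult_mono) (auto intro: w)
      then show ?case by (simp add: full mult.commute)
    next
      case (step k)
      have notbad: "\<not> Bad k \<omega>" using notU F step(1) le_Suc_ex[OF step(1)] by (auto simp: add.commute)
      show ?case
      proof
        fix t assume "t \<in> K"
        then obtain t' where t': "t' \<in> T (Suc k)" "\<And>q. \<bar>w t (Suc k) q - w t' (Suc k) q\<bar> \<le> \<theta> / 4 ^ Suc k"
          using T(4) by blast
        have "t' \<in> K" using t'(1) T(1) by blast
        then have *: "x0 * r ^ k \<le> X t' k \<omega>" using step.IH by blast
        then have "2 * \<mu> * X t' k \<omega> \<le> X t' (Suc k) \<omega>"
          using notbad t'(1) by (auto simp: Bad_def not_less)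
        moreover have "2 * \<mu> * (x0 * r ^ k) \<le> 2 * \<mu> * X t' k \<omega>"
          using * \<mu> by (intro mult_left_mono) auto
        \<comment> \<open>at most \<open>4 ^ Suc k\<close> squares, each with an error of \<open>\<theta> / 4 ^ Suc k\<close>\<close>
        moreover have "\<bar>X t (Suc k) \<omega> - X t' (Suc k) \<omega>\<bar> \<le> \<theta>"
        proof -
          have "\<bar>X t (Suc k) \<omega> - X t' (Suc k) \<omega>\<bar> \<le> (\<Sum>q\<in>chosen \<omega> (Suc k). \<bar>w t (Suc k) q - w t' (Suc k) q\<bar>)"
            unfolding X_def sum_subtractf[symmetric] by (rule sum_abs)
          also have "\<dots> \<le> real (card (chosen \<omega> (Suc k))) * (\<theta> / 4 ^ Suc k)"
            by (rule sum_bounded_above) (rule t'(2))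
          also have "\<dots> \<le> real (4 ^ Suc k) * (\<theta> / 4 ^ Suc k)"
            using \<theta> card_chosen_le[of \<omega> "Suc k"] by (intro mult_right_mono) (simp_all only: of_nat_le_iff, auto)
          also have "\<dots> = \<theta>" by simp
          finally show ?thesis .
        qed
        moreover have "\<theta> \<le> \<theta> * r ^ k" using \<theta> r by simp
        moreover have "2 * \<mu> * (x0 * r ^ k) - \<theta> * r ^ k = x0 * r ^ Suc k"
          by (simp add: \<theta>_def algebra_simps)
        ultimately show "x0 * r ^ Suc k \<le> X t (Suc k) \<omega>" by linarith
      qed
    qed
    have "0 < X t n \<omega>"
    proof (cases "n \<le> n0")
      case True
      then show ?thesis using full[OF True, of t] root(1) root(2)[OF t] by simp
    next
      case False
      then have "x0 * r ^ n \<le> X t n \<omega>" using grow[of n] t by auto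
      moreover have "0 < x0 * r ^ n" using root(1) r by simp
      ultimately show ?thesis by linarith
    qed
    then show "\<exists>q\<in>chosen \<omega> n. 0 < w t n q"
      unfolding X_def by (meson not_less sum_nonpos)
  qed
  moreover have "{\<omega>. \<forall>n. \<forall>t\<in>K. \<exists>q\<in>chosen \<omega> n. 0 < w t n q} \<in> events"
    unfolding sets_percolation_iff_pred by measurable
  ultimately have "prob ({\<omega>. F \<omega>} - ?U) \<le> prob {\<omega>. \<forall>n. \<forall>t\<in>K. \<exists>q\<in>chosen \<omega> n. 0 < w t n q}"
    by (intro finite_measure_mono)
  with pos show ?thesis by linarith
qed

section \<open>Covering an interval of parallel lines\<close>

text \<open>
  Half-open intervals make the lengths exactly additive under subdivision, also for lines that run
  along the sides of dyadic squares.
\<close>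

definition dyadic_Ico :: "nat \<Rightarrow> nat \<Rightarrow> real set" where
  "dyadic_Ico n i = {real i / 2 ^ n ..< (real i + 1) / 2 ^ n}"

lemma dyadic_Ico_halves:
  "dyadic_Ico n i = dyadic_Ico (Suc n) (2 * i) \<union> dyadic_Ico (Suc n) (2 * i + 1)"
  "dyadic_Ico (Suc n) (2 * i) \<inter> dyadic_Ico (Suc n) (2 * i + 1) = {}"
  by (auto simp: dyadic_Ico_def field_simps)

lemma sets_dyadic_Ico [measurable]: "dyadic_Ico n i \<in> sets borel"
  by (simp add: dyadic_Ico_def)

lemma emeasure_dyadic_Ico: "emeasure lborel (dyadic_Ico n i) = ennreal (1 / 2 ^ n)"
  unfolding dyadic_Ico_def by (subst emeasure_lborel_Ico) (auto simp: field_simps)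

definition crossing_set :: "real \<Rightarrow> real \<Rightarrow> nat \<Rightarrow> nat \<times> nat \<Rightarrow> real set" where
  "crossing_set m \<tau> n q = dyadic_Ico n (fst q) \<inter> (\<lambda>x. m * x + \<tau>) -` dyadic_Ico n (snd q)"

definition crossing :: "real \<Rightarrow> real \<Rightarrow> nat \<Rightarrow> nat \<times> nat \<Rightarrow> real" where
  "crossing m \<tau> n q = 2 ^ n * measure lborel (crossing_set m \<tau> n q)"

lemma sets_crossing_set [measurable]: "crossing_set m \<tau> n q \<in> sets borel"
proof -
  have "(\<lambda>x. m * x + \<tau>) -` dyadic_Ico n (snd q) \<inter> space borel \<in> sets borel"
    by (rule measurable_sets[of _ _ borel]) auto
  then show ?thesis by (simp add: crossing_set_def)
qed

lemma emeasure_crossing_set_le: "emeasure lborel (crossing_set m \<tau> n q) \<le> ennreal (1 / 2 ^ n)"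
  unfolding emeasure_dyadic_Ico[symmetric, of n "fst q"]
  by (rule emeasure_mono) (auto simp: crossing_set_def)

lemma emeasure_crossing_set_finite: "emeasure lborel (crossing_set m \<tau> n q) \<noteq> \<infinity>"
  using emeasure_crossing_set_le[of m \<tau> n q] by (auto simp: top_unique)

lemma crossing_nonneg: "0 \<le> crossing m \<tau> n q"
  by (simp add: crossing_def)

lemma crossing_le_1: "crossing m \<tau> n q \<le> 1"
proof -
  have "measure lborel (crossing_set m \<tau> n q) \<le> 1 / 2 ^ n"
    unfolding measure_def using emeasure_crossing_set_le[of m \<tau> n q]
    by (intro enn2real_leI) auto
  then show ?thesis by (simp add: crossing_def field_simps)
qed

lemma crossing_children:
  "crossing m \<tau> (Suc n) (2 * i, 2 * j) + crossing m \<tau> (Suc n) (2 * i, 2 * j + 1) +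
   crossing m \<tau> (Suc n) (2 * i + 1, 2 * j) + crossing m \<tau> (Suc n) (2 * i + 1, 2 * j + 1)
   = 2 * crossing m \<tau> n (i, j)"
proof -
  let ?S = "\<lambda>x y. crossing_set m \<tau> (Suc n) (2 * i + x, 2 * j + y)"
  have split: "crossing_set m \<tau> n (i, j) = (?S 0 0 \<union> ?S 0 1) \<union> (?S 1 0 \<union> ?S 1 1)"
    unfolding crossing_set_def by (auto simp: dyadic_Ico_halves(1)[of n])
  have disj: "?S 0 0 \<inter> ?S 0 1 = {}" "?S 1 0 \<inter> ?S 1 1 = {}" "(?S 0 0 \<union> ?S 0 1) \<inter> (?S 1 0 \<union> ?S 1 1) = {}"
    using dyadic_Ico_halves(2)[of n i] dyadic_Ico_halves(2)[of n j] unfolding crossing_set_def by auto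
  have fin: "emeasure lborel (?S x y \<union> ?S x' y') \<noteq> \<infinity>" for x y x' y'
    using emeasure_subadditive[of "?S x y" lborel "?S x' y'"] emeasure_crossing_set_finite
    by (auto simp: top_unique)
  have "measure lborel (crossing_set m \<tau> n (i, j)) =
      measure lborel (?S 0 0) + measure lborel (?S 0 1) + (measure lborel (?S 1 0) + measure lborel (?S 1 1))"
    unfolding split
    by (subst measure_Union[OF fin fin _ _ disj(3)], measurable,
        subst measure_Union[OF emeasure_crossing_set_finite emeasure_crossing_set_finite _ _ disj(1)], measurable,
        subst measure_Union[OF emeasure_crossing_set_finite emeasure_crossing_set_finite _ _ disj(2)], measurable)
  then show ?thesis by (simp add: crossing_def algebra_simps)
qed

lemma measure_affine_vimage_interval:
  fixes m :: real
  assumes "m \<noteq> 0" "a \<le> b"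
  shows "{x. m * x + \<tau> \<in> {a..b}} \<in> sets lborel"
    and "emeasure lborel {x. m * x + \<tau> \<in> {a..b}} = ennreal ((b - a) / \<bar>m\<bar>)"
proof -
  have eq: "{x. m * x + \<tau> \<in> {a..b}} =
      (if 0 < m then {(a - \<tau>) / m..(b - \<tau>) / m} else {(b - \<tau>) / m..(a - \<tau>) / m})"
    using assms(1) by (auto simp: field_simps)
  show "{x. m * x + \<tau> \<in> {a..b}} \<in> sets lborel" unfolding eq by simp
  show "emeasure lborel {x. m * x + \<tau> \<in> {a..b}} = ennreal ((b - a) / \<bar>m\<bar>)"
    using assms minus_divide_left[of "b - a" m]
    unfolding eq by (auto simp: divide_right_mono divide_right_mono_neg diff_divide_distrib[symmetric])
qed

text \<open>
  A shift of a slanted line changes its intersection with a square only where the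
  line is close to the lower or upper side, on a set of length \<open>\<bar>\<tau> - \<tau>'\<bar> / \<bar>m\<bar>\<close>.
\<close>

lemma crossing_Lipschitz:
  assumes m: "m \<noteq> 0"
  shows "\<bar>crossing m \<tau> n q - crossing m \<tau>' n q\<bar> \<le> 2 ^ n * (\<bar>\<tau> - \<tau>'\<bar> / \<bar>m\<bar>)"
proof -
  have one: "measure lborel (crossing_set m \<tau> n q) \<le> measure lborel (crossing_set m \<tau>' n q) + \<bar>\<tau> - \<tau>'\<bar> / \<bar>m\<bar>"
    for \<tau> \<tau>'
  proof -
    define c where "c = real (snd q) / 2 ^ n"
    define d where "d = (real (snd q) + 1) / 2 ^ n"
    obtain a b where ab: "a \<le> b" "b - a = \<bar>\<tau> - \<tau>'\<bar>"
      and sub: "\<And>y. y \<in> {c..<d} \<Longrightarrow> y + (\<tau>' - \<tau>) \<notin> {c..<d} \<Longrightarrow> y \<in> {a..b}"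
    proof (cases "\<tau>' \<ge> \<tau>")
      case True
      then show ?thesis by (intro that[of "d - (\<tau>' - \<tau>)" d]) auto
    next
      case False
      then show ?thesis by (intro that[of c "c - (\<tau>' - \<tau>)"]) auto
    qed
    let ?E = "{x. m * x + \<tau> \<in> {a..b}}"
    have "crossing_set m \<tau> n q \<subseteq> crossing_set m \<tau>' n q \<union> ?E"
    proof
      fix x assume x: "x \<in> crossing_set m \<tau> n q"
      show "x \<in> crossing_set m \<tau>' n q \<union> ?E"
      proof (cases "m * x + \<tau>' \<in> {c..<d}")
        case True
        then show ?thesis using x by (simp add: crossing_set_def dyadic_Ico_def c_def d_def)
      next
        case False
        have "m * x + \<tau> \<in> {c..<d}" using x by (simp add: crossing_set_def dyadic_Ico_def c_def d_def)
        from sub[OF this] False show ?thesis by simp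
      qed
    qed
    then have "emeasure lborel (crossing_set m \<tau> n q) \<le> emeasure lborel (crossing_set m \<tau>' n q \<union> ?E)"
      by (rule emeasure_mono) (use measure_affine_vimage_interval(1)[OF m ab(1)] in simp)
    also have "\<dots> \<le> emeasure lborel (crossing_set m \<tau>' n q) + emeasure lborel ?E"
      by (rule emeasure_subadditive) (use measure_affine_vimage_interval(1)[OF m ab(1)] in simp_all)
    also have "\<dots> = ennreal (measure lborel (crossing_set m \<tau>' n q) + \<bar>\<tau> - \<tau>'\<bar> / \<bar>m\<bar>)"
      unfolding measure_affine_vimage_interval(2)[OF m ab(1)] ab(2)
      using emeasure_crossing_set_finite[of m \<tau>' n q]
      by (simp add: emeasure_eq_ennreal_measure)
    finally show ?thesis unfolding measure_def by (intro enn2real_leI) auto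
  qed
  have "\<bar>measure lborel (crossing_set m \<tau> n q) - measure lborel (crossing_set m \<tau>' n q)\<bar> \<le> \<bar>\<tau> - \<tau>'\<bar> / \<bar>m\<bar>"
    using one[of \<tau> \<tau>'] one[of \<tau>' \<tau>] by (simp add: abs_le_iff abs_minus_commute)
  then have "2 ^ n * \<bar>measure lborel (crossing_set m \<tau> n q) - measure lborel (crossing_set m \<tau>' n q)\<bar>
      \<le> 2 ^ n * (\<bar>\<tau> - \<tau>'\<bar> / \<bar>m\<bar>)"
    by (rule mult_left_mono) simp
  moreover have "2 ^ n * \<bar>measure lborel (crossing_set m \<tau> n q) - measure lborel (crossing_set m \<tau>' n q)\<bar> =
      \<bar>crossing m \<tau> n q - crossing m \<tau>' n q\<bar>"
    unfolding crossing_def right_diff_distrib[symmetric] abs_mult by simp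
  ultimately show ?thesis by simp
qed

text \<open>
  The lower bound degenerates for lines through the two extreme corners of the unit
  square, which explains the margin \<open>\<epsilon>\<close>.
\<close>

lemma crossing_root_ge:
  assumes m: "m \<noteq> 0" and \<epsilon>: "0 < \<epsilon>" and \<tau>: "\<tau> \<in> {min 0 (- m) + \<epsilon> .. 1 + max 0 (- m) - \<epsilon>}"
  shows "min 1 (min (\<epsilon> / \<bar>m\<bar>) (1 / \<bar>m\<bar>)) \<le> crossing m \<tau> 0 (0, 0)"
proof -
  define lo where "lo = max 0 (if 0 < m then - \<tau> / m else (1 - \<tau>) / m)"
  define hi where "hi = min 1 (if 0 < m then (1 - \<tau>) / m else - \<tau> / m)"
  define x0 where "x0 = min 1 (min (\<epsilon> / \<bar>m\<bar>) (1 / \<bar>m\<bar>))"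
  have x0: "0 < x0" using m \<epsilon> by (simp add: x0_def)
  \<comment> \<open>in these coordinates the end points \<open>lo\<close> and \<open>hi\<close> are piecewise linear\<close>
  define s where "s = \<tau> / m"
  define \<delta> where "\<delta> = \<epsilon> / \<bar>m\<bar>"
  define \<rho> where "\<rho> = 1 / \<bar>m\<bar>"
  have pos: "0 < \<delta>" "0 < \<rho>" using m \<epsilon> by (simp_all add: \<delta>_def \<rho>_def)
  have x0_le: "x0 \<le> hi - lo"
  proof (cases "0 < m")
    case True
    then have "m * (- 1 + \<delta>) \<le> m * s" "m * s \<le> m * (\<rho> - \<delta>)"
      using \<tau> by (simp_all add: s_def \<delta>_def \<rho>_def algebra_simps)
    then have "- 1 + \<delta> \<le> s" "s \<le> \<rho> - \<delta>" using True by simp_all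
    moreover have "lo = max 0 (- s)" "hi = min 1 (\<rho> - s)"
      using True by (simp_all add: lo_def hi_def s_def \<rho>_def diff_divide_distrib)
    ultimately show ?thesis unfolding x0_def \<delta>_def[symmetric] \<rho>_def[symmetric] using pos by linarith
  next
    case False
    then have "m < 0" using m by simp
    then have "m * (- \<delta>) \<le> m * s" "m * s \<le> m * (- \<rho> - 1 + \<delta>)"
      using \<tau> by (simp_all add: s_def \<delta>_def \<rho>_def algebra_simps)
    then have "s \<le> - \<delta>" "- \<rho> - 1 + \<delta> \<le> s"
      unfolding mult_le_cancel_left_neg[OF \<open>m < 0\<close>] by simp_all
    moreover have "lo = max 0 (- \<rho> - s)" "hi = min 1 (- s)"
      using \<open>m < 0\<close> by (simp_all add: lo_def hi_def s_def \<rho>_def diff_divide_distrib)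
    ultimately show ?thesis unfolding x0_def \<delta>_def[symmetric] \<rho>_def[symmetric] using pos by linarith
  qed
  have "{lo<..<hi} \<subseteq> crossing_set m \<tau> 0 (0, 0)"
    using m unfolding crossing_set_def dyadic_Ico_def lo_def hi_def
    by (auto simp: field_simps split: if_splits)
  then have "measure lborel {lo<..<hi} \<le> measure lborel (crossing_set m \<tau> 0 (0, 0))"
    using emeasure_crossing_set_finite[of m \<tau> 0 "(0,0)"]
    by (intro measure_mono_fmeasurable) (auto simp: fmeasurable_def top.not_eq_extremum)
  then show ?thesis using x0 x0_le by (simp add: crossing_def x0_def)
qed

lemma crossing_pos_imp_hit:
  assumes "0 < crossing m \<tau> n q"
  shows "\<exists>z\<in>dyadic_square n q. snd z = m * fst z + \<tau>"
proof -
  have "crossing_set m \<tau> n q \<noteq> {}" using assms by (auto simp: crossing_def)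
  then obtain x where "x \<in> crossing_set m \<tau> n q" by blast
  then have "(x, m * x + \<tau>) \<in> dyadic_square n q"
    by (cases q) (auto simp: crossing_set_def dyadic_Ico_def dyadic_square_def)
  then show ?thesis by (intro bexI[of _ "(x, m * x + \<tau>)"]) auto
qed

lemma interval_net:
  fixes a b h :: real
  assumes "0 < h"
  shows "\<exists>T\<subseteq>{a..b}. finite T \<and> real (card T) \<le> \<bar>b - a\<bar> / h + 1 \<and> (\<forall>t\<in>{a..b}. \<exists>t'\<in>T. \<bar>t - t'\<bar> \<le> h)"
proof (cases "a \<le> b")
  case False
  then show ?thesis using assms by (intro exI[of _ "{}"]) auto
next
  case True
  define N where "N = nat \<lfloor>(b - a) / h\<rfloor>"
  have N: "real N \<le> (b - a) / h" using True assms by (simp add: N_def)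
  define T where "T = (\<lambda>k. a + real k * h) ` {..N}"
  have "real k * h \<le> b - a" if "k \<le> N" for k
  proof -
    have "real k \<le> (b - a) / h" using that N by linarith
    then show ?thesis using assms by (simp add: field_simps)
  qed
  then have "T \<subseteq> {a..b}" using assms by (fastforce simp: T_def)
  moreover have "card T \<le> N + 1"
    unfolding T_def by (rule card_image_le[THEN order_trans]) auto
  then have "real (card T) \<le> \<bar>b - a\<bar> / h + 1" using N True by simp
  moreover have "\<exists>t'\<in>T. \<bar>t - t'\<bar> \<le> h" if t: "t \<in> {a..b}" for t
  proof -
    define k where "k = nat \<lfloor>(t - a) / h\<rfloor>"
    have "(t - a) / h \<le> (b - a) / h" using t assms by (intro divide_right_mono) auto
    then have "k \<le> N" unfolding k_def N_def by (intro nat_mono floor_mono)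
    have "real k = of_int \<lfloor>(t - a) / h\<rfloor>" using t assms by (simp add: k_def)
    then have "real k \<le> (t - a) / h" "(t - a) / h < real k + 1"
      by linarith+
    then have "real k * h \<le> t - a" "t - a < (real k + 1) * h" using assms by (simp_all add: field_simps)
    then have "\<bar>t - (a + real k * h)\<bar> \<le> h" by (simp add: algebra_simps abs_le_iff)
    then show ?thesis using \<open>k \<le> N\<close> unfolding T_def by blast
  qed
  ultimately show ?thesis by (intro exI[of _ T]) (auto simp: T_def)
qed

text \<open>
  By the Lipschitz estimate a net of mesh proportional to \<open>1 / 8 ^ n\<close> is fine enough at level \<open>n\<close>.
\<close>

lemma prob_slanted_lines_hit_pos:
  assumes p: "1 / 2 < p" "p < 1" and m: "m \<noteq> 0" and \<epsilon>: "0 < \<epsilon>"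
  shows "0 < measure (percolation_measure p)
     {\<omega>. \<forall>n. \<forall>\<tau>\<in>{min 0 (- m) + \<epsilon> .. 1 + max 0 (- m) - \<epsilon>}. \<exists>q\<in>chosen \<omega> n. 0 < crossing m \<tau> n q}"
proof (rule percolation_weights_survive[where w = "crossing m", OF p crossing_nonneg crossing_le_1 crossing_children])
  show "0 < min 1 (min (\<epsilon> / \<bar>m\<bar>) (1 / \<bar>m\<bar>))" using m \<epsilon> by simp
next
  fix \<tau> assume "\<tau> \<in> {min 0 (- m) + \<epsilon> .. 1 + max 0 (- m) - \<epsilon>}"
  then show "min 1 (min (\<epsilon> / \<bar>m\<bar>) (1 / \<bar>m\<bar>)) \<le> crossing m \<tau> 0 (0, 0)"
    by (rule crossing_root_ge[OF m \<epsilon>])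
next
  fix \<theta> :: real assume \<theta>: "0 < \<theta>"
  define a where "a = min 0 (- m) + \<epsilon>"
  define b where "b = 1 + max 0 (- m) - \<epsilon>"
  show "\<exists>C. \<forall>n. \<exists>T\<subseteq>{min 0 (- m) + \<epsilon>..1 + max 0 (- m) - \<epsilon>}. finite T \<and> real (card T) \<le> C * 8 ^ n \<and>
      (\<forall>t\<in>{min 0 (- m) + \<epsilon>..1 + max 0 (- m) - \<epsilon>}. \<exists>t'\<in>T. \<forall>q. \<bar>crossing m t n q - crossing m t' n q\<bar> \<le> \<theta> / 4 ^ n)"
    unfolding a_def[symmetric] b_def[symmetric]
  proof (intro exI[of _ "\<bar>b - a\<bar> / (\<theta> * \<bar>m\<bar>) + 1"] allI)
    fix n
    define h where "h = \<theta> * \<bar>m\<bar> / 8 ^ n"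
    have h: "0 < h" using \<theta> m by (simp add: h_def)
    obtain T where T: "T \<subseteq> {a..b}" "finite T" "real (card T) \<le> \<bar>b - a\<bar> / h + 1"
        "\<forall>t\<in>{a..b}. \<exists>t'\<in>T. \<bar>t - t'\<bar> \<le> h"
      using interval_net[OF h, of a b] by blast
    have "\<bar>b - a\<bar> / h = \<bar>b - a\<bar> / (\<theta> * \<bar>m\<bar>) * 8 ^ n" by (simp add: h_def)
    moreover have "(1::real) \<le> 8 ^ n" by simp
    ultimately have card: "real (card T) \<le> (\<bar>b - a\<bar> / (\<theta> * \<bar>m\<bar>) + 1) * 8 ^ n"
      using T(3) unfolding distrib_right mult_1 by linarith
    have close: "\<bar>crossing m t n q - crossing m t' n q\<bar> \<le> \<theta> / 4 ^ n" if "\<bar>t - t'\<bar> \<le> h" for t t' q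
    proof -
      have "\<bar>crossing m t n q - crossing m t' n q\<bar> \<le> 2 ^ n * (\<bar>t - t'\<bar> / \<bar>m\<bar>)"
        by (rule crossing_Lipschitz[OF m])
      also have "\<dots> \<le> 2 ^ n * (h / \<bar>m\<bar>)"
        using that by (intro mult_left_mono divide_right_mono) auto
      also have "\<dots> = \<theta> / 4 ^ n"
        using m power_mult_distrib[of "2::real" 4 n] by (simp add: h_def field_simps)
      finally show ?thesis .
    qed
    show "\<exists>T\<subseteq>{a..b}. finite T \<and> real (card T) \<le> (\<bar>b - a\<bar> / (\<theta> * \<bar>m\<bar>) + 1) * 8 ^ n \<and>
        (\<forall>t\<in>{a..b}. \<exists>t'\<in>T. \<forall>q. \<bar>crossing m t n q - crossing m t' n q\<bar> \<le> \<theta> / 4 ^ n)"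
      using T(1,2,4) card close by (intro exI[of _ T]) blast
  qed
qed

lemma crossing_horizontal:
  "crossing 0 \<tau> n (i, j) = of_bool (\<tau> \<in> dyadic_Ico n j)"
proof -
  have "crossing_set 0 \<tau> n (i, j) = (if \<tau> \<in> dyadic_Ico n j then dyadic_Ico n i else {})"
    by (auto simp: crossing_set_def)
  then show ?thesis
    by (simp add: crossing_def measure_def emeasure_dyadic_Ico)
qed

lemma dyadic_Ico_unique: "t \<in> dyadic_Ico n i \<Longrightarrow> t \<in> dyadic_Ico n j \<Longrightarrow> i = j"
proof -
  assume "t \<in> dyadic_Ico n i" "t \<in> dyadic_Ico n j"
  then have "real i < real j + 1" "real j < real i + 1"
    unfolding dyadic_Ico_def by (auto simp: field_simps elim!: le_less_trans)
  then show "i = j" by linarith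
qed

text \<open>
  For horizontal lines the crossings are not continuous in the height, but they are constant on
  dyadic intervals, so that finitely many heights represent all others.
\<close>

lemma prob_horizontal_lines_hit_pos:
  assumes p: "1 / 2 < p" "p < 1"
  shows "0 < measure (percolation_measure p)
     {\<omega>. \<forall>n. \<forall>\<tau>\<in>{0..<1}. \<exists>q\<in>chosen \<omega> n. 0 < crossing 0 \<tau> n q}"
proof (rule percolation_weights_survive[where w = "crossing 0" and ?x0.0 = 1, OF p crossing_nonneg crossing_le_1 crossing_children])
  fix \<tau> :: real assume "\<tau> \<in> {0..<1}"
  then show "1 \<le> crossing 0 \<tau> 0 (0, 0)" by (simp add: crossing_horizontal dyadic_Ico_def)
next
  fix \<theta> :: real assume \<theta>: "0 < \<theta>"
  show "\<exists>C. \<forall>n. \<exists>T\<subseteq>{0..<1}. finite T \<and> real (card T) \<le> C * 8 ^ n \<and>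
      (\<forall>t\<in>{0..<1}. \<exists>t'\<in>T. \<forall>q. \<bar>crossing 0 t n q - crossing 0 t' n q\<bar> \<le> \<theta> / 4 ^ n)"
  proof (intro exI[of _ "1::real"] allI)
    fix n
    define T where "T = (\<lambda>k. real k / 2 ^ n) ` {..<2 ^ n :: nat}"
    have "T \<subseteq> {0..<1}" by (auto simp: T_def)
    moreover have "card T \<le> 2 ^ n"
      unfolding T_def by (rule card_image_le[THEN order_trans]) auto
    then have "real (card T) \<le> 2 ^ n" by (metis of_nat_le_iff of_nat_numeral of_nat_power)
    then have "real (card T) \<le> 1 * 8 ^ n" using power_mono[of "2::real" 8 n] by linarith
    moreover have "\<exists>t'\<in>T. \<forall>q. \<bar>crossing 0 t n q - crossing 0 t' n q\<bar> \<le> \<theta> / 4 ^ n" if t: "t \<in> {0..<1}" for t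
    proof -
      define k where "k = nat \<lfloor>t * 2 ^ n\<rfloor>"
      have "real k = of_int \<lfloor>t * 2 ^ n\<rfloor>" using t by (simp add: k_def)
      then have k: "real k \<le> t * 2 ^ n" "t * 2 ^ n < real k + 1" by linarith+
      have "t * 2 ^ n < 2 ^ n" using t by simp
      then have "real k < 2 ^ n" using k by linarith
      then have "k < 2 ^ n" by (metis of_nat_less_iff of_nat_numeral of_nat_power)
      moreover have "t \<in> dyadic_Ico n k" "real k / 2 ^ n \<in> dyadic_Ico n k"
        using k by (auto simp: dyadic_Ico_def field_simps)
      then have "crossing 0 t n q = crossing 0 (real k / 2 ^ n) n q" for q
        using dyadic_Ico_unique by (cases q) (auto simp: crossing_horizontal of_bool_def)
      ultimately show ?thesis using \<theta> unfolding T_def by (intro bexI[of _ "real k / 2 ^ n"]) auto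
    qed
    ultimately show "\<exists>T\<subseteq>{0..<1}. finite T \<and> real (card T) \<le> 1 * 8 ^ n \<and>
      (\<forall>t\<in>{0..<1}. \<exists>t'\<in>T. \<forall>q. \<bar>crossing 0 t n q - crossing 0 t' n q\<bar> \<le> \<theta> / 4 ^ n)"
      by (intro exI[of _ T]) (auto simp: T_def)
  qed
qed simp

text \<open>
  For a unit vector \<open>(u, v)\<close>, the coordinate orthogonal to the direction of sight \<open>(u, v)\<close>.
\<close>

definition proj :: "real \<Rightarrow> real \<Rightarrow> real \<times> real \<Rightarrow> real" where
  "proj u v z = u * snd z - v * fst z"

text \<open>
  The projection of the unit square is the interval from \<open>shadow_lo u v\<close> to \<open>shadow_hi u v\<close>.
\<close>

definition shadow_lo :: "real \<Rightarrow> real \<Rightarrow> real" where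
  "shadow_lo u v = min 0 u + min 0 (- v)"

definition shadow_hi :: "real \<Rightarrow> real \<Rightarrow> real" where
  "shadow_hi u v = max 0 u + max 0 (- v)"

text \<open>
  Stating the covering for every finite level makes the event visibly measurable.
\<close>

definition covers :: "real \<Rightarrow> real \<Rightarrow> real \<Rightarrow> (nat \<times> nat \<times> nat \<Rightarrow> bool) \<Rightarrow> bool" where
  "covers u v \<epsilon> \<omega> \<longleftrightarrow> (\<forall>n. \<forall>t\<in>{shadow_lo u v + \<epsilon> .. shadow_hi u v - \<epsilon>}.
      \<exists>q\<in>chosen \<omega> n. t \<in> proj u v ` dyadic_square n q)"

lemma pred_covers [measurable]: "Measurable.pred (percolation_measure p) (covers u v \<epsilon>)"
  unfolding covers_def[abs_def] by measurable

lemma compact_dyadic_square: "compact (dyadic_square n q)"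
  by (cases q) (auto simp: dyadic_square_def intro!: compact_Times)

lemma covers_slanted:
  assumes u: "u \<noteq> 0" and hit: "\<forall>n. \<forall>\<tau>\<in>{min 0 (- (v / u)) + \<epsilon> / \<bar>u\<bar> .. 1 + max 0 (- (v / u)) - \<epsilon> / \<bar>u\<bar>}.
      \<exists>q\<in>chosen \<omega> n. 0 < crossing (v / u) \<tau> n q"
  shows "covers u v \<epsilon> \<omega>"
  unfolding covers_def
proof (intro allI ballI)
  fix n t assume t: "t \<in> {shadow_lo u v + \<epsilon> .. shadow_hi u v - \<epsilon>}"
  have "t / u \<in> {min 0 (- (v / u)) + \<epsilon> / \<bar>u\<bar> .. 1 + max 0 (- (v / u)) - \<epsilon> / \<bar>u\<bar>}"
  proof -
    define m s \<delta> where "m = v / u" and "s = t / u" and "\<delta> = \<epsilon> / \<bar>u\<bar>"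
    have eqs: "v = u * m" "t = u * s" "\<epsilon> = \<bar>u\<bar> * \<delta>" using u by (simp_all add: m_def s_def \<delta>_def)
    have "s \<in> {min 0 (- m) + \<delta> .. 1 + max 0 (- m) - \<delta>}"
    proof (cases "0 < u")
      case True
      then have "shadow_lo u v = u * min 0 (- m)" "shadow_hi u v = u * (1 + max 0 (- m))"
        by (simp_all add: shadow_lo_def shadow_hi_def eqs min_mult_distrib_left max_mult_distrib_left distrib_left)
      then have "u * (min 0 (- m) + \<delta>) \<le> u * s" "u * s \<le> u * (1 + max 0 (- m) - \<delta>)"
        using t True by (simp_all add: eqs algebra_simps)
      then show ?thesis using True by simp
    next
      case False
      then have "u < 0" using u by simp
      then have "shadow_lo u v = u * (1 + max 0 (- m))" "shadow_hi u v = u * min 0 (- m)"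
        by (simp_all add: shadow_lo_def shadow_hi_def eqs min_mult_distrib_left max_mult_distrib_left distrib_left)
      then have "u * (1 + max 0 (- m) - \<delta>) \<le> u * s" "u * s \<le> u * (min 0 (- m) + \<delta>)"
        using t \<open>u < 0\<close> by (simp_all add: eqs algebra_simps)
      then show ?thesis using \<open>u < 0\<close> by simp
    qed
    then show ?thesis by (simp add: m_def s_def \<delta>_def)
  qed
  then obtain q where q: "q \<in> chosen \<omega> n" "0 < crossing (v / u) (t / u) n q" using hit by blast
  then obtain z where "z \<in> dyadic_square n q" "snd z = v / u * fst z + t / u"
    using crossing_pos_imp_hit by blast
  then have "t \<in> proj u v ` dyadic_square n q"
    using u by (intro image_eqI[of _ _ z]) (simp_all add: proj_def field_simps)
  with q(1) show "\<exists>q\<in>chosen \<omega> n. t \<in> proj u v ` dyadic_square n q" by blast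
qed

text \<open>
  The crossings see only the half-open unit interval; its right end is recovered because the
  shadow of finitely many closed squares is closed.
\<close>

lemma covers_horizontal:
  assumes u: "u \<noteq> 0" and \<epsilon>: "0 \<le> \<epsilon>" and hit: "\<forall>n. \<forall>\<tau>\<in>{0..<1}. \<exists>q\<in>chosen \<omega> n. 0 < crossing 0 \<tau> n q"
  shows "covers u 0 \<epsilon> \<omega>"
  unfolding covers_def
proof (intro allI ballI)
  fix n t assume t: "t \<in> {shadow_lo u 0 + \<epsilon> .. shadow_hi u 0 - \<epsilon>}"
  let ?S = "\<Union>q\<in>chosen \<omega> n. snd ` dyadic_square n q"
  have "closed ?S"
    by (intro compact_imp_closed compact_UN finite_chosen compact_continuous_image
        compact_dyadic_square continuous_intros)
  moreover have "{0..<1} \<subseteq> ?S"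
  proof
    fix \<tau> :: real assume "\<tau> \<in> {0..<1}"
    then obtain q where q: "q \<in> chosen \<omega> n" "0 < crossing 0 \<tau> n q" using hit by blast
    then obtain z where "z \<in> dyadic_square n q" "snd z = \<tau>"
      using crossing_pos_imp_hit[of 0 \<tau> n q] by auto
    then show "\<tau> \<in> ?S" using q(1) by force
  qed
  ultimately have "closure {0..<1} \<subseteq> ?S" by (intro closure_minimal)
  then have "{0..1} \<subseteq> ?S" by simp
  moreover have "t / u \<in> {0..1}"
    using t u \<epsilon> unfolding shadow_lo_def shadow_hi_def
    by (cases "0 < u") (auto simp: field_simps)
  ultimately obtain q z where q: "q \<in> chosen \<omega> n" "z \<in> dyadic_square n q" "t / u = snd z" by blast
  then have "t = proj u 0 z" using u by (simp add: proj_def field_simps)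
  then show "\<exists>q\<in>chosen \<omega> n. t \<in> proj u 0 ` dyadic_square n q" using q by blast
qed

lemma chosen_swap:
  "chosen (\<omega> \<circ> (\<lambda>(n, i, j). (n, j, i))) n = prod.swap ` chosen \<omega> n"
proof -
  have "(i, j) \<in> chosen (\<omega> \<circ> (\<lambda>(n, i, j). (n, j, i))) n \<longleftrightarrow> (j, i) \<in> chosen \<omega> n" for i j
    by (induction n arbitrary: i j) auto
  then have *: "q \<in> chosen (\<omega> \<circ> (\<lambda>(n, i, j). (n, j, i))) n \<longleftrightarrow> prod.swap q \<in> chosen \<omega> n" for q
    by (cases q) simp
  show ?thesis
  proof (intro set_eqI iffI)
    fix q assume "q \<in> chosen (\<omega> \<circ> (\<lambda>(n, i, j). (n, j, i))) n"
    then have "prod.swap (prod.swap q) \<in> prod.swap ` chosen \<omega> n" unfolding * by (rule imageI)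
    then show "q \<in> prod.swap ` chosen \<omega> n" by simp
  next
    fix q assume "q \<in> prod.swap ` chosen \<omega> n"
    then show "q \<in> chosen (\<omega> \<circ> (\<lambda>(n, i, j). (n, j, i))) n" unfolding * by auto
  qed
qed

lemma covers_swap:
  assumes "covers (- v) (- u) \<epsilon> (\<omega> \<circ> (\<lambda>(n, i, j). (n, j, i)))"
  shows "covers u v \<epsilon> \<omega>"
  unfolding covers_def
proof (intro allI ballI)
  fix n t assume "t \<in> {shadow_lo u v + \<epsilon> .. shadow_hi u v - \<epsilon>}"
  then have "t \<in> {shadow_lo (- v) (- u) + \<epsilon> .. shadow_hi (- v) (- u) - \<epsilon>}"
    by (simp add: shadow_lo_def shadow_hi_def add.commute)
  then obtain q z where q: "q \<in> chosen \<omega> n" "z \<in> dyadic_square n (prod.swap q)" "t = proj (- v) (- u) z"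
    using assms unfolding covers_def chosen_swap by blast
  have "prod.swap z \<in> dyadic_square n q" using q(2) by (cases q; cases z) (auto simp: dyadic_square_def)
  moreover have "t = proj u v (prod.swap z)" using q(3) by (cases z) (simp add: proj_def)
  ultimately show "\<exists>q\<in>chosen \<omega> n. t \<in> proj u v ` dyadic_square n q" using q(1) by blast
qed

text \<open>
  Lines of sight that are not vertical have a slope \<open>v / u\<close> and are treated directly; vertical
  ones are reduced to horizontal ones by exchanging the coordinates.
\<close>

lemma prob_covers_pos:
  assumes p: "1 / 2 < p" "p < 1" and uv: "u \<noteq> 0 \<or> v \<noteq> 0"
    and \<epsilon>: "0 \<le> \<epsilon>" "\<epsilon> = 0 \<Longrightarrow> u = 0 \<or> v = 0"
  shows "0 < measure (percolation_measure p) {\<omega>. covers u v \<epsilon> \<omega>}"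
proof -
  interpret prob_space "percolation_measure p" by (rule prob_space_percolation_measure)
  have axis: "0 < prob {\<omega>. covers u 0 \<epsilon> \<omega>}" if "u \<noteq> 0" for u
  proof -
    have "prob {\<omega>. \<forall>n. \<forall>\<tau>\<in>{0..<1}. \<exists>q\<in>chosen \<omega> n. 0 < crossing 0 \<tau> n q} \<le> prob {\<omega>. covers u 0 \<epsilon> \<omega>}"
      by (rule finite_measure_mono)
        (use covers_horizontal[OF that \<epsilon>(1)] in \<open>auto simp: sets_percolation_iff_pred\<close>)
    then show ?thesis using prob_horizontal_lines_hit_pos[OF p] by linarith
  qed
  consider "v = 0" "u \<noteq> 0" | "u = 0" "v \<noteq> 0" | "u \<noteq> 0" "v \<noteq> 0" "0 < \<epsilon>"
    using uv \<epsilon> by fastforce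
  then show ?thesis
  proof cases
    case 1
    then show ?thesis using axis by simp
  next
    case 2
    have "inj (\<lambda>(n :: nat, i :: nat, j :: nat). (n, j, i))" by (auto simp: inj_def)
    then have "prob {\<omega>. covers (- v) 0 \<epsilon> (\<omega> \<circ> (\<lambda>(n, i, j). (n, j, i)))} = prob {\<omega>. covers (- v) 0 \<epsilon> \<omega>}"
      by (rule prob_reindex) measurable
    moreover have "prob {\<omega>. covers (- v) 0 \<epsilon> (\<omega> \<circ> (\<lambda>(n, i, j). (n, j, i)))} \<le> prob {\<omega>. covers u v \<epsilon> \<omega>}"
      by (rule finite_measure_mono) (use 2 covers_swap[of v u] in \<open>auto simp: sets_percolation_iff_pred\<close>)
    ultimately show ?thesis using axis[of "- v"] 2 by simp
  next
    case 3
    have "0 < prob {\<omega>. \<forall>n. \<forall>\<tau>\<in>{min 0 (- (v / u)) + \<epsilon> / \<bar>u\<bar> .. 1 + max 0 (- (v / u)) - \<epsilon> / \<bar>u\<bar>}.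
        \<exists>q\<in>chosen \<omega> n. 0 < crossing (v / u) \<tau> n q}"
      by (rule prob_slanted_lines_hit_pos[OF p]) (use 3 in auto)
    also have "\<dots> \<le> prob {\<omega>. covers u v \<epsilon> \<omega>}"
      by (rule finite_measure_mono) (use covers_slanted[OF 3(1)] in \<open>auto simp: sets_percolation_iff_pred\<close>)
    finally show ?thesis .
  qed
qed

section \<open>Points of the percolation set above a covered interval\<close>

lemma dyadic_square_ancestor:
  "dyadic_square (n + k) (i, j) \<subseteq> dyadic_square n (i div 2 ^ k, j div 2 ^ k)"
proof (induction k arbitrary: i j)
  case (Suc k)
  have "dyadic_square (n + Suc k) (i, j) \<subseteq> dyadic_square (n + k) (i div 2, j div 2)"
    using dyadic_square_parent[of "n + k" i j] by simp
  also have "\<dots> \<subseteq> dyadic_square n (i div 2 div 2 ^ k, j div 2 div 2 ^ k)" by (rule Suc.IH)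
  finally show ?case by (simp add: div_mult2_eq)
qed simp

lemma percolation_set_in_chosen:
  assumes "z \<in> percolation_set \<omega>"
  shows "\<exists>q\<in>chosen \<omega> n. z \<in> dyadic_square n q"
proof -
  obtain q where q: "q \<in> chosen \<omega> (Suc n)" "z \<in> dyadic_square (Suc n) q"
  proof -
    have "z \<in> (\<Union>q\<in>chosen \<omega> (Suc n). dyadic_square (Suc n) q)"
      using assms unfolding percolation_set_def by (rule INT_D) simp
    then show ?thesis using that by blast
  qed
  obtain i j where ij: "q = (i, j)" by (cases q)
  have "(i div 2, j div 2) \<in> chosen \<omega> n" using q(1) by (simp add: ij)
  then show ?thesis using q(2) dyadic_square_parent[of n i j] ij by blast
qed

lemma percolation_set_subtree:
  assumes q: "(a, b) \<in> chosen \<omega> m" and z: "z \<in> percolation_set (\<omega> \<circ> subtree m (a, b))"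
  shows "((real a + fst z) / 2 ^ m, (real b + snd z) / 2 ^ m) \<in> percolation_set \<omega> \<inter> dyadic_square m (a, b)"
proof
  let ?z = "((real a + fst z) / 2 ^ m, (real b + snd z) / 2 ^ m)"
  have "z \<in> dyadic_square 0 (0, 0)" using percolation_set_in_chosen[OF z, of 0] by simp
  then have sq: "?z \<in> dyadic_square m (a, b)"
    by (cases z) (auto simp: dyadic_square_def divide_right_mono)
  then show "?z \<in> dyadic_square m (a, b)" .
  show "?z \<in> percolation_set \<omega>"
    unfolding percolation_set_def
  proof
    fix n :: nat
    show "?z \<in> (\<Union>q\<in>chosen \<omega> n. dyadic_square n q)"
    proof (cases "n \<le> m")
      case True
      then obtain k where k: "m = n + k" using le_Suc_ex by blast
      have "(a div 2 ^ k, b div 2 ^ k) \<in> chosen \<omega> n" using chosen_parent q unfolding k by blast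
      then show ?thesis using sq dyadic_square_ancestor unfolding k by blast
    next
      case False
      then obtain k where k: "n = m + k" using le_Suc_ex nat_le_linear by blast
      obtain i j where ij: "(i, j) \<in> chosen (\<omega> \<circ> subtree m (a, b)) k" "z \<in> dyadic_square k (i, j)"
        using percolation_set_in_chosen[OF z, of k] by auto
      then have "(a * 2 ^ k + i, b * 2 ^ k + j) \<in> chosen \<omega> n"
        using chosen_subtree_iff[of i k j a b \<omega> m] chosen_index_less[OF ij(1)] q k by simp
      moreover have "?z \<in> dyadic_square n (a * 2 ^ k + i, b * 2 ^ k + j)"
      proof -
        have "real (a' * 2 ^ k + i') / 2 ^ (m + k) = (real a' + real i' / 2 ^ k) / 2 ^ m"
          "(real (a' * 2 ^ k + i') + 1) / 2 ^ (m + k) = (real a' + (real i' + 1) / 2 ^ k) / 2 ^ m" for a' i' :: nat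
          by (simp_all add: power_add field_simps)
        then show ?thesis
          using ij(2) unfolding k dyadic_square_def prod.case
          by (cases z) (simp add: divide_right_mono)
      qed
      ultimately show ?thesis by blast
    qed
  qed
qed

text \<open>
  By compactness, a line that meets the chosen squares of every level meets the limit set.
\<close>

lemma covers_imp_hit:
  assumes "covers u v \<epsilon> \<omega>" "t \<in> {shadow_lo u v + \<epsilon> .. shadow_hi u v - \<epsilon>}"
  shows "\<exists>z\<in>percolation_set \<omega>. proj u v z = t"
proof -
  have "closed {z. proj u v z = t}"
    unfolding proj_def by (intro closed_Collect_eq continuous_intros)
  note iff = percolation_set_disjoint_iff[OF \<open>closed {z. proj u v z = t}\<close>, of \<omega>]
  have "percolation_set \<omega> \<inter> {z. proj u v z = t} \<noteq> {}"
    unfolding iff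
  proof clarify
    fix n assume n: "\<forall>q\<in>chosen \<omega> n. dyadic_square n q \<inter> {z. proj u v z = t} = {}"
    obtain q where q: "q \<in> chosen \<omega> n" "t \<in> proj u v ` dyadic_square n q"
      using assms unfolding covers_def by blast
    then show False using n by blast
  qed
  then show ?thesis by blast
qed

section \<open>Squares exposed to the view from one side\<close>

text \<open>
  The view along \<open>(u, v)\<close> from the line \<open>u x + v y = c\<close>, on the side where \<open>u x + v y > c\<close>.  The other side
  is the same situation for \<open>- u, - v, - c\<close>.
\<close>

locale viewing =
  fixes u v c p :: real
  assumes unit: "u\<^sup>2 + v\<^sup>2 = 1" and p: "1 / 2 < p" "p < 1"
begin

definition depth :: "real \<times> real \<Rightarrow> real" where
  "depth z = u * fst z + v * snd z"

text \<open>
  Among the four children of a square, one reaches furthest in the direction of either end of the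
  shadow; the shadows of the other children stop short of it by at least \<open>2 * margin\<close> times their side
  length, provided that the margin is positive.  In axis-parallel directions the
  margin is \<open>0\<close>: squares in a row along the line of sight have the same shadow, and no point counts as near to its end.
\<close>

definition margin :: real where "margin = min \<bar>u\<bar> \<bar>v\<bar> / 2"

text \<open>
  In units of the side length.  A strip that contains a point at distance \<open>margin\<close> from the ends of a shadow
  stays at distance at least \<open>margin / 2\<close> from them; in axis-parallel directions strips are the
  shadows of the columns or rows.
\<close>

definition strip_width :: real where "strip_width = (if margin = 0 then 1 else margin / 2)"

definition square_lo :: "nat \<Rightarrow> nat \<times> nat \<Rightarrow> real" where
  "square_lo n q = (u * real (snd q) - v * real (fst q) + shadow_lo u v) / 2 ^ n"

definition square_hi :: "nat \<Rightarrow> nat \<times> nat \<Rightarrow> real" where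
  "square_hi n q = (u * real (snd q) - v * real (fst q) + shadow_hi u v) / 2 ^ n"

definition core :: "nat \<Rightarrow> nat \<times> nat \<Rightarrow> real set" where
  "core n q = {square_lo n q + margin / 2 / 2 ^ n .. square_hi n q - margin / 2 / 2 ^ n}"

definition strip :: "nat \<Rightarrow> int \<Rightarrow> real set" where
  "strip n k = {of_int k * strip_width / 2 ^ n .. (of_int k + 1) * strip_width / 2 ^ n}"

definition in_front :: "nat \<Rightarrow> nat \<times> nat \<Rightarrow> bool" where
  "in_front n q \<longleftrightarrow> (\<forall>z\<in>dyadic_square n q. c < depth z)"

text \<open>
  This order along the lines of sight is defined by the points of the squares, so that an
  earlier square hides a later one on every common line of sight.
\<close>

definition earlier :: "nat \<Rightarrow> nat \<times> nat \<Rightarrow> nat \<times> nat \<Rightarrow> bool" where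
  "earlier n q' q \<longleftrightarrow> (\<forall>a\<in>dyadic_square n q. \<forall>b\<in>dyadic_square n q'.
      proj u v a = proj u v b \<longrightarrow> depth b < depth a)"

definition opaque :: "nat \<Rightarrow> nat \<times> nat \<Rightarrow> (nat \<times> nat \<times> nat \<Rightarrow> bool) \<Rightarrow> bool" where
  "opaque n q \<omega> \<longleftrightarrow> covers u v (margin / 2) (\<omega> \<circ> subtree n q)"

definition candidates :: "nat \<Rightarrow> int \<Rightarrow> (nat \<times> nat \<times> nat \<Rightarrow> bool) \<Rightarrow> (nat \<times> nat) set" where
  "candidates n k \<omega> = {q \<in> chosen \<omega> n. strip n k \<subseteq> core n q \<and> in_front n q}"

definition exposed_in :: "nat \<Rightarrow> int \<Rightarrow> (nat \<times> nat \<times> nat \<Rightarrow> bool) \<Rightarrow> (nat \<times> nat) set" where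
  "exposed_in n k \<omega> = {q \<in> candidates n k \<omega>. \<forall>q'\<in>candidates n k \<omega>. opaque n q' \<omega> \<longrightarrow> \<not> earlier n q' q}"

text \<open>
  Finitely many strips that include all those inside the shadow of the unit square.
\<close>

definition strips :: "nat \<Rightarrow> int set" where
  "strips n = {- \<lceil>2 * 2 ^ n / strip_width\<rceil> .. \<lceil>2 * 2 ^ n / strip_width\<rceil>}"

definition exposed :: "nat \<Rightarrow> (nat \<times> nat \<times> nat \<Rightarrow> bool) \<Rightarrow> (nat \<times> nat) set" where
  "exposed n \<omega> = (\<Union>k\<in>strips n. exposed_in n k \<omega>)"

lemma abs_direction_le_1: "\<bar>u\<bar> \<le> 1" "\<bar>v\<bar> \<le> 1"
proof -
  have "u\<^sup>2 \<le> 1" "v\<^sup>2 \<le> 1" using unit zero_le_power2[of u] zero_le_power2[of v] by linarith+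
  then show "\<bar>u\<bar> \<le> 1" "\<bar>v\<bar> \<le> 1" by (simp_all add: abs_square_le_1)
qed

lemma margin_nonneg: "0 \<le> margin" by (simp add: margin_def)

lemma strip_width_pos: "0 < strip_width"
  using margin_nonneg by (simp add: strip_width_def)

lemma shadow_length: "shadow_hi u v - shadow_lo u v = \<bar>u\<bar> + \<bar>v\<bar>"
  by (auto simp: shadow_hi_def shadow_lo_def)

lemma prob_covers_margin_pos: "0 < measure (percolation_measure p) {\<omega>. covers u v (margin / 2) \<omega>}"
proof (rule prob_covers_pos[OF p])
  show "u \<noteq> 0 \<or> v \<noteq> 0" using unit by auto
qed (auto simp: margin_def)

lemma proj_dyadic_square:
  assumes "z \<in> dyadic_square n q"
  shows "square_lo n q \<le> proj u v z" "proj u v z \<le> square_hi n q"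
proof -
  obtain i j where q: "q = (i, j)" by (cases q)
  define x where "x = fst z * 2 ^ n - real i"
  define y where "y = snd z * 2 ^ n - real j"
  have xy: "0 \<le> x" "x \<le> 1" "0 \<le> y" "y \<le> 1"
    using assms by (cases z; auto simp: q dyadic_square_def x_def y_def field_simps)+
  have P: "proj u v z = (u * real j - v * real i + (u * y - v * x)) / 2 ^ n"
    by (simp add: proj_def x_def y_def field_simps)
  have bnd: "min 0 a \<le> a * s \<and> a * s \<le> max 0 a" if "0 \<le> s" "s \<le> 1" for a s :: real
    using that mult_left_le[of s a] mult_left_le[of s "- a"]
    by (cases "0 \<le> a") (auto simp: min_def max_def mult_nonpos_nonneg)
  have "shadow_lo u v \<le> u * y - v * x" "u * y - v * x \<le> shadow_hi u v"
    using bnd[OF xy(3,4), of u] bnd[OF xy(1,2), of "- v"] by (auto simp: shadow_lo_def shadow_hi_def)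
  then show "square_lo n q \<le> proj u v z" "proj u v z \<le> square_hi n q"
    unfolding P square_lo_def square_hi_def q by (auto intro!: divide_right_mono)
qed

lemma opaque_hit:
  assumes q: "q \<in> chosen \<omega> n" and "opaque n q \<omega>" and t: "t \<in> core n q"
  shows "\<exists>z\<in>percolation_set \<omega> \<inter> dyadic_square n q. proj u v z = t"
proof -
  obtain a b where ab: "q = (a, b)" by (cases q)
  define s where "s = t * 2 ^ n - (u * real b - v * real a)"
  have "s \<in> {shadow_lo u v + margin / 2 .. shadow_hi u v - margin / 2}"
  proof -
    let ?K = "u * real b - v * real a"
    have "core n q = {(?K + shadow_lo u v + margin / 2) / 2 ^ n .. (?K + shadow_hi u v - margin / 2) / 2 ^ n}"
      by (simp add: core_def square_lo_def square_hi_def ab add_divide_distrib diff_divide_distrib)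
    then show ?thesis using t by (simp add: pos_divide_le_eq pos_le_divide_eq s_def)
  qed
  then obtain z where z: "z \<in> percolation_set (\<omega> \<circ> subtree n (a, b))" "proj u v z = s"
    using covers_imp_hit assms(2) unfolding opaque_def ab by blast
  let ?z = "((real a + fst z) / 2 ^ n, (real b + snd z) / 2 ^ n)"
  have "proj u v ?z = (u * real b - v * real a + proj u v z) / 2 ^ n"
    by (simp add: proj_def field_simps)
  then have "proj u v ?z = t" by (simp add: z(2) s_def)
  then show ?thesis using percolation_set_subtree[OF q[unfolded ab] z(1)] unfolding ab by blast
qed

text \<open>
  Points on one line of sight differ by a multiple of the unit vector \<open>(u, v)\<close>.
\<close>

lemma difference_along_view:
  assumes "proj u v a = proj u v b"
  shows "fst a - fst b = (depth a - depth b) * u" "snd a - snd b = (depth a - depth b) * v"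
proof -
  define x where "x = fst a - fst b"
  define y where "y = snd a - snd b"
  have *: "u * y = v * x" using assms by (simp add: proj_def x_def y_def algebra_simps)
  have d: "depth a - depth b = u * x + v * y" by (simp add: depth_def x_def y_def algebra_simps)
  have "x = (u\<^sup>2 + v\<^sup>2) * x" "y = (u\<^sup>2 + v\<^sup>2) * y" using unit by simp_all
  then have "x = (u * x + v * y) * u" "y = (u * x + v * y) * v" 
    using * by (simp_all add: power2_eq_square algebra_simps) (metis mult.left_commute)+
  then show "fst a - fst b = (depth a - depth b) * u" "snd a - snd b = (depth a - depth b) * v"
    by (simp_all add: d x_def[symmetric] y_def[symmetric])
qed

text \<open>
  If a coordinate separates two squares, then along every common line of sight the order is
  that of the coordinate or its reverse, according to the sign of the component \<open>w\<close> of the direction.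
  For \<open>w = 0\<close> there are no common lines of sight.
\<close>

lemma earlier_of_coordinate_gap:
  assumes gap: "\<And>a b. a \<in> dyadic_square n q \<Longrightarrow> b \<in> dyadic_square n q' \<Longrightarrow> proj u v a = proj u v b \<Longrightarrow>
      0 < (depth a - depth b) * w"
  shows "earlier n q q' \<or> earlier n q' q"
proof (cases "0 < w")
  case True
  then have "earlier n q' q" unfolding earlier_def using gap by (fastforce simp: zero_less_mult_iff)
  then show ?thesis ..
next
  case False
  then have "earlier n q q'" unfolding earlier_def using gap by (fastforce simp: zero_less_mult_iff)
  then show ?thesis ..
qed

lemma earlier_if_far:
  assumes "i' + 2 \<le> i \<or> j' + 2 \<le> j"
  shows "earlier n (i, j) (i', j') \<or> earlier n (i', j') (i, j)"
  using assms
proof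
  assume far: "i' + 2 \<le> i"
  show ?thesis
  proof (rule earlier_of_coordinate_gap)
    fix a b assume ab: "a \<in> dyadic_square n (i, j)" "b \<in> dyadic_square n (i', j')" "proj u v a = proj u v b"
    have "real i' + 1 < real i" using far by linarith
    then have "(real i' + 1) / 2 ^ n < real i / 2 ^ n" by (rule divide_strict_right_mono) simp
    then have "fst b < fst a" using ab by (auto simp: dyadic_square_def)
    then show "0 < (depth a - depth b) * u" using difference_along_view(1)[OF ab(3)] by simp
  qed
next
  assume far: "j' + 2 \<le> j"
  show ?thesis
  proof (rule earlier_of_coordinate_gap)
    fix a b assume ab: "a \<in> dyadic_square n (i, j)" "b \<in> dyadic_square n (i', j')" "proj u v a = proj u v b"
    have "real j' + 1 < real j" using far by linarith
    then have "(real j' + 1) / 2 ^ n < real j / 2 ^ n" by (rule divide_strict_right_mono) simp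
    then have "snd b < snd a" using ab by (auto simp: dyadic_square_def)
    then show "0 < (depth a - depth b) * v" using difference_along_view(2)[OF ab(3)] by simp
  qed
qed

text \<open>
  Squares that are not comparable have indices that differ by at most one in both coordinates.
\<close>

lemma card_unordered_le_9:
  assumes "\<And>q q'. q \<in> F \<Longrightarrow> q' \<in> F \<Longrightarrow> \<not> earlier n q q'"
  shows "card F \<le> 9"
proof (cases "F = {}")
  case False
  then obtain i0 j0 where 0: "(i0, j0) \<in> F" by auto
  have "F \<subseteq> {i0 - 1..i0 + 1} \<times> {j0 - 1..j0 + 1}"
  proof
    fix q assume "q \<in> F"
    obtain i j where ij: "q = (i, j)" by (cases q)
    have "\<not> (i0 + 2 \<le> i \<or> j0 + 2 \<le> j)" "\<not> (i + 2 \<le> i0 \<or> j + 2 \<le> j0)"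
      using \<open>q \<in> F\<close> 0 assms earlier_if_far unfolding ij by metis+
    then show "q \<in> {i0 - 1..i0 + 1} \<times> {j0 - 1..j0 + 1}" by (auto simp: ij)
  qed
  then have "card F \<le> card ({i0 - 1..i0 + 1} \<times> {j0 - 1..j0 + 1})" by (rule card_mono[rotated]) simp
  also have "\<dots> \<le> 3 * 3" unfolding card_cartesian_product by (rule mult_mono) auto
  finally show ?thesis by simp
qed simp

lemma dyadic_square_nonempty: "dyadic_square n q \<noteq> {}"
  by (cases q) (auto simp: dyadic_square_def divide_right_mono)

lemma not_earlier_self: "\<not> earlier n q q"
  using dyadic_square_nonempty[of n q] by (auto simp: earlier_def)

lemma pred_opaque [measurable]: "Measurable.pred (percolation_measure p') (opaque n q)"
  unfolding opaque_def[abs_def] by measurable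

lemma pred_exposed_in [measurable]: "Measurable.pred (percolation_measure p') (\<lambda>\<omega>. q \<in> exposed_in n k \<omega>)"
proof -
  have "q \<in> exposed_in n k \<omega> \<longleftrightarrow>
      (q \<in> chosen \<omega> n \<and> strip n k \<subseteq> core n q \<and> in_front n q) \<and>
      (\<forall>q'. (q' \<in> chosen \<omega> n \<and> strip n k \<subseteq> core n q' \<and> in_front n q') \<longrightarrow> opaque n q' \<omega> \<longrightarrow> \<not> earlier n q' q)" for \<omega>
    by (auto simp: exposed_in_def candidates_def)
  then show ?thesis by simp
qed

text \<open>
  Whether \<open>q\<close> is exposed depends on the chosen squares of its level and on the percolation inside the other
  squares; the percolation inside \<open>q\<close> itself has no influence because \<open>q\<close> is not earlier than itself.
\<close>

lemma determined_by_exposed_in: "determined_by (- below n q) (\<lambda>\<omega>. q \<in> exposed_in n k \<omega>)"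
proof (rule determined_byI)
  fix \<omega> \<omega>' :: "nat \<times> nat \<times> nat \<Rightarrow> bool"
  assume *: "\<And>i. i \<in> - below n q \<Longrightarrow> \<omega> i = \<omega>' i"
  have "chosen \<omega> n = chosen \<omega>' n"
    by (rule chosen_cong, rule *) (cases q, simp add: in_below_iff)
  then have cand: "candidates n k \<omega> = candidates n k \<omega>'" by (simp add: candidates_def)
  have op: "opaque n q' \<omega> = opaque n q' \<omega>'" if "q' \<noteq> q" for q'
  proof -
    have "chosen (\<omega> \<circ> subtree n q') m = chosen (\<omega>' \<circ> subtree n q') m" for m
      by (rule chosen_subtree_cong, rule *) (use below_disjoint[OF that, of n] in blast)
    then show ?thesis by (simp add: opaque_def covers_def)
  qed
  have "(opaque n q' \<omega> \<longrightarrow> \<not> earlier n q' q) = (opaque n q' \<omega>' \<longrightarrow> \<not> earlier n q' q)" for q'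
    by (cases "q' = q") (simp_all add: not_earlier_self op)
  then show "(q \<in> exposed_in n k \<omega>) = (q \<in> exposed_in n k \<omega>')"
    by (simp add: exposed_in_def cand)
qed

lemma determined_by_opaque: "determined_by (below n q) (opaque n q)"
proof (rule determined_byI)
  fix \<omega> \<omega>' :: "nat \<times> nat \<times> nat \<Rightarrow> bool"
  assume *: "\<And>i. i \<in> below n q \<Longrightarrow> \<omega> i = \<omega>' i"
  have "chosen (\<omega> \<circ> subtree n q) m = chosen (\<omega>' \<circ> subtree n q) m" for m
    by (rule chosen_subtree_cong) (rule *)
  then show "opaque n q \<omega> = opaque n q \<omega>'" by (simp add: opaque_def covers_def)
qed

lemma finite_exposed_in: "finite (exposed_in n k \<omega>)"
  using finite_chosen by (rule finite_subset[rotated]) (auto simp: exposed_in_def candidates_def)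

lemma finite_strips: "finite (strips n)" by (simp add: strips_def)

lemma finite_exposed: "finite (exposed n \<omega>)"
  unfolding exposed_def using finite_strips finite_exposed_in by blast

abbreviation "hit_prob \<equiv> measure (percolation_measure p) {\<omega>. covers u v (margin / 2) \<omega>}"

text \<open>
  Squares that are both exposed and opaque cannot hide each other, so there are at most nine of them.
  On the other hand each exposed square is opaque with probability \<open>hit_prob\<close>, independently of its being
  exposed.  Comparing expectations bounds the number of all exposed squares.
\<close>

lemma expected_exposed_in_le:
  "(\<integral>\<^sup>+\<omega>. of_nat (card (exposed_in n k \<omega>)) \<partial>percolation_measure p) \<le> ennreal (9 / hit_prob)"
proof -
  interpret prob_space "percolation_measure p" by (rule prob_space_percolation_measure)
  define G where "G = {..<2 ^ n :: nat} \<times> {..<2 ^ n :: nat}"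
  have finG: "finite G" by (simp add: G_def)
  have inG: "exposed_in n k \<omega> \<subseteq> G" for \<omega>
    using chosen_index_less by (fastforce simp: G_def exposed_in_def candidates_def)
  have card_eq: "card {q \<in> exposed_in n k \<omega>. P q} = (\<Sum>q\<in>G. of_bool (q \<in> exposed_in n k \<omega> \<and> P q))" for P \<omega>
  proof -
    have "{q \<in> exposed_in n k \<omega>. P q} = G \<inter> {q. q \<in> exposed_in n k \<omega> \<and> P q}" using inG by blast
    then show ?thesis using finG by simp
  qed
  have expo: "(\<integral>\<^sup>+\<omega>. of_nat (card {q \<in> exposed_in n k \<omega>. P q \<omega>}) \<partial>percolation_measure p) =
      ennreal (\<Sum>q\<in>G. prob {\<omega>. q \<in> exposed_in n k \<omega> \<and> P q \<omega>})"
    if [measurable]: "\<And>q. Measurable.pred (percolation_measure p) (P q)" for P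
  proof -
    have "(\<integral>\<^sup>+\<omega>. of_nat (card {q \<in> exposed_in n k \<omega>. P q \<omega>}) \<partial>percolation_measure p) =
        (\<integral>\<^sup>+\<omega>. (\<Sum>q\<in>G. indicator {\<omega>. q \<in> exposed_in n k \<omega> \<and> P q \<omega>} \<omega>) \<partial>percolation_measure p)"
      unfolding card_eq by (intro nn_integral_cong) (simp add: indicator_def)
    also have "\<dots> = (\<Sum>q\<in>G. emeasure (percolation_measure p) {\<omega>. q \<in> exposed_in n k \<omega> \<and> P q \<omega>})"
      by (subst nn_integral_sum) (auto simp: sets_percolation_iff_pred)
    finally show ?thesis by (simp add: emeasure_eq_measure)
  qed
  have indep: "prob {\<omega>. q \<in> exposed_in n k \<omega> \<and> opaque n q \<omega>} = prob {\<omega>. q \<in> exposed_in n k \<omega>} * hit_prob" for q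
  proof -
    have "prob {\<omega>. q \<in> exposed_in n k \<omega> \<and> opaque n q \<omega>} =
        prob {\<omega>. q \<in> exposed_in n k \<omega>} * prob {\<omega>. opaque n q \<omega>}"
      by (rule prob_conj_determined_by[OF _ _ determined_by_exposed_in determined_by_opaque]) auto
    also have "prob {\<omega>. opaque n q \<omega>} = hit_prob"
      unfolding opaque_def by (rule prob_reindex[OF inj_subtree]) measurable
    finally show ?thesis .
  qed
  have le9: "card {q \<in> exposed_in n k \<omega>. opaque n q \<omega>} \<le> 9" for \<omega>
    by (rule card_unordered_le_9) (auto simp: exposed_in_def)
  have "ennreal (\<Sum>q\<in>G. prob {\<omega>. q \<in> exposed_in n k \<omega> \<and> opaque n q \<omega>}) =
      (\<integral>\<^sup>+\<omega>. of_nat (card {q \<in> exposed_in n k \<omega>. opaque n q \<omega>}) \<partial>percolation_measure p)"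
    by (rule expo[symmetric]) measurable
  also have "\<dots> \<le> (\<integral>\<^sup>+\<omega>. of_nat 9 \<partial>percolation_measure p)"
    using le9 by (intro nn_integral_mono) (simp only: of_nat_le_iff)
  also have "\<dots> = ennreal 9" using emeasure_space_1 by simp
  finally have "(\<Sum>q\<in>G. prob {\<omega>. q \<in> exposed_in n k \<omega> \<and> opaque n q \<omega>}) \<le> 9"
    by (subst (asm) ennreal_le_iff) simp_all
  then have "(\<Sum>q\<in>G. prob {\<omega>. q \<in> exposed_in n k \<omega>}) * hit_prob \<le> 9"
    unfolding indep sum_distrib_right .
  then have "(\<Sum>q\<in>G. prob {\<omega>. q \<in> exposed_in n k \<omega>}) \<le> 9 / hit_prob"
    using prob_covers_margin_pos by (simp add: field_simps)
  moreover have "(\<integral>\<^sup>+\<omega>. of_nat (card (exposed_in n k \<omega>)) \<partial>percolation_measure p) =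
      ennreal (\<Sum>q\<in>G. prob {\<omega>. q \<in> exposed_in n k \<omega>})"
    using expo[of "\<lambda>_ _. True"] by simp
  ultimately show ?thesis by (simp add: ennreal_leI)
qed

definition exposed_bound :: real where
  "exposed_bound = (4 / strip_width + 3) * (9 / hit_prob)"

lemma card_strips_le: "real (card (strips n)) \<le> (4 / strip_width + 3) * 2 ^ n"
proof -
  define x where "x = 2 * 2 ^ n / strip_width"
  have "0 \<le> x" using strip_width_pos by (simp add: x_def)
  then have "0 \<le> \<lceil>x\<rceil>" by linarith
  then have "real (card (strips n)) = 2 * of_int \<lceil>x\<rceil> + 1" by (simp add: strips_def x_def)
  also have "\<dots> \<le> 2 * x + 3" using of_int_ceiling_le_add_one[of x] by linarith
  also have "\<dots> \<le> 2 * x + 3 * 2 ^ n" by simp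
  also have "\<dots> = (4 / strip_width + 3) * 2 ^ n" by (simp add: x_def algebra_simps)
  finally show ?thesis .
qed

lemma measurable_card_exposed_in [measurable]:
  "(\<lambda>\<omega>. of_nat (card (exposed_in n k \<omega>)) :: ennreal) \<in> borel_measurable (percolation_measure p')"
proof -
  define G where "G = {..<2 ^ n :: nat} \<times> {..<2 ^ n :: nat}"
  have "card (exposed_in n k \<omega>) = (\<Sum>q\<in>G. of_bool (q \<in> exposed_in n k \<omega>))" for \<omega>
  proof -
    have "exposed_in n k \<omega> = G \<inter> {q. q \<in> exposed_in n k \<omega>}"
      using chosen_index_less by (fastforce simp: G_def exposed_in_def candidates_def)
    then show ?thesis by (simp add: G_def)
  qed
  then show ?thesis by simp
qed

text \<open>
  Summing over strips counts a square once for every strip in which it is exposed, which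
  only enlarges the count and makes it additive in the strips.
\<close>

definition exposed_upto :: "nat \<Rightarrow> (nat \<times> nat \<times> nat \<Rightarrow> bool) \<Rightarrow> ennreal" where
  "exposed_upto n \<omega> = (\<Sum>m\<le>n. \<Sum>k\<in>strips m. of_nat (card (exposed_in m k \<omega>)))"

lemma measurable_exposed_upto [measurable]: "exposed_upto n \<in> borel_measurable (percolation_measure p')"
  unfolding exposed_upto_def[abs_def] by measurable

lemma card_exposed_sum_le: "of_nat (\<Sum>m\<le>n. card (exposed m \<omega>)) \<le> exposed_upto n \<omega>"
proof -
  have "card (exposed m \<omega>) \<le> (\<Sum>k\<in>strips m. card (exposed_in m k \<omega>))" for m
    unfolding exposed_def by (rule card_UN_le[OF finite_strips])
  then have "(\<Sum>m\<le>n. card (exposed m \<omega>)) \<le> (\<Sum>m\<le>n. \<Sum>k\<in>strips m. card (exposed_in m k \<omega>))"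
    by (intro sum_mono)
  then have "(of_nat (\<Sum>m\<le>n. card (exposed m \<omega>)) :: ennreal) \<le>
      of_nat (\<Sum>m\<le>n. \<Sum>k\<in>strips m. card (exposed_in m k \<omega>))"
    by (simp only: of_nat_le_iff)
  then show ?thesis by (simp add: exposed_upto_def)
qed

lemma expected_exposed_upto_le:
  "(\<integral>\<^sup>+\<omega>. exposed_upto n \<omega> \<partial>percolation_measure p) \<le> ennreal (2 * exposed_bound * 2 ^ n)"
proof -
  define h where "h = 9 / hit_prob"
  have h0: "0 \<le> h" by (simp add: h_def)
  have "(\<integral>\<^sup>+\<omega>. exposed_upto n \<omega> \<partial>percolation_measure p) =
      (\<Sum>m\<le>n. \<Sum>k\<in>strips m. \<integral>\<^sup>+\<omega>. of_nat (card (exposed_in m k \<omega>)) \<partial>percolation_measure p)"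
    unfolding exposed_upto_def by (simp add: nn_integral_sum)
  also have "\<dots> \<le> (\<Sum>m\<le>n. \<Sum>k\<in>strips m. ennreal h)"
    unfolding h_def by (intro sum_mono expected_exposed_in_le)
  also have "\<dots> = (\<Sum>m\<le>n. ennreal (real (card (strips m)) * h))"
    using h0 by (intro sum.cong) (simp_all add: ennreal_of_nat_eq_real_of_nat ennreal_mult)
  also have "\<dots> = ennreal (\<Sum>m\<le>n. real (card (strips m)) * h)"
    using h0 by (intro sum_ennreal) simp
  also have "\<dots> \<le> ennreal (\<Sum>m\<le>n. (4 / strip_width + 3) * 2 ^ m * h)"
    by (intro ennreal_leI sum_mono mult_right_mono card_strips_le h0)
  also have "(\<Sum>m\<le>n. (4 / strip_width + 3) * 2 ^ m * h) = exposed_bound * (\<Sum>m\<le>n. 2 ^ m)"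
    unfolding sum_distrib_left exposed_bound_def h_def[symmetric] by (intro sum.cong) simp_all
  also have "ennreal \<dots> \<le> ennreal (2 * exposed_bound * 2 ^ n)"
  proof (rule ennreal_leI)
    have "(\<Sum>m\<le>n. (2::real) ^ m) \<le> 2 * 2 ^ n" by (induction n) auto
    moreover have "0 \<le> exposed_bound" using strip_width_pos by (simp add: exposed_bound_def)
    ultimately have "exposed_bound * (\<Sum>m\<le>n. 2 ^ m) \<le> exposed_bound * (2 * 2 ^ n)"
      by (rule mult_left_mono)
    then show "exposed_bound * (\<Sum>m\<le>n. 2 ^ m) \<le> 2 * exposed_bound * 2 ^ n" by simp
  qed
  finally show ?thesis .
qed

end

section \<open>Counting the squares that meet the visible part\<close>

context viewing
begin

text \<open>
  Only points strictly in front of the line can hide others here.  If the percolation set avoids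
  the line, these are exactly the visible points on the side under consideration.
\<close>

definition front_visible :: "(nat \<times> nat \<times> nat \<Rightarrow> bool) \<Rightarrow> (real \<times> real) set" where
  "front_visible \<omega> = {a \<in> percolation_set \<omega>. c < depth a \<and>
     (\<forall>b\<in>percolation_set \<omega>. proj u v b = proj u v a \<longrightarrow> c < depth b \<longrightarrow> \<not> depth b < depth a)}"

lemma square_bounds:
  assumes "fst q < 2 ^ n" "snd q < 2 ^ n"
  shows "- 2 \<le> square_lo n q" "square_hi n q \<le> 2"
proof -
  have "fst q + 1 \<le> 2 ^ n" "snd q + 1 \<le> 2 ^ n" using assms by auto
  then have "real (fst q + 1) \<le> 2 ^ n" "real (snd q + 1) \<le> 2 ^ n"
    by (metis of_nat_le_iff of_nat_numeral of_nat_power)+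
  then have ij: "real (fst q) + 1 \<le> 2 ^ n" "real (snd q) + 1 \<le> 2 ^ n" by simp_all
  have b: "\<bar>w\<bar> * r \<le> 2 ^ n" if "\<bar>w\<bar> \<le> 1" "0 \<le> r" "r \<le> 2 ^ n" for w r :: real
    using mult_mono[OF that(1) that(3)] that(2) by simp
  have u: "\<bar>u\<bar> * (real (snd q) + 1) \<le> 2 ^ n" by (rule b) (use abs_direction_le_1 ij in auto)
  have v: "\<bar>v\<bar> * (real (fst q) + 1) \<le> 2 ^ n" by (rule b) (use abs_direction_le_1 ij in auto)
  have *: "- \<bar>u\<bar> * real (snd q) \<le> u * real (snd q)" "u * real (snd q) \<le> \<bar>u\<bar> * real (snd q)"
    "- \<bar>v\<bar> * real (fst q) \<le> v * real (fst q)" "v * real (fst q) \<le> \<bar>v\<bar> * real (fst q)"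
    by (intro mult_right_mono; simp)+
  have "- \<bar>u\<bar> - \<bar>v\<bar> \<le> shadow_lo u v" "shadow_hi u v \<le> \<bar>u\<bar> + \<bar>v\<bar>"
    by (auto simp: shadow_lo_def shadow_hi_def)
  then have "- (2 * 2 ^ n) \<le> u * real (snd q) - v * real (fst q) + shadow_lo u v"
    "u * real (snd q) - v * real (fst q) + shadow_hi u v \<le> 2 * 2 ^ n"
    using u v * unfolding distrib_left by linarith+
  then show "- 2 \<le> square_lo n q" "square_hi n q \<le> 2"
    unfolding square_lo_def square_hi_def by (simp_all add: field_simps)
qed

lemma axis_parallel_Ints:
  assumes "margin = 0"
  shows "u \<in> \<int>" "v \<in> \<int>" "\<bar>u\<bar> + \<bar>v\<bar> = 1"
proof -
  have "u = 0 \<or> v = 0" using assms by (auto simp: margin_def min_def split: if_splits)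
  then have "(u = 0 \<and> (v = 1 \<or> v = - 1)) \<or> (v = 0 \<and> (u = 1 \<or> u = - 1))"
    using unit by (auto simp: power2_eq_1_iff)
  then show "u \<in> \<int>" "v \<in> \<int>" "\<bar>u\<bar> + \<bar>v\<bar> = 1" by auto
qed

text \<open>
  In axis-parallel directions the shadow of a square of level \<open>n\<close> is exactly one strip; otherwise
  the strip containing \<open>t\<close> is narrow enough to fit into the core.
\<close>

lemma strip_through:
  assumes t: "t \<in> {square_lo n q + margin / 2 ^ n .. square_hi n q - margin / 2 ^ n}"
  shows "\<exists>k. t \<in> strip n k \<and> strip n k \<subseteq> core n q"
proof (cases "margin = 0")
  case True
  note ints = axis_parallel_Ints[OF True]
  have "u * real (snd q) - v * real (fst q) + shadow_lo u v \<in> \<int>"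
    using ints unfolding shadow_lo_def
    by (intro Ints_add Ints_diff Ints_mult) (auto simp: min_def)
  then obtain K where K: "u * real (snd q) - v * real (fst q) + shadow_lo u v = of_int K"
    by (elim Ints_cases)
  then have lo: "square_lo n q = of_int K / 2 ^ n" by (simp add: square_lo_def)
  have "u * real (snd q) - v * real (fst q) + shadow_hi u v = of_int K + 1"
    using K shadow_length ints(3) by linarith
  then have hi: "square_hi n q = (of_int K + 1) / 2 ^ n" by (simp add: square_hi_def)
  have "strip n K = core n q"
    by (simp add: strip_def core_def strip_width_def True lo hi)
  moreover have "t \<in> core n q" using t by (simp add: core_def True)
  ultimately show ?thesis by blast
next
  case False
  define w where "w = strip_width"
  have w: "0 < w" "margin = 2 * w" using False strip_width_pos by (simp_all add: w_def strip_width_def)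
  define k where "k = \<lfloor>t * 2 ^ n / w\<rfloor>"
  have "of_int k \<le> t * 2 ^ n / w" "t * 2 ^ n / w < of_int k + 1" unfolding k_def by linarith+
  then have k: "of_int k * w \<le> t * 2 ^ n" "t * 2 ^ n < (of_int k + 1) * w"
    using w by (simp_all add: field_simps)
  then have k': "of_int k * w / 2 ^ n \<le> t" "t < (of_int k + 1) * w / 2 ^ n"
    by (simp_all add: field_simps)
  moreover have "(of_int k + 1) * w / 2 ^ n = of_int k * w / 2 ^ n + w / 2 ^ n"
    by (simp add: field_simps)
  ultimately have "strip n k \<subseteq> core n q" "t \<in> strip n k"
    using t unfolding strip_def core_def w_def[symmetric] w(2) by auto
  then show ?thesis by blast
qed

lemma strip_index:
  assumes "strip n k \<subseteq> core n q" "fst q < 2 ^ n" "snd q < 2 ^ n"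
  shows "k \<in> strips n"
proof -
  let ?t = "of_int k * strip_width / 2 ^ n"
  have "?t \<in> strip n k" using strip_width_pos by (simp add: strip_def divide_right_mono)
  then have "?t \<in> core n q" using assms(1) by blast
  moreover have "0 \<le> margin / 2 / 2 ^ n" using margin_nonneg by simp
  ultimately have "square_lo n q \<le> ?t" "?t \<le> square_hi n q" unfolding core_def by auto
  then have "- 2 \<le> ?t" "?t \<le> 2" using square_bounds[OF assms(2,3)] by linarith+
  then have "- (2 * 2 ^ n / strip_width) \<le> of_int k" "of_int k \<le> 2 * 2 ^ n / strip_width"
    using strip_width_pos by (simp_all add: field_simps)
  then show ?thesis unfolding strips_def by (auto simp: le_ceiling_iff ceiling_le_iff) linarith+
qed

lemma connected_dyadic_square: "connected (dyadic_square n q)"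
  by (cases q) (auto simp: dyadic_square_def intro!: convex_connected convex_Times)

lemma in_frontI:
  assumes "dyadic_square n q \<inter> {z. depth z = c} = {}" "a \<in> dyadic_square n q" "c < depth a"
  shows "in_front n q"
proof (unfold in_front_def, rule ballI, rule ccontr)
  fix z assume z: "z \<in> dyadic_square n q" "\<not> c < depth z"
  have "connected (depth ` dyadic_square n q)"
    unfolding depth_def by (intro connected_continuous_image connected_dyadic_square continuous_intros)
  then have "c \<in> depth ` dyadic_square n q"
    by (rule connectedD_interval[of _ "depth z" "depth a"]) (use z assms in auto)
  then show False using assms(1) by blast
qed

text \<open>
  If \<open>q\<close> were not exposed in the strip of \<open>a\<close>, then an opaque square in front of \<open>q\<close> would contain a point
  of the percolation set on the line of sight of \<open>a\<close>, and \<open>a\<close> would not be visible.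
\<close>

lemma exposedI:
  assumes a: "a \<in> front_visible \<omega>" "a \<in> dyadic_square n q" and q: "q \<in> chosen \<omega> n" "in_front n q"
    and t: "proj u v a \<in> {square_lo n q + margin / 2 ^ n .. square_hi n q - margin / 2 ^ n}"
  shows "q \<in> exposed n \<omega>"
proof -
  obtain k where k: "proj u v a \<in> strip n k" "strip n k \<subseteq> core n q" using strip_through[OF t] by blast
  have "fst q < 2 ^ n \<and> snd q < 2 ^ n" using chosen_index_less q(1) by (cases q) auto
  then have "k \<in> strips n" using strip_index[OF k(2)] by blast
  moreover have "q \<in> exposed_in n k \<omega>"
    unfolding exposed_in_def
  proof (intro CollectI conjI ballI impI notI)
    show "q \<in> candidates n k \<omega>" using q k by (simp add: candidates_def)
    fix q' assume q': "q' \<in> candidates n k \<omega>" "opaque n q' \<omega>" "earlier n q' q"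
    have "q' \<in> chosen \<omega> n" "proj u v a \<in> core n q'" using q'(1) k(1) by (auto simp: candidates_def)
    from opaque_hit[OF this(1) q'(2) this(2)]
    obtain b where b: "b \<in> percolation_set \<omega>" "b \<in> dyadic_square n q'" "proj u v b = proj u v a"
      by blast
    have "c < depth b" using b(2) q'(1) by (auto simp: candidates_def in_front_def)
    moreover have "depth b < depth a" using q'(3) a(2) b(2,3) unfolding earlier_def by auto
    ultimately show False using a(1) b(1,3) unfolding front_visible_def by blast
  qed
  ultimately show ?thesis by (auto simp: exposed_def)
qed

definition near_hi :: "nat \<Rightarrow> (nat \<times> nat \<times> nat \<Rightarrow> bool) \<Rightarrow> (nat \<times> nat) set" where
  "near_hi n \<omega> = {q \<in> chosen \<omega> n. \<exists>a\<in>front_visible \<omega> \<inter> dyadic_square n q.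
      square_hi n q - margin / 2 ^ n < proj u v a}"

definition near_lo :: "nat \<Rightarrow> (nat \<times> nat \<times> nat \<Rightarrow> bool) \<Rightarrow> (nat \<times> nat) set" where
  "near_lo n \<omega> = {q \<in> chosen \<omega> n. \<exists>a\<in>front_visible \<omega> \<inter> dyadic_square n q.
      proj u v a < square_lo n q + margin / 2 ^ n}"

text \<open>
  The child whose shadow shares the upper end with that of its parent, and likewise below for the
  lower end.  In axis-parallel directions two children share each end; one of them is picked, and
  then nothing is ever near to an end.
\<close>

definition hi_child :: "nat \<times> nat \<Rightarrow> nat \<times> nat" where
  "hi_child q = (2 * fst q + (if v < 0 then 1 else 0), 2 * snd q + (if 0 < u then 1 else 0))"

definition lo_child :: "nat \<times> nat \<Rightarrow> nat \<times> nat" where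
  "lo_child q = (2 * fst q + (if 0 < v then 1 else 0), 2 * snd q + (if u < 0 then 1 else 0))"

lemma child_square_lo_hi:
  fixes i j x y :: nat
  shows "square_lo (Suc n) (2 * i + x, 2 * j + y) =
      (2 * (u * real j - v * real i) + (u * real y - v * real x) + shadow_lo u v) / 2 ^ Suc n"
    and "square_hi (Suc n) (2 * i + x, 2 * j + y) =
      (2 * (u * real j - v * real i) + (u * real y - v * real x) + shadow_hi u v) / 2 ^ Suc n"
    and "square_lo n (i, j) = (2 * (u * real j - v * real i) + 2 * shadow_lo u v) / 2 ^ Suc n"
    and "square_hi n (i, j) = (2 * (u * real j - v * real i) + 2 * shadow_hi u v) / 2 ^ Suc n"
  by (simp_all add: square_lo_def square_hi_def algebra_simps add_divide_distrib diff_divide_distrib)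

text \<open>
  The shadow of a child, relative to that of its parent, is governed by \<open>u y - v x\<close>.  If \<open>(x, y)\<close> is not the
  extreme corner, at least one of \<open>\<bar>u\<bar>\<close> and \<open>\<bar>v\<bar>\<close> is lost, hence at least \<open>2 * margin\<close>.
\<close>

lemma corner_gap:
  assumes xy: "x \<in> {0, 1::nat}" "y \<in> {0, 1::nat}"
  shows "u * real y - v * real x \<le> shadow_hi u v - 2 * margin \<or>
      x = (if v < 0 then 1 else 0) \<and> y = (if 0 < u then 1 else 0)"
    and "shadow_lo u v + 2 * margin \<le> u * real y - v * real x \<or>
      x = (if 0 < v then 1 else 0) \<and> y = (if u < 0 then 1 else 0)"
    and "shadow_lo u v \<le> u * real y - v * real x" "u * real y - v * real x \<le> shadow_hi u v"
  using xy unfolding shadow_hi_def shadow_lo_def margin_def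
  by (auto simp: min_def max_def abs_if split: if_splits)

text \<open>
  A point near the upper end for the child cannot be near the lower end for the parent, whose shadow
  is twice as long; and near the upper end for the parent only the extreme child reaches.
\<close>

lemma near_hi_child:
  fixes t :: real
  assumes xy: "x \<in> {0, 1::nat}" "y \<in> {0, 1::nat}"
    and t: "square_hi (Suc n) (2 * i + x, 2 * j + y) - margin / 2 ^ Suc n < t"
      "t \<le> square_hi (Suc n) (2 * i + x, 2 * j + y)"
    and bad: "t \<notin> {square_lo n (i, j) + margin / 2 ^ n .. square_hi n (i, j) - margin / 2 ^ n}"
  shows "square_hi n (i, j) - margin / 2 ^ n < t \<and> (2 * i + x, 2 * j + y) = hi_child (i, j)"
proof -
  \<comment> \<open>all quantities in units of the side length at level \<open>Suc n\<close>\<close>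
  define A where "A = 2 * (u * real j - v * real i)"
  define d where "d = u * real y - v * real x"
  define T where "T = t * 2 ^ Suc n"
  have T: "t = T / 2 ^ Suc n" by (simp add: T_def)
  have m: "margin / 2 ^ n = 2 * margin / 2 ^ Suc n" by simp
  have 1: "A + d + shadow_hi u v - margin < T" "T \<le> A + d + shadow_hi u v"
    using t unfolding child_square_lo_hi(2) A_def[symmetric] d_def[symmetric] T
    by (simp_all only: diff_divide_distrib[symmetric] divide_less_cancel divide_le_cancel) simp_all
  have 2: "\<not> (A + 2 * shadow_lo u v + 2 * margin \<le> T \<and> T \<le> A + 2 * shadow_hi u v - 2 * margin)"
    using bad unfolding child_square_lo_hi(3,4) A_def[symmetric] T m atLeastAtMost_iff
      diff_divide_distrib[symmetric] add_divide_distrib[symmetric] divide_le_cancel by simp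
  have gap: "4 * margin \<le> shadow_hi u v - shadow_lo u v"
    unfolding shadow_length margin_def by (simp add: min_def)
  note c = corner_gap[OF xy, folded d_def]
  have 3: "A + 2 * shadow_hi u v - 2 * margin < T"
    using 1 2 c(3) gap margin_nonneg by linarith
  then have "\<not> d \<le> shadow_hi u v - 2 * margin" using 1 by linarith
  then have "x = (if v < 0 then 1 else 0) \<and> y = (if 0 < u then 1 else 0)" using c(1) by blast
  moreover have "square_hi n (i, j) - margin / 2 ^ n < t"
    using 3 unfolding child_square_lo_hi(4) A_def[symmetric] T m
      diff_divide_distrib[symmetric] by (simp add: divide_less_cancel)
  ultimately show ?thesis by (simp add: hi_child_def)
qed

lemma near_lo_child:
  fixes t :: real
  assumes xy: "x \<in> {0, 1::nat}" "y \<in> {0, 1::nat}"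
    and t: "t < square_lo (Suc n) (2 * i + x, 2 * j + y) + margin / 2 ^ Suc n"
      "square_lo (Suc n) (2 * i + x, 2 * j + y) \<le> t"
    and bad: "t \<notin> {square_lo n (i, j) + margin / 2 ^ n .. square_hi n (i, j) - margin / 2 ^ n}"
  shows "t < square_lo n (i, j) + margin / 2 ^ n \<and> (2 * i + x, 2 * j + y) = lo_child (i, j)"
proof -
  define A where "A = 2 * (u * real j - v * real i)"
  define d where "d = u * real y - v * real x"
  define T where "T = t * 2 ^ Suc n"
  have T: "t = T / 2 ^ Suc n" by (simp add: T_def)
  have m: "margin / 2 ^ n = 2 * margin / 2 ^ Suc n" by simp
  have 1: "T < A + d + shadow_lo u v + margin" "A + d + shadow_lo u v \<le> T"
    using t unfolding child_square_lo_hi(1) A_def[symmetric] d_def[symmetric] T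
    by (simp_all only: add_divide_distrib[symmetric] divide_less_cancel divide_le_cancel) simp_all
  have 2: "\<not> (A + 2 * shadow_lo u v + 2 * margin \<le> T \<and> T \<le> A + 2 * shadow_hi u v - 2 * margin)"
    using bad unfolding child_square_lo_hi(3,4) A_def[symmetric] T m atLeastAtMost_iff
      diff_divide_distrib[symmetric] add_divide_distrib[symmetric] divide_le_cancel by simp
  have gap: "4 * margin \<le> shadow_hi u v - shadow_lo u v"
    unfolding shadow_length margin_def by (simp add: min_def)
  note c = corner_gap[OF xy, folded d_def]
  have 3: "T < A + 2 * shadow_lo u v + 2 * margin"
    using 1 2 c(4) gap margin_nonneg by linarith
  then have "\<not> shadow_lo u v + 2 * margin \<le> d" using 1 by linarith
  then have "x = (if 0 < v then 1 else 0) \<and> y = (if u < 0 then 1 else 0)" using c(2) by blast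
  moreover have "t < square_lo n (i, j) + margin / 2 ^ n"
    using 3 unfolding child_square_lo_hi(3) A_def[symmetric] T m
      add_divide_distrib[symmetric] by (simp add: divide_less_cancel)
  ultimately show ?thesis by (simp add: lo_child_def)
qed

context
  fixes \<omega> :: "nat \<times> nat \<times> nat \<Rightarrow> bool" and n1 :: nat
  assumes avoid: "\<And>n q. n1 \<le> n \<Longrightarrow> q \<in> chosen \<omega> n \<Longrightarrow> dyadic_square n q \<inter> {z. depth z = c} = {}"
begin

lemma exposed_if_not_near:
  assumes "n1 \<le> n" "q \<in> chosen \<omega> n" "a \<in> front_visible \<omega>" "a \<in> dyadic_square n q"
    "proj u v a \<in> {square_lo n q + margin / 2 ^ n .. square_hi n q - margin / 2 ^ n}"
  shows "q \<in> exposed n \<omega>"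
  by (rule exposedI[OF assms(3,4,2) _ assms(5)], rule in_frontI[OF avoid[OF assms(1,2)] assms(4)])
    (use assms(3) in \<open>simp add: front_visible_def\<close>)

lemma parent_decomposition:
  assumes "q \<in> chosen \<omega> (Suc n)" "a \<in> dyadic_square (Suc n) q"
  obtains i j x y where "q = (2 * i + x, 2 * j + y)" "x \<in> {0, 1}" "y \<in> {0, 1}"
    "(i, j) \<in> chosen \<omega> n" "a \<in> dyadic_square n (i, j)"
proof -
  obtain I J where q: "q = (I, J)" by (cases q)
  show ?thesis
  proof (rule that)
    show "q = (2 * (I div 2) + I mod 2, 2 * (J div 2) + J mod 2)" by (simp add: q)
    show "(I div 2, J div 2) \<in> chosen \<omega> n" using assms(1) by (simp add: q)
    show "a \<in> dyadic_square n (I div 2, J div 2)"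
      using assms(2) dyadic_square_parent[of n I J] by (auto simp: q)
  qed auto
qed

lemma near_hi_Suc:
  assumes n: "n1 \<le> n"
  shows "near_hi (Suc n) \<omega> \<subseteq> child_squares (exposed n \<omega>) \<union> hi_child ` near_hi n \<omega>"
proof
  fix q assume "q \<in> near_hi (Suc n) \<omega>"
  then obtain a where q: "q \<in> chosen \<omega> (Suc n)" and a: "a \<in> front_visible \<omega>" "a \<in> dyadic_square (Suc n) q"
      "square_hi (Suc n) q - margin / 2 ^ Suc n < proj u v a"
    unfolding near_hi_def by blast
  obtain i j x y where par: "q = (2 * i + x, 2 * j + y)" "x \<in> {0, 1}" "y \<in> {0, 1}"
    "(i, j) \<in> chosen \<omega> n" "a \<in> dyadic_square n (i, j)"
    by (rule parent_decomposition[OF q a(2)])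
  show "q \<in> child_squares (exposed n \<omega>) \<union> hi_child ` near_hi n \<omega>"
  proof (cases "proj u v a \<in> {square_lo n (i, j) + margin / 2 ^ n .. square_hi n (i, j) - margin / 2 ^ n}")
    case True
    then have "(i, j) \<in> exposed n \<omega>" by (rule exposed_if_not_near[OF n par(4) a(1) par(5)])
    then show ?thesis using par(1-3) by (auto simp: child_squares_def)
  next
    case False
    have "square_hi n (i, j) - margin / 2 ^ n < proj u v a \<and> q = hi_child (i, j)"
      unfolding par(1) by (rule near_hi_child[OF par(2,3) a(3)[unfolded par(1)]
            proj_dyadic_square(2)[OF a(2), unfolded par(1)] False])
    then show ?thesis using par(4,5) a(1) unfolding near_hi_def by blast
  qed
qed

lemma near_lo_Suc:
  assumes n: "n1 \<le> n"
  shows "near_lo (Suc n) \<omega> \<subseteq> child_squares (exposed n \<omega>) \<union> lo_child ` near_lo n \<omega>"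
proof
  fix q assume "q \<in> near_lo (Suc n) \<omega>"
  then obtain a where q: "q \<in> chosen \<omega> (Suc n)" and a: "a \<in> front_visible \<omega>" "a \<in> dyadic_square (Suc n) q"
      "proj u v a < square_lo (Suc n) q + margin / 2 ^ Suc n"
    unfolding near_lo_def by blast
  obtain i j x y where par: "q = (2 * i + x, 2 * j + y)" "x \<in> {0, 1}" "y \<in> {0, 1}"
    "(i, j) \<in> chosen \<omega> n" "a \<in> dyadic_square n (i, j)"
    by (rule parent_decomposition[OF q a(2)])
  show "q \<in> child_squares (exposed n \<omega>) \<union> lo_child ` near_lo n \<omega>"
  proof (cases "proj u v a \<in> {square_lo n (i, j) + margin / 2 ^ n .. square_hi n (i, j) - margin / 2 ^ n}")
    case True
    then have "(i, j) \<in> exposed n \<omega>" by (rule exposed_if_not_near[OF n par(4) a(1) par(5)])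
    then show ?thesis using par(1-3) by (auto simp: child_squares_def)
  next
    case False
    have "proj u v a < square_lo n (i, j) + margin / 2 ^ n \<and> q = lo_child (i, j)"
      unfolding par(1) by (rule near_lo_child[OF par(2,3) a(3)[unfolded par(1)]
            proj_dyadic_square(1)[OF a(2), unfolded par(1)] False])
    then show ?thesis using par(4,5) a(1) unfolding near_lo_def by blast
  qed
qed

text \<open>
  The squares of \<open>S\<close> at one level are extreme children of squares of \<open>S\<close>, at most one each, or children of
  exposed squares, so the recursion has no growth factor for the cardinality of \<open>S\<close>.
\<close>

lemma card_le_by_corner_recursion:
  assumes sub: "\<And>n. S n \<subseteq> chosen \<omega> n"
    and rec: "\<And>n. n1 \<le> n \<Longrightarrow> S (Suc n) \<subseteq> child_squares (exposed n \<omega>) \<union> f ` S n"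
  shows "card (S (n1 + k)) \<le> 4 ^ n1 + 4 * (\<Sum>m<n1 + k. card (exposed m \<omega>))"
proof (induction k)
  case 0
  have "card (S n1) \<le> card (chosen \<omega> n1)" by (rule card_mono[OF finite_chosen sub])
  also have "\<dots> \<le> 4 ^ n1" by (rule card_chosen_le)
  finally show ?case by simp
next
  case (Suc k)
  let ?n = "n1 + k"
  have fin: "finite (S ?n)" using sub finite_chosen by (rule finite_subset)
  have "card (S (Suc ?n)) \<le> card (child_squares (exposed ?n \<omega>) \<union> f ` S ?n)"
    using fin by (intro card_mono rec) (simp_all add: finite_child_squares finite_exposed)
  also have "\<dots> \<le> card (child_squares (exposed ?n \<omega>)) + card (f ` S ?n)" by (rule card_Un_le)
  also have "\<dots> \<le> 4 * card (exposed ?n \<omega>) + card (S ?n)"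
    by (intro add_mono card_child_squares_le finite_exposed card_image_le fin)
  finally show ?case using Suc.IH by simp
qed

lemma card_squares_meeting_front_visible:
  assumes "n1 \<le> n"
  shows "card {q \<in> chosen \<omega> n. dyadic_square n q \<inter> front_visible \<omega> \<noteq> {}} \<le>
      2 * 4 ^ n1 + 8 * (\<Sum>m\<le>n. card (exposed m \<omega>))"
proof -
  obtain k where k: "n = n1 + k" using assms le_Suc_ex by blast
  have hi: "card (near_hi n \<omega>) \<le> 4 ^ n1 + 4 * (\<Sum>m<n. card (exposed m \<omega>))"
    unfolding k by (rule card_le_by_corner_recursion[OF _ near_hi_Suc]) (auto simp: near_hi_def)
  have lo: "card (near_lo n \<omega>) \<le> 4 ^ n1 + 4 * (\<Sum>m<n. card (exposed m \<omega>))"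
    unfolding k by (rule card_le_by_corner_recursion[OF _ near_lo_Suc]) (auto simp: near_lo_def)
  have "{q \<in> chosen \<omega> n. dyadic_square n q \<inter> front_visible \<omega> \<noteq> {}} \<subseteq> exposed n \<omega> \<union> (near_hi n \<omega> \<union> near_lo n \<omega>)"
  proof
    fix q assume "q \<in> {q \<in> chosen \<omega> n. dyadic_square n q \<inter> front_visible \<omega> \<noteq> {}}"
    then obtain a where a: "q \<in> chosen \<omega> n" "a \<in> front_visible \<omega>" "a \<in> dyadic_square n q" by blast
    show "q \<in> exposed n \<omega> \<union> (near_hi n \<omega> \<union> near_lo n \<omega>)"
    proof (cases "proj u v a \<in> {square_lo n q + margin / 2 ^ n .. square_hi n q - margin / 2 ^ n}")
      case True
      then show ?thesis using exposed_if_not_near[OF assms a] by blast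
    next
      case False
      then have "proj u v a < square_lo n q + margin / 2 ^ n \<or> square_hi n q - margin / 2 ^ n < proj u v a"
        by auto
      then show ?thesis using a unfolding near_hi_def near_lo_def by blast
    qed
  qed
  moreover have "finite (exposed n \<omega> \<union> (near_hi n \<omega> \<union> near_lo n \<omega>))"
    using finite_exposed[of n \<omega>] finite_chosen[of \<omega> n] by (simp add: near_hi_def near_lo_def)
  ultimately have "card {q \<in> chosen \<omega> n. dyadic_square n q \<inter> front_visible \<omega> \<noteq> {}} \<le>
      card (exposed n \<omega> \<union> (near_hi n \<omega> \<union> near_lo n \<omega>))" by (rule card_mono[rotated])
  also have "\<dots> \<le> card (exposed n \<omega>) + (card (near_hi n \<omega>) + card (near_lo n \<omega>))"
    by (intro card_Un_le[THEN order_trans] add_mono card_Un_le order_refl)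
  also have "\<dots> \<le> card (exposed n \<omega>) + 2 * (4 ^ n1 + 4 * (\<Sum>m<n. card (exposed m \<omega>)))"
    unfolding mult_2 by (intro add_mono order_refl hi lo)
  also have "\<dots> \<le> 2 * 4 ^ n1 + 8 * (\<Sum>m\<le>n. card (exposed m \<omega>))"
    by (simp add: lessThan_Suc_atMost[symmetric])
  finally show ?thesis .
qed

end

end

section \<open>A zero-one law for hereditary properties\<close>

lemma prob_not:
  assumes "Measurable.pred (percolation_measure p) P"
  shows "measure (percolation_measure p) {\<omega>. \<not> P \<omega>} = 1 - measure (percolation_measure p) {\<omega>. P \<omega>}"
  using prob_space.prob_neg[OF prob_space_percolation_measure, of p P] assms
  by (simp add: sets_percolation_iff_pred)

text \<open>
  The percolations below the four squares of level one are independent copies of the whole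
  percolation.
\<close>

lemma prob_forall_children:
  assumes p: "0 \<le> p" "p \<le> 1" and [measurable]: "Measurable.pred (percolation_measure p) R"
    and det: "determined_by (below 0 (0, 0)) R" and "finite C"
  shows "measure (percolation_measure p) {\<omega>. \<forall>q\<in>C. \<omega> (1, q) \<longrightarrow> R (\<omega> \<circ> subtree 1 q)} =
     (1 - p + p * measure (percolation_measure p) {\<omega>. R \<omega>}) ^ card C"
  using \<open>finite C\<close>
proof induction
  case empty
  then show ?case using prob_space.prob_space[OF prob_space_percolation_measure, of p] by simp
next
  case (insert q C)
  interpret prob_space "percolation_measure p" by (rule prob_space_percolation_measure)
  define K where "K q = insert (1, q) (below 1 q)" for q :: "nat \<times> nat"
  have K_disj: "K q \<inter> K q' = {}" if "q \<noteq> q'" for q q'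
    using below_disjoint[OF that, of 1] that by (cases q; cases q') (auto simp: K_def in_below_iff)
  have shift: "determined_by (below 1 q) (\<lambda>\<omega>. R (\<omega> \<circ> subtree 1 q))" for q
  proof (rule determined_byI)
    fix \<omega> \<omega>' :: "nat \<times> nat \<times> nat \<Rightarrow> bool"
    assume *: "\<And>k. k \<in> below 1 q \<Longrightarrow> \<omega> k = \<omega>' k"
    show "R (\<omega> \<circ> subtree 1 q) = R (\<omega>' \<circ> subtree 1 q)"
    proof (rule determined_byD[OF det])
      fix k assume "k \<in> below 0 (0, 0)"
      then have "subtree 1 q k \<in> below 1 q" by (auto simp: below_def subtree_0)
      then show "(\<omega> \<circ> subtree 1 q) k = (\<omega>' \<circ> subtree 1 q) k" by (simp add: *)
    qed
  qed
  have det_q: "determined_by (K q) (\<lambda>\<omega>. \<omega> (1, q) \<longrightarrow> R (\<omega> \<circ> subtree 1 q))" for q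
  proof (rule determined_byI)
    fix \<omega> \<omega>' :: "nat \<times> nat \<times> nat \<Rightarrow> bool"
    assume *: "\<And>k. k \<in> K q \<Longrightarrow> \<omega> k = \<omega>' k"
    have "R (\<omega> \<circ> subtree 1 q) = R (\<omega>' \<circ> subtree 1 q)"
      by (rule determined_byD[OF shift], rule *) (simp add: K_def)
    then show "(\<omega> (1, q) \<longrightarrow> R (\<omega> \<circ> subtree 1 q)) = (\<omega>' (1, q) \<longrightarrow> R (\<omega>' \<circ> subtree 1 q))"
      using *[of "(1, q)"] by (simp add: K_def)
  qed
  have det_C: "determined_by (\<Union>q\<in>C. K q) (\<lambda>\<omega>. \<forall>q\<in>C. \<omega> (1, q) \<longrightarrow> R (\<omega> \<circ> subtree 1 q))"
  proof (rule determined_byI, rule ball_cong[OF refl])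
    fix \<omega> \<omega>' :: "nat \<times> nat \<times> nat \<Rightarrow> bool" and q
    assume *: "\<And>k. k \<in> (\<Union>q\<in>C. K q) \<Longrightarrow> \<omega> k = \<omega>' k" and "q \<in> C"
    show "(\<omega> (1, q) \<longrightarrow> R (\<omega> \<circ> subtree 1 q)) = (\<omega>' (1, q) \<longrightarrow> R (\<omega>' \<circ> subtree 1 q))"
      by (rule determined_byD[OF det_q], rule *) (use \<open>q \<in> C\<close> in blast)
  qed
  have meas_q [measurable]: "Measurable.pred (percolation_measure p) (\<lambda>\<omega>. R (\<omega> \<circ> subtree 1 q))" for q
    by measurable
  have [measurable]: "Measurable.pred (percolation_measure p) (\<lambda>\<omega>. \<forall>q\<in>C. \<omega> (1, q) \<longrightarrow> R (\<omega> \<circ> subtree 1 q))"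
    using insert(1) by (intro pred_intros_finite) auto
  have "prob {\<omega>. \<omega> (1, q) \<and> \<not> R (\<omega> \<circ> subtree 1 q)} = prob {\<omega>. \<omega> (1, q)} * prob {\<omega>. \<not> R (\<omega> \<circ> subtree 1 q)}"
  proof (rule prob_conj_determined_by)
    show "determined_by {(1, q)} (\<lambda>\<omega>. \<omega> (1, q))" by (rule determined_byI) simp
    show "determined_by (below 1 q) (\<lambda>\<omega>. \<not> R (\<omega> \<circ> subtree 1 q))"
      using shift[of q] unfolding determined_by_def by simp
    show "{(1, q)} \<inter> below 1 q = {}" by (cases q) (auto simp: in_below_iff)
  qed measurable
  also have "prob {\<omega>. \<not> R (\<omega> \<circ> subtree 1 q)} = prob {\<omega>. \<not> R \<omega>}"
    by (rule prob_reindex[OF inj_subtree, where P = "\<lambda>\<omega>. \<not> R \<omega>"]) measurable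
  also have "\<dots> = 1 - prob {\<omega>. R \<omega>}"
    by (rule prob_not) measurable
  finally have "prob {\<omega>. \<omega> (1, q) \<and> \<not> R (\<omega> \<circ> subtree 1 q)} = p * (1 - prob {\<omega>. R \<omega>})"
    by (simp only: prob_toss[OF p])
  moreover have "prob {\<omega>. \<not> (\<omega> (1, q) \<and> \<not> R (\<omega> \<circ> subtree 1 q))} =
      1 - prob {\<omega>. \<omega> (1, q) \<and> \<not> R (\<omega> \<circ> subtree 1 q)}"
    by (rule prob_not) measurable
  ultimately have "prob {\<omega>. \<omega> (1, q) \<longrightarrow> R (\<omega> \<circ> subtree 1 q)} = 1 - p + p * prob {\<omega>. R \<omega>}"
    by (simp add: algebra_simps)
  moreover have "prob {\<omega>. (\<omega> (1, q) \<longrightarrow> R (\<omega> \<circ> subtree 1 q)) \<and> (\<forall>q\<in>C. \<omega> (1, q) \<longrightarrow> R (\<omega> \<circ> subtree 1 q))} =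
      prob {\<omega>. \<omega> (1, q) \<longrightarrow> R (\<omega> \<circ> subtree 1 q)} * prob {\<omega>. \<forall>q\<in>C. \<omega> (1, q) \<longrightarrow> R (\<omega> \<circ> subtree 1 q)}"
  proof (rule prob_conj_determined_by)
    show "determined_by (K q) (\<lambda>\<omega>. \<omega> (1, q) \<longrightarrow> R (\<omega> \<circ> subtree 1 q))" by (rule det_q)
    show "determined_by (\<Union>q\<in>C. K q) (\<lambda>\<omega>. \<forall>q\<in>C. \<omega> (1, q) \<longrightarrow> R (\<omega> \<circ> subtree 1 q))" by (rule det_C)
    have "\<forall>q'\<in>C. K q \<inter> K q' = {}" by (intro ballI K_disj) (use insert(2) in auto)
    then show "K q \<inter> (\<Union>q\<in>C. K q) = {}" by (simp add: Int_UN_distrib)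
  qed measurable
  ultimately have "prob {\<omega>. (\<omega> (1, q) \<longrightarrow> R (\<omega> \<circ> subtree 1 q)) \<and> (\<forall>q\<in>C. \<omega> (1, q) \<longrightarrow> R (\<omega> \<circ> subtree 1 q))} =
      (1 - p + p * prob {\<omega>. R \<omega>}) * (1 - p + p * prob {\<omega>. R \<omega>}) ^ card C"
    unfolding insert.IH by simp
  moreover have "{\<omega>. \<forall>q\<in>insert q C. \<omega> (1, q) \<longrightarrow> R (\<omega> \<circ> subtree 1 q)} =
      {\<omega>. (\<omega> (1, q) \<longrightarrow> R (\<omega> \<circ> subtree 1 q)) \<and> (\<forall>q\<in>C. \<omega> (1, q) \<longrightarrow> R (\<omega> \<circ> subtree 1 q))}"
    by auto
  ultimately show ?case by (simp only: card_insert_disjoint[OF insert(1,2)] power_Suc)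
qed

text \<open>
  With \<open>g s = 1 - p + p * s\<close>, the quotient \<open>(1 - g s ^ 4) / (1 - s)\<close> equals \<open>p * (1 + g s + g s ^ 2 + g s ^ 3)\<close>,
  which is strictly increasing; it is at most \<open>1\<close> at \<open>x\<close> and at least \<open>1\<close> at \<open>y\<close>.
\<close>

lemma generating_function_fixed_points:
  fixes p x y :: real
  assumes p: "0 < p" and x: "x \<le> (1 - p + p * x) ^ 4" "x < 1" and y: "(1 - p + p * y) ^ 4 \<le> y" "0 \<le> y" "p \<le> 1"
  shows "x \<le> y"
proof (rule ccontr)
  assume "\<not> x \<le> y"
  then have "y < x" by simp
  define G where "G s = 1 + s + s\<^sup>2 + s ^ 3" for s :: real
  define a where "a = 1 - p + p * x"
  define b where "b = 1 - p + p * y"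
  have ab: "0 \<le> b" "b < a" using p y \<open>y < x\<close> by (auto simp: a_def b_def)
  have fac: "1 - s ^ 4 = (1 - s) * G s" for s :: real
    by (simp add: G_def algebra_simps power2_eq_square power3_eq_cube power4_eq_xxxx)
  have "(1 - x) * (p * G a) \<le> (1 - x) * 1"
    using x(1) fac[of a] by (simp add: a_def algebra_simps)
  then have "p * G a \<le> 1" using x(2) by simp
  moreover have "(1 - y) * 1 \<le> (1 - y) * (p * G b)"
    using y(1) fac[of b] by (simp add: b_def algebra_simps)
  then have "1 \<le> p * G b" using x(2) \<open>y < x\<close> by simp
  moreover have "G b < G a"
    unfolding G_def using ab by (intro add_le_less_mono add_mono order_refl power_mono power_strict_mono) auto
  then have "p * G b < p * G a" using p by simp
  ultimately show False by linarith
qed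

lemma percolation_set_empty_if_chosen_empty: "chosen \<omega> n = {} \<Longrightarrow> percolation_set \<omega> = {}"
  using percolation_set_in_chosen[of _ \<omega> n] by blast

lemma chosen_empty_mono:
  assumes "chosen \<omega> m = {}" "m \<le> n"
  shows "chosen \<omega> n = {}"
  using assms(2,1) by (induction rule: dec_induct) auto

lemma below_root: "below 0 (0, 0) = {(n, i, j). 0 < n \<and> i < 2 ^ n \<and> j < 2 ^ n}"
  by (auto simp: below_def subtree_0)

lemma subtree_below_root:
  assumes "fst q < 2 ^ m" "snd q < 2 ^ m" "k \<in> below 0 (0, 0)"
  shows "subtree m q k \<in> below 0 (0, 0)"
proof -
  obtain n i j where k: "k = (n, i, j)" "0 < n" "i < 2 ^ n" "j < 2 ^ n" using assms(3) by (auto simp: below_root)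
  have "a * 2 ^ n + b < 2 ^ (m + n)" if "a < 2 ^ m" "b < 2 ^ n" for a b :: nat
  proof -
    have "a * 2 ^ n + b < (a + 1) * 2 ^ n" using that by simp
    also have "\<dots> \<le> 2 ^ m * 2 ^ n" using that by (intro mult_right_mono) auto
    finally show ?thesis by (simp add: power_add)
  qed
  then show ?thesis using k assms by (simp add: below_root subtree_def)
qed

text \<open>
  Let \<open>Z\<close> say that no chosen square has the property \<open>S\<close>.  Then \<open>Z\<close> is inherited by the chosen squares of
  level one, while extinction follows from extinction in all of them.  Then \<open>generating_function_fixed_points\<close> compares
  the two probabilities, and extinction implies \<open>Z\<close>, so \<open>Z\<close> and extinction differ by a null set.
\<close>

lemma AE_nonempty_imp_subtree:
  assumes p: "0 < p" "p \<le> 1"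
    and meas[measurable]: "Measurable.pred (percolation_measure p) S"
    and det: "determined_by (below 0 (0, 0)) S"
    and pos: "0 < measure (percolation_measure p) {\<omega>. S \<omega>}"
    and alive: "\<And>\<omega> n. S \<omega> \<Longrightarrow> chosen \<omega> n \<noteq> {}"
  shows "AE \<omega> in percolation_measure p. percolation_set \<omega> \<noteq> {} \<longrightarrow>
           (\<exists>m. \<exists>q\<in>chosen \<omega> m. S (\<omega> \<circ> subtree m q))"
proof -
  interpret prob_space "percolation_measure p" by (rule prob_space_percolation_measure)
  define C :: "(nat \<times> nat) set" where "C = {0, 1} \<times> {0, 1}"
  have C: "finite C" "card C = 4" by (simp_all add: C_def)
  define Dead where "Dead \<omega> \<longleftrightarrow> (\<exists>n. chosen \<omega> n = {})" for \<omega>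
  define Z where "Z \<omega> \<longleftrightarrow> (\<forall>m q. q \<in> chosen \<omega> m \<longrightarrow> \<not> S (\<omega> \<circ> subtree m q))" for \<omega>
  have [measurable]: "Measurable.pred (percolation_measure p) Dead" unfolding Dead_def[abs_def] by measurable
  have [measurable]: "Measurable.pred (percolation_measure p) Z" unfolding Z_def[abs_def] by measurable
  have chosen_det: "chosen \<omega> n = chosen \<omega>' n" if "\<And>k. k \<in> below 0 (0, 0) \<Longrightarrow> \<omega> k = \<omega>' k" for \<omega> \<omega>' n
    by (rule chosen_cong, rule that) (simp add: below_root)
  have det_Dead: "determined_by (below 0 (0, 0)) Dead"
  proof (rule determined_byI)
    fix \<omega> \<omega>' :: "nat \<times> nat \<times> nat \<Rightarrow> bool"
    assume *: "\<And>k. k \<in> below 0 (0, 0) \<Longrightarrow> \<omega> k = \<omega>' k"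
    have "chosen \<omega> n = chosen \<omega>' n" for n by (rule chosen_det) (rule *)
    then show "Dead \<omega> = Dead \<omega>'" by (simp add: Dead_def)
  qed
  have det_Z: "determined_by (below 0 (0, 0)) Z"
  proof (rule determined_byI)
    fix \<omega> \<omega>' :: "nat \<times> nat \<times> nat \<Rightarrow> bool"
    assume *: "\<And>k. k \<in> below 0 (0, 0) \<Longrightarrow> \<omega> k = \<omega>' k"
    have ch: "chosen \<omega> m = chosen \<omega>' m" for m by (rule chosen_det) (rule *)
    have "S (\<omega> \<circ> subtree m q) = S (\<omega>' \<circ> subtree m q)" if "q \<in> chosen \<omega> m" for m q
    proof (rule determined_byD[OF det])
      fix k assume "k \<in> below 0 (0, 0)"
      moreover have "fst q < 2 ^ m" "snd q < 2 ^ m" using that chosen_index_less[of _ _ \<omega> m] by (cases q; auto)+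
      ultimately have "subtree m q k \<in> below 0 (0, 0)" by (intro subtree_below_root)
      then show "(\<omega> \<circ> subtree m q) k = (\<omega>' \<circ> subtree m q) k" by (simp add: *)
    qed
    then show "Z \<omega> = Z \<omega>'" unfolding Z_def ch[symmetric] by auto
  qed
  have child: "q \<in> chosen \<omega> 1 \<longleftrightarrow> q \<in> C \<and> \<omega> (1, q)" for \<omega> q
    by (cases q) (auto simp: C_def)
  have Z_le: "prob {\<omega>. Z \<omega>} \<le> (1 - p + p * prob {\<omega>. Z \<omega>}) ^ 4"
  proof -
    have "{\<omega>. Z \<omega>} \<subseteq> {\<omega>. \<forall>q\<in>C. \<omega> (1, q) \<longrightarrow> Z (\<omega> \<circ> subtree 1 q)}"
    proof clarify
      fix \<omega> x y assume Z: "Z \<omega>" and c: "(x, y) \<in> C" "\<omega> (1, x, y)"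
      show "Z (\<omega> \<circ> subtree 1 (x, y))"
        unfolding Z_def
      proof clarify
        fix m i j assume ij: "(i, j) \<in> chosen (\<omega> \<circ> subtree 1 (x, y)) m"
          and S: "S (\<omega> \<circ> subtree 1 (x, y) \<circ> subtree m (i, j))"
        have "(x * 2 ^ m + i, y * 2 ^ m + j) \<in> chosen \<omega> (1 + m)"
          using chosen_subtree_iff[of i m j x y \<omega> 1] chosen_index_less[OF ij] ij child c by blast
        then show False using Z S unfolding Z_def comp_assoc subtree_comp by blast
      qed
    qed
    then have "prob {\<omega>. Z \<omega>} \<le> prob {\<omega>. \<forall>q\<in>C. \<omega> (1, q) \<longrightarrow> Z (\<omega> \<circ> subtree 1 q)}"
      using C(1) by (intro finite_measure_mono)
        (auto simp: sets_percolation_iff_pred intro!: pred_intros_finite)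
    also have "\<dots> = (1 - p + p * prob {\<omega>. Z \<omega>}) ^ card C"
      using p C(1) det_Z by (intro prob_forall_children) auto
    finally show ?thesis by (simp add: C(2))
  qed
  have Dead_ge: "(1 - p + p * prob {\<omega>. Dead \<omega>}) ^ 4 \<le> prob {\<omega>. Dead \<omega>}"
  proof -
    have "{\<omega>. \<forall>q\<in>C. \<omega> (1, q) \<longrightarrow> Dead (\<omega> \<circ> subtree 1 q)} \<subseteq> {\<omega>. Dead \<omega>}"
    proof clarify
      fix \<omega> assume "\<forall>q\<in>C. \<omega> (1, q) \<longrightarrow> Dead (\<omega> \<circ> subtree 1 q)"
      then have "\<forall>q\<in>chosen \<omega> 1. \<exists>n. chosen (\<omega> \<circ> subtree 1 q) n = {}" using child unfolding Dead_def by blast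
      then obtain N where N: "\<And>q. q \<in> chosen \<omega> 1 \<Longrightarrow> chosen (\<omega> \<circ> subtree 1 q) (N q) = {}" by metis
      define n where "n = (\<Sum>q\<in>chosen \<omega> 1. N q)"
      have "chosen (\<omega> \<circ> subtree 1 q) n = {}" if "q \<in> chosen \<omega> 1" for q
      proof (rule chosen_empty_mono[OF N[OF that]])
        show "N q \<le> n" unfolding n_def using that by (intro member_le_sum finite_chosen) auto
      qed
      then have none: "chosen (\<omega> \<circ> subtree 1 (a, b)) n = {}" if "(a, b) \<in> chosen \<omega> 1" for a b
        using that by blast
      have "(I, J) \<notin> chosen \<omega> (1 + n)" for I J
      proof
        assume IJ: "(I, J) \<in> chosen \<omega> (1 + n)"
        have eq: "I = (I div 2 ^ n) * 2 ^ n + I mod 2 ^ n" "J = (J div 2 ^ n) * 2 ^ n + J mod 2 ^ n"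
          by (rule div_mult_mod_eq[symmetric])+
        have "(I div 2 ^ n, J div 2 ^ n) \<in> chosen \<omega> 1 \<and>
            (I mod 2 ^ n, J mod 2 ^ n) \<in> chosen (\<omega> \<circ> subtree 1 (I div 2 ^ n, J div 2 ^ n)) n"
          using chosen_subtree_iff[of "I mod 2 ^ n" n "J mod 2 ^ n" "I div 2 ^ n" "J div 2 ^ n" \<omega> 1] IJ
          unfolding eq[symmetric] by (simp del: chosen.simps)
        then show False using none by blast
      qed
      then have "chosen \<omega> (1 + n) = {}" by auto
      then show "Dead \<omega>" unfolding Dead_def by blast
    qed
    then have "prob {\<omega>. \<forall>q\<in>C. \<omega> (1, q) \<longrightarrow> Dead (\<omega> \<circ> subtree 1 q)} \<le> prob {\<omega>. Dead \<omega>}"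
      by (intro finite_measure_mono) (auto simp: sets_percolation_iff_pred)
    moreover have "prob {\<omega>. \<forall>q\<in>C. \<omega> (1, q) \<longrightarrow> Dead (\<omega> \<circ> subtree 1 q)} = (1 - p + p * prob {\<omega>. Dead \<omega>}) ^ card C"
      using p C(1) det_Dead by (intro prob_forall_children) auto
    ultimately show ?thesis by (simp add: C(2))
  qed
  have Z_lt: "prob {\<omega>. Z \<omega>} < 1"
  proof -
    have "Z \<omega> \<Longrightarrow> \<not> S \<omega>" for \<omega>
      unfolding Z_def by (metis chosen.simps(1) comp_id singletonI subtree_0)
    then have "prob {\<omega>. Z \<omega>} \<le> prob {\<omega>. \<not> S \<omega>}"
      by (intro finite_measure_mono) (auto simp: sets_percolation_iff_pred)
    also have "\<dots> = 1 - prob {\<omega>. S \<omega>}" by (rule prob_not[OF meas])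
    finally show ?thesis using pos by simp
  qed
  have "prob {\<omega>. Z \<omega>} \<le> prob {\<omega>. Dead \<omega>}"
    by (rule generating_function_fixed_points[OF p(1) Z_le Z_lt Dead_ge]) (use p in auto)
  moreover have sub: "{\<omega>. Dead \<omega>} \<subseteq> {\<omega>. Z \<omega>}"
  proof clarify
    fix \<omega> assume "Dead \<omega>"
    then obtain n where n: "chosen \<omega> n = {}" by (auto simp: Dead_def)
    show "Z \<omega>" unfolding Z_def
    proof clarify
      fix m a b assume ab: "(a, b) \<in> chosen \<omega> m" and S: "S (\<omega> \<circ> subtree m (a, b))"
      obtain i j where ij: "(i, j) \<in> chosen (\<omega> \<circ> subtree m (a, b)) n" using alive[OF S, of n] by auto
      then have "(a * 2 ^ n + i, b * 2 ^ n + j) \<in> chosen \<omega> (m + n)"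
        using chosen_subtree_iff[of i n j a b \<omega> m] chosen_index_less[OF ij] ab by blast
      then show False using chosen_empty_mono[OF n, of "m + n"] by simp
    qed
  qed
  moreover have "prob ({\<omega>. Z \<omega>} - {\<omega>. Dead \<omega>}) = prob {\<omega>. Z \<omega>} - prob {\<omega>. Dead \<omega>}"
    using sub by (intro finite_measure_Diff) (auto simp: sets_percolation_iff_pred)
  ultimately have "prob ({\<omega>. Z \<omega>} - {\<omega>. Dead \<omega>}) = 0"
    using measure_nonneg[of "percolation_measure p" "{\<omega>. Z \<omega>} - {\<omega>. Dead \<omega>}"] by linarith
  then have "{\<omega>. Z \<omega>} - {\<omega>. Dead \<omega>} \<in> null_sets (percolation_measure p)"
    by (intro null_setsI) (auto simp: emeasure_eq_measure sets_percolation_iff_pred intro!: sets.Diff)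
  then have "AE \<omega> in percolation_measure p. \<omega> \<notin> {\<omega>. Z \<omega>} - {\<omega>. Dead \<omega>}" by (rule AE_not_in)
  then show ?thesis
    by (rule eventually_mono) (auto simp: Z_def Dead_def dest: percolation_set_empty_if_chosen_empty)
qed

section \<open>Visible parts from a line\<close>

lemma is_line_normal_form:
  fixes l :: "(real \<times> real) set"
  assumes "is_line l"
  obtains u v c where "u\<^sup>2 + v\<^sup>2 = 1" "l = {z. u * fst z + v * snd z = c}"
proof -
  have "affine l" "aff_dim l = int (DIM(real \<times> real)) - 1" using assms by (simp_all add: is_line_def)
  then have "\<exists>a b. a \<noteq> 0 \<and> affine hull l = {x. a \<bullet> x = b}"
    by (intro aff_dim_eq_hyperplane[THEN iffD1]) simp
  then obtain a b where ab: "a \<noteq> 0" "affine hull l = {x. a \<bullet> x = b}" by (elim exE conjE)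
  have l: "l = {x. a \<bullet> x = b}" using ab(2) \<open>affine l\<close> affine_hull_eq[of l] by metis
  obtain a1 a2 where a: "a = (a1, a2)" by (cases a)
  define N where "N = sqrt (a1\<^sup>2 + a2\<^sup>2)"
  have "a1\<^sup>2 + a2\<^sup>2 \<noteq> 0" using ab(1) by (auto simp: a sum_power2_eq_zero_iff zero_prod_def)
  then have N: "N\<^sup>2 = a1\<^sup>2 + a2\<^sup>2" "N \<noteq> 0" by (auto simp: N_def)
  show ?thesis
  proof (rule that)
    show "(a1 / N)\<^sup>2 + (a2 / N)\<^sup>2 = 1"
      unfolding power_divide add_divide_distrib[symmetric] N(1)[symmetric] using N(2) by simp
    show "l = {z. a1 / N * fst z + a2 / N * snd z = b / N}"
      using N(2) unfolding l by (auto simp: a inner_prod_def add_divide_distrib[symmetric])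
  qed
qed

lemma orth_proj_line:
  fixes u v c :: real
  assumes "u\<^sup>2 + v\<^sup>2 = 1"
  shows "orth_proj {z. u * fst z + v * snd z = c} a =
    (fst a - (u * fst a + v * snd a - c) * u, snd a - (u * fst a + v * snd a - c) * v)"
proof (rule orth_proj_eqI)
  define d where "d = u * fst a + v * snd a - c"
  have "u * (fst a - d * u) + v * (snd a - d * v) = u * fst a + v * snd a - d * (u\<^sup>2 + v\<^sup>2)"
    by (simp add: algebra_simps power2_eq_square)
  then have on: "u * (fst a - d * u) + v * (snd a - d * v) = c" by (simp add: assms d_def)
  then show "(fst a - (u * fst a + v * snd a - c) * u, snd a - (u * fst a + v * snd a - c) * v)
      \<in> {z. u * fst z + v * snd z = c}" by (simp add: d_def)
  fix w assume w: "w \<in> {z. u * fst z + v * snd z = c}"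
  have "d * u * (fst w - (fst a - d * u)) + d * v * (snd w - (snd a - d * v)) =
      d * ((u * fst w + v * snd w) - (u * (fst a - d * u) + v * (snd a - d * v)))"
    by (simp add: algebra_simps)
  also have "\<dots> = 0" using on w by simp
  finally show "orthogonal (a - (fst a - (u * fst a + v * snd a - c) * u, snd a - (u * fst a + v * snd a - c) * v))
      (w - (fst a - (u * fst a + v * snd a - c) * u, snd a - (u * fst a + v * snd a - c) * v))"
    unfolding d_def[symmetric] by (simp add: orthogonal_def inner_prod_def)
qed

lemma compact_percolation_set: "compact (percolation_set \<omega>)"
proof -
  have "closed (percolation_set \<omega>)"
    unfolding percolation_set_def
    by (intro closed_INT ballI compact_imp_closed compact_UN finite_chosen compact_dyadic_square)
  moreover have "percolation_set \<omega> \<subseteq> dyadic_square 0 (0, 0)"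
    using percolation_set_in_chosen[of _ \<omega> 0] by auto
  then have "bounded (percolation_set \<omega>)" using bounded_dyadic_square bounded_subset by blast
  ultimately show ?thesis by (simp add: compact_eq_bounded_closed)
qed

lemma abs_proj_diff_le_dist:
  assumes "u\<^sup>2 + v\<^sup>2 = 1"
  shows "\<bar>proj u v x - proj u v y\<bar> \<le> dist x y"
proof -
  have "proj u v x - proj u v y = (- v, u) \<bullet> (x - y)"
    by (simp add: proj_def inner_prod_def algebra_simps)
  then have "\<bar>proj u v x - proj u v y\<bar> \<le> norm (- v, u) * norm (x - y)"
    using Cauchy_Schwarz_ineq2[of "(- v, u)" "x - y"] by simp
  moreover have "norm (- v, u) = 1" using assms by (simp add: norm_prod_def add.commute)
  ultimately show ?thesis by (simp add: dist_norm)
qed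

text \<open>
  By Fatou's lemma the lower limit of the \<open>f n\<close> has finite integral.
\<close>

lemma AE_frequently_bounded:
  assumes [measurable]: "\<And>n. f n \<in> borel_measurable M"
    and bound: "\<And>n::nat. (\<integral>\<^sup>+x. f n x \<partial>M) \<le> ennreal C"
  shows "AE x in M. \<exists>B::real. \<forall>N. \<exists>n\<ge>N. f n x \<le> ennreal B"
proof -
  have "(\<integral>\<^sup>+x. liminf (\<lambda>n. f n x) \<partial>M) \<le> liminf (\<lambda>n. \<integral>\<^sup>+x. f n x \<partial>M)"
    by (rule nn_integral_liminf) measurable
  also have "\<dots> \<le> ennreal C"
    by (rule Liminf_le) (use bound in auto)
  finally have "(\<integral>\<^sup>+x. liminf (\<lambda>n. f n x) \<partial>M) \<noteq> \<infinity>" by (auto simp: top_unique)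
  then have "AE x in M. liminf (\<lambda>n. f n x) \<noteq> \<infinity>"
    by (intro nn_integral_noteq_infinite) measurable
  then show ?thesis
  proof (rule eventually_mono)
    fix x assume "liminf (\<lambda>n. f n x) \<noteq> \<infinity>"
    then obtain b where b: "0 \<le> b" "liminf (\<lambda>n. f n x) = ennreal b" by (cases "liminf (\<lambda>n. f n x)") auto
    have "\<exists>n\<ge>N. f n x \<le> ennreal (b + 1)" for N
    proof -
      have "(INF n\<in>{N..}. f n x) \<le> liminf (\<lambda>n. f n x)"
        unfolding liminf_SUP_INF by (rule SUP_upper) simp
      also have "\<dots> < ennreal (b + 1)" unfolding b(2) using b(1) by (simp add: ennreal_less_iff)
      finally show ?thesis unfolding INF_less_iff by (auto intro: less_imp_le)
    qed
    then show "\<exists>B::real. \<forall>N. \<exists>n\<ge>N. f n x \<le> ennreal B" by blast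
  qed
qed

context viewing
begin

abbreviation "view_line \<equiv> {z. u * fst z + v * snd z = c}"

lemma orth_proj_view_line:
  "orth_proj view_line a = (fst a - (depth a - c) * u, snd a - (depth a - c) * v)"
  unfolding orth_proj_line[OF unit] depth_def ..

lemma depth_along_segment:
  "depth (fst a - s * u, snd a - s * v) = depth a - s"
  "proj u v (fst a - s * u, snd a - s * v) = proj u v a"
proof -
  have "depth (fst a - s * u, snd a - s * v) = depth a - s * (u\<^sup>2 + v\<^sup>2)"
    by (simp add: depth_def algebra_simps power2_eq_square)
  then show "depth (fst a - s * u, snd a - s * v) = depth a - s" by (simp add: unit)
  show "proj u v (fst a - s * u, snd a - s * v) = proj u v a"
    by (simp add: proj_def algebra_simps)
qed

lemma in_segment_iff:
  "z \<in> closed_segment a (orth_proj view_line a) \<longleftrightarrow>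
     (\<exists>s. 0 \<le> s \<and> s \<le> 1 \<and> z = (fst a - s * (depth a - c) * u, snd a - s * (depth a - c) * v))"
  unfolding orth_proj_view_line in_segment
  by (intro ex_cong1) (auto simp: prod_eq_iff algebra_simps)

lemma visible_part_subset_front_visible:
  assumes a: "a \<in> visible_part view_line (percolation_set \<omega>)" and "c < depth a"
  shows "a \<in> front_visible \<omega>"
  unfolding front_visible_def
proof (intro CollectI conjI ballI impI notI)
  show "a \<in> percolation_set \<omega>" using a by (simp add: visible_part_def)
  show "c < depth a" by fact
  fix b assume b: "b \<in> percolation_set \<omega>" "proj u v b = proj u v a" "c < depth b" "depth b < depth a"
  define s where "s = (depth a - depth b) / (depth a - c)"
  have s: "0 \<le> s" "s \<le> 1" "s * (depth a - c) = depth a - depth b"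
    using b assms(2) by (auto simp: s_def)
  have "b = (fst a - s * (depth a - c) * u, snd a - s * (depth a - c) * v)"
    unfolding s(3) using difference_along_view[OF b(2)] by (simp add: prod_eq_iff algebra_simps)
  then have "b \<in> closed_segment a (orth_proj view_line a)" unfolding in_segment_iff using s by blast
  then have "b = a" using a b(1) unfolding visible_part_def by blast
  then show False using b(4) by simp
qed

text \<open>
  The point of the percolation set nearest to the line on the segment from \<open>a\<close> to its foot point is
  visible and has the same foot point.
\<close>

lemma proj_visible_part:
  assumes a: "a \<in> percolation_set \<omega>"
  shows "proj u v a \<in> proj u v ` visible_part view_line (percolation_set \<omega>)"
proof -
  define S where "S = closed_segment a (orth_proj view_line a) \<inter> percolation_set \<omega>"
  have "compact S" unfolding S_def by (intro compact_Int compact_segment compact_percolation_set)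
  moreover have "a \<in> S" using a by (simp add: S_def)
  moreover have "continuous_on S (\<lambda>z. \<bar>depth z - c\<bar>)" unfolding depth_def by (intro continuous_intros)
  ultimately obtain b where b: "b \<in> S" "\<And>z. z \<in> S \<Longrightarrow> \<bar>depth b - c\<bar> \<le> \<bar>depth z - c\<bar>"
    using continuous_attains_inf[of S "\<lambda>z. \<bar>depth z - c\<bar>"] by blast
  have b_seg: "b \<in> closed_segment a (orth_proj view_line a)" using b(1) by (simp add: S_def)
  then obtain s where s: "0 \<le> s" "s \<le> 1" "b = (fst a - s * (depth a - c) * u, snd a - s * (depth a - c) * v)"
    unfolding in_segment_iff by (elim exE conjE)
  have pb: "proj u v b = proj u v a" unfolding s(3) by (rule depth_along_segment)
  have db: "depth b = depth a - s * (depth a - c)" unfolding s(3) by (rule depth_along_segment)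
  have same: "orth_proj view_line b = orth_proj view_line a"
    unfolding orth_proj_view_line db by (simp add: s(3) algebra_simps)
  have sub: "closed_segment b (orth_proj view_line b) \<subseteq> closed_segment a (orth_proj view_line a)"
    unfolding same using b_seg by (simp add: subset_closed_segment)
  have "z = b" if z: "z \<in> closed_segment b (orth_proj view_line b)" "z \<in> percolation_set \<omega>" for z
  proof -
    obtain r where r: "0 \<le> r" "r \<le> 1" "z = (fst b - r * (depth b - c) * u, snd b - r * (depth b - c) * v)"
      using z(1) unfolding in_segment_iff by (elim exE conjE)
    have "depth z = depth b - r * (depth b - c)" unfolding r(3) by (rule depth_along_segment)
    then have "depth z - c = (1 - r) * (depth b - c)" by (simp add: algebra_simps)
    then have "\<bar>depth z - c\<bar> = (1 - r) * \<bar>depth b - c\<bar>" using r by (simp add: abs_mult)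
    moreover have "\<bar>depth b - c\<bar> \<le> \<bar>depth z - c\<bar>" using z sub by (intro b(2)) (auto simp: S_def)
    ultimately have "r * \<bar>depth b - c\<bar> \<le> 0" by (simp add: algebra_simps)
    then have "r * (depth b - c) = 0" using r(1) by (auto simp: mult_le_0_iff)
    then show ?thesis unfolding r(3) by (simp only:) simp
  qed
  then have "b \<in> visible_part view_line (percolation_set \<omega>)"
    using b(1) by (auto simp: visible_part_def S_def)
  then show ?thesis using pb by (metis imageI)
qed

lemma core_nontrivial: "square_lo n q + margin / 2 / 2 ^ n < square_hi n q - margin / 2 / 2 ^ n"
proof -
  have "1 \<le> \<bar>u\<bar> + \<bar>v\<bar>"
  proof -
    have "u\<^sup>2 \<le> \<bar>u\<bar>" "v\<^sup>2 \<le> \<bar>v\<bar>"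
      using abs_direction_le_1 mult_left_le[of "\<bar>u\<bar>" "\<bar>u\<bar>"] mult_left_le[of "\<bar>v\<bar>" "\<bar>v\<bar>"]
      by (simp_all add: power2_eq_square)
    then show ?thesis using unit by linarith
  qed
  moreover have "2 * margin \<le> \<bar>u\<bar>" "2 * margin \<le> \<bar>v\<bar>" by (auto simp: margin_def)
  ultimately have "margin < \<bar>u\<bar> + \<bar>v\<bar>" using margin_nonneg by linarith
  then have "margin / 2 ^ n < (\<bar>u\<bar> + \<bar>v\<bar>) / 2 ^ n" by (rule divide_strict_right_mono) simp
  moreover have "square_hi n q = square_lo n q + (\<bar>u\<bar> + \<bar>v\<bar>) / 2 ^ n"
    unfolding square_hi_def square_lo_def shadow_length[symmetric] by (simp add: add_divide_distrib[symmetric])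
  moreover have "margin / 2 / 2 ^ n = margin / 2 ^ n / 2" by simp
  ultimately show ?thesis by linarith
qed

lemma AE_visible_part_pos:
  "AE \<omega> in percolation_measure p. percolation_set \<omega> \<noteq> {} \<longrightarrow>
     0 < hausdorff_measure 1 (visible_part view_line (percolation_set \<omega>))"
proof -
  have det: "determined_by (below 0 (0, 0)) (covers u v (margin / 2))"
  proof (rule determined_byI)
    fix \<omega> \<omega>' :: "nat \<times> nat \<times> nat \<Rightarrow> bool"
    assume *: "\<And>k. k \<in> below 0 (0, 0) \<Longrightarrow> \<omega> k = \<omega>' k"
    have "chosen \<omega> n = chosen \<omega>' n" for n by (rule chosen_cong, rule *) (simp add: below_root)
    then show "covers u v (margin / 2) \<omega> = covers u v (margin / 2) \<omega>'" by (simp add: covers_def)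
  qed
  have alive: "chosen \<omega> n \<noteq> {}" if "covers u v (margin / 2) \<omega>" for \<omega> n
  proof -
    have "shadow_lo u v + margin / 2 \<in> {shadow_lo u v + margin / 2 .. shadow_hi u v - margin / 2}"
      using core_nontrivial[of 0 "(0, 0)"] by (simp add: square_lo_def square_hi_def)
    then show ?thesis using that unfolding covers_def by blast
  qed
  have "AE \<omega> in percolation_measure p. percolation_set \<omega> \<noteq> {} \<longrightarrow>
      (\<exists>m. \<exists>q\<in>chosen \<omega> m. covers u v (margin / 2) (\<omega> \<circ> subtree m q))"
    by (rule AE_nonempty_imp_subtree[OF _ _ pred_covers det prob_covers_margin_pos alive]) (use p in auto)
  then show ?thesis
  proof (rule eventually_mono, intro impI)
    fix \<omega> assume "percolation_set \<omega> \<noteq> {} \<longrightarrow>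
      (\<exists>m. \<exists>q\<in>chosen \<omega> m. covers u v (margin / 2) (\<omega> \<circ> subtree m q))" "percolation_set \<omega> \<noteq> {}"
    then obtain m q where q: "q \<in> chosen \<omega> m" "opaque m q \<omega>" unfolding opaque_def by blast
    let ?a = "square_lo m q + margin / 2 / 2 ^ m" and ?b = "square_hi m q - margin / 2 / 2 ^ m"
    have "{?a..?b} \<subseteq> proj u v ` visible_part view_line (percolation_set \<omega>)"
    proof
      fix t assume "t \<in> {?a..?b}"
      then obtain z where "z \<in> percolation_set \<omega>" "proj u v z = t"
        using opaque_hit[OF q, of t] unfolding core_def by blast
      then show "t \<in> proj u v ` visible_part view_line (percolation_set \<omega>)" using proj_visible_part by blast
    qed
    then have "ennreal (?b - ?a) \<le> hausdorff_measure 1 (visible_part view_line (percolation_set \<omega>))"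
      by (rule interval_length_le_hausdorff_measure_1[OF abs_proj_diff_le_dist[OF unit]])
    moreover have "0 < ennreal (?b - ?a)" using core_nontrivial[of m q] by (simp add: ennreal_less_zero_iff)
    ultimately show "0 < hausdorff_measure 1 (visible_part view_line (percolation_set \<omega>))"
      by (rule less_le_trans[rotated])
  qed
qed

text \<open>
  The bounds for the two sides of the line are added before Fatou's lemma is applied, as both have to be
  effective at the same levels.
\<close>

lemma AE_visible_part_finite:
  "AE \<omega> in percolation_measure p. percolation_set \<omega> \<inter> view_line = {} \<longrightarrow>
     hausdorff_measure 1 (visible_part view_line (percolation_set \<omega>)) < \<infinity>"
proof -
  interpret behind: viewing "- u" "- v" "- c" p by unfold_locales (use unit p in auto)
  have behind_depth: "behind.depth z = - depth z" for z by (simp add: behind.depth_def depth_def)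
  have behind_line: "behind.view_line = view_line" by auto
  define f where "f n \<omega> = ennreal (1 / 2 ^ n) * (exposed_upto n \<omega> + behind.exposed_upto n \<omega>)" for n \<omega>
  have b0: "0 \<le> exposed_bound" "0 \<le> behind.exposed_bound"
    using strip_width_pos behind.strip_width_pos by (simp_all add: exposed_bound_def behind.exposed_bound_def)
  have ennreal_combine: "ennreal r * (ennreal x + ennreal y) = ennreal (r * (x + y))" if "0 \<le> r" "0 \<le> x" "0 \<le> y" for r x y
    using that by (simp add: ennreal_mult flip: ennreal_plus)
  have "AE \<omega> in percolation_measure p. \<exists>B::real. \<forall>N. \<exists>n\<ge>N. f n \<omega> \<le> ennreal B"
  proof (rule AE_frequently_bounded)
    show "f n \<in> borel_measurable (percolation_measure p)" for n unfolding f_def by measurable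
    fix n
    have "(\<integral>\<^sup>+\<omega>. f n \<omega> \<partial>percolation_measure p) = ennreal (1 / 2 ^ n) *
        ((\<integral>\<^sup>+\<omega>. exposed_upto n \<omega> \<partial>percolation_measure p) + (\<integral>\<^sup>+\<omega>. behind.exposed_upto n \<omega> \<partial>percolation_measure p))"
      unfolding f_def by (simp add: nn_integral_cmult nn_integral_add)
    also have "\<dots> \<le> ennreal (1 / 2 ^ n) * (ennreal (2 * exposed_bound * 2 ^ n) + ennreal (2 * behind.exposed_bound * 2 ^ n))"
      by (intro mult_left_mono add_mono expected_exposed_upto_le behind.expected_exposed_upto_le) simp
    also have "\<dots> = ennreal (1 / 2 ^ n * (2 * exposed_bound * 2 ^ n + 2 * behind.exposed_bound * 2 ^ n))"
      by (rule ennreal_combine) (use b0 in simp_all)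
    also have "1 / 2 ^ n * (2 * exposed_bound * 2 ^ n + 2 * behind.exposed_bound * 2 ^ n) =
        2 * (exposed_bound + behind.exposed_bound)"
      by (simp add: field_simps)
    finally show "(\<integral>\<^sup>+\<omega>. f n \<omega> \<partial>percolation_measure p) \<le> ennreal (2 * (exposed_bound + behind.exposed_bound))" .
  qed
  then show ?thesis
  proof (rule eventually_mono, intro impI)
    fix \<omega> assume "\<exists>B::real. \<forall>N. \<exists>n\<ge>N. f n \<omega> \<le> ennreal B" and disj: "percolation_set \<omega> \<inter> view_line = {}"
    then obtain B where B: "\<And>N. \<exists>n\<ge>N. f n \<omega> \<le> ennreal B" by blast
    have closed: "closed view_line" by (intro closed_Collect_eq continuous_intros)
    obtain n1 where n1: "\<forall>q\<in>chosen \<omega> n1. dyadic_square n1 q \<inter> view_line = {}"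
      using disj unfolding percolation_set_disjoint_iff[OF closed] by blast
    have avoid': "dyadic_square n q \<inter> view_line = {}" if nq: "n1 \<le> n" "q \<in> chosen \<omega> n" for n q
    proof -
      obtain k where k: "n = n1 + k" using le_Suc_ex[OF nq(1)] by blast
      obtain i j where q: "q = (i, j)" by (cases q)
      have "(i div 2 ^ k, j div 2 ^ k) \<in> chosen \<omega> n1" using nq(2) unfolding k q by (rule chosen_parent)
      then have "dyadic_square n1 (i div 2 ^ k, j div 2 ^ k) \<inter> view_line = {}" by (rule n1[rule_format])
      moreover have "dyadic_square n q \<inter> view_line \<subseteq> dyadic_square n1 (i div 2 ^ k, j div 2 ^ k) \<inter> view_line"
        unfolding k q by (rule Int_mono[OF dyadic_square_ancestor order_refl])
      ultimately show ?thesis by (simp only: subset_empty)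
    qed
    have avoid: "dyadic_square n q \<inter> {z. depth z = c} = {}" if "n1 \<le> n" "q \<in> chosen \<omega> n" for n q
      using avoid'[OF that] unfolding depth_def .
    have behind_avoid: "dyadic_square n q \<inter> {z. behind.depth z = - c} = {}" if "n1 \<le> n" "q \<in> chosen \<omega> n" for n q
      using avoid[OF that] unfolding behind_depth by simp
    let ?V = "visible_part view_line (percolation_set \<omega>)"
    define B' where "B' = max 0 B"
    have "hausdorff_measure 1 ?V \<le> ennreal (2 * (4 * 4 ^ n1 + 8 * B'))"
    proof (rule hausdorff_measure_1_le_dyadic)
      fix N
      obtain n where n: "max N n1 \<le> n" "f n \<omega> \<le> ennreal B" using B by blast
      define D where "D = {q \<in> chosen \<omega> n. dyadic_square n q \<inter> front_visible \<omega> \<noteq> {}}"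
      define D' where "D' = {q \<in> chosen \<omega> n. dyadic_square n q \<inter> behind.front_visible \<omega> \<noteq> {}}"
      define s where "s = (\<Sum>m\<le>n. card (exposed m \<omega>))"
      define s' where "s' = (\<Sum>m\<le>n. card (behind.exposed m \<omega>))"
      define P :: nat where "P = 4 ^ n1"
      have "card D \<le> 2 * P + 8 * s"
        unfolding D_def s_def P_def by (rule card_squares_meeting_front_visible[OF avoid]) (use n in auto)
      moreover have "card D' \<le> 2 * P + 8 * s'"
        unfolding D'_def s'_def P_def by (rule behind.card_squares_meeting_front_visible[OF behind_avoid]) (use n in auto)
      ultimately have "card (D \<union> D') \<le> (2 * P + 8 * s) + (2 * P + 8 * s')"
        by (intro card_Un_le[THEN order_trans] add_mono)
      also have "\<dots> = 4 * P + 8 * (s + s')" by simp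
      finally have "real (card (D \<union> D')) \<le> real (4 * P + 8 * (s + s'))" by (simp only: of_nat_le_iff)
      then have card: "real (card (D \<union> D')) \<le> 4 * 4 ^ n1 + 8 * real (s + s')" by (simp add: P_def)
      have "ennreal (real (s + s') / 2 ^ n) = ennreal (1 / 2 ^ n) * (of_nat s + of_nat s')"
        by (simp add: ennreal_of_nat_eq_real_of_nat flip: ennreal_plus ennreal_mult)
      also have "\<dots> \<le> f n \<omega>"
        unfolding f_def s_def s'_def
        by (intro mult_left_mono add_mono card_exposed_sum_le behind.card_exposed_sum_le) simp
      also have "\<dots> \<le> ennreal (B')" using n(2) by (rule order_trans) (simp add: B'_def ennreal_leI)
      finally have "real (s + s') / 2 ^ n \<le> B'"
        by (rule ennreal_le_iff[THEN iffD1, rotated]) (simp add: B'_def)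
      then have ss: "real (s + s') \<le> B' * 2 ^ n" by (simp add: field_simps)
      note card
      also have "4 * 4 ^ n1 + 8 * real (s + s') \<le> 4 * 4 ^ n1 * 2 ^ n + 8 * (B' * 2 ^ n)"
        by (intro add_mono mult_left_mono ss) simp_all
      also have "\<dots> = (4 * 4 ^ n1 + 8 * B') * 2 ^ n" by (simp add: algebra_simps)
      finally have "real (card (D \<union> D')) \<le> (4 * 4 ^ n1 + 8 * B') * 2 ^ n" .
      moreover have "finite (D \<union> D')" by (simp add: D_def D'_def finite_chosen)
      moreover have "?V \<subseteq> (\<Union>q\<in>D \<union> D'. dyadic_square n q)"
      proof
        fix a assume a: "a \<in> ?V"
        then have aE: "a \<in> percolation_set \<omega>" by (simp add: visible_part_def)
        then obtain q where q: "q \<in> chosen \<omega> n" "a \<in> dyadic_square n q" using percolation_set_in_chosen by blast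
        have "depth a \<noteq> c" using aE disj by (auto simp: depth_def)
        then consider "c < depth a" | "- c < behind.depth a" unfolding behind_depth by linarith
        then show "a \<in> (\<Union>q\<in>D \<union> D'. dyadic_square n q)"
        proof cases
          case 1
          then have "q \<in> D" using visible_part_subset_front_visible[OF a] q by (auto simp: D_def)
          then show ?thesis using q(2) by blast
        next
          case 2
          then have "q \<in> D'"
            using behind.visible_part_subset_front_visible[unfolded behind_line, OF a] q by (auto simp: D'_def)
          then show ?thesis using q(2) by blast
        qed
      qed
      ultimately show "\<exists>n\<ge>N. \<exists>D. finite D \<and> ?V \<subseteq> (\<Union>q\<in>D. dyadic_square n q) \<and>
          real (card D) \<le> (4 * 4 ^ n1 + 8 * B') * 2 ^ n"
        using n(1) by (intro exI[of _ n] conjI exI[of _ "D \<union> D'"]) auto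
    qed
    then show "hausdorff_measure 1 ?V < \<infinity>" by (rule le_less_trans) simp
  qed
qed

end

theorem theorem1p5:
  fixes p :: real and l :: "(real \<times> real) set"
  assumes "is_line l" and "1 / 2 < p" and "p < 1"
  shows "AE \<omega> in conditioned_percolation p l.
           0 < hausdorff_measure 1 (visible_part l (percolation_set \<omega>)) \<and>
           hausdorff_measure 1 (visible_part l (percolation_set \<omega>)) < \<infinity>"
proof -
  have "affine l" using assms(1) by (simp add: is_line_def)
  obtain u v c where uv: "u\<^sup>2 + v\<^sup>2 = 1" and l: "l = {z. u * fst z + v * snd z = c}"
    using is_line_normal_form[OF assms(1)] .
  interpret viewing u v c p by unfold_locales (use uv assms in auto)
  show ?thesis
    unfolding AE_conditioned_percolation_iff[OF \<open>affine l\<close>]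
    using AE_visible_part_pos AE_visible_part_finite unfolding l by eventually_elim blast
qed

end
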